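(* Let $A$ be a densely defined, $m$-accretive linear operator in $L^1(\mathbb{R}^d)$ satisfying the positivity property (P) stated in the context. Let $T>0$ and let $u\ge 0$ be a classical solution of $$\partial_t u + A\big(\kappa(t,x)\,\varphi(u)\big)=0 \quad\text{on } [0,T],$$ belonging to $L^1(\mathbb{R}^d)\cap L^\infty(\mathbb{R}^d)$. Assume that $\varphi$ is non-decreasing, that $\varphi(0)=0$, and that for some $m>0$ and $\theta\in\{-1,1\}$ $$\inf_{u> 0}\left\{\theta\,\frac{\varphi(u)\varphi''(u)}{(\varphi'(u))^2}\right\}\ge m .$$ Assume also that $\kappa$ is positive and that, for some constant $L>0$, $$\kappa(t,x),\ \kappa(t,x)^{-1},\ |\partial_t\kappa(t,x)|,\ |\partial_{tt}\kappa(t,x)|\ \le L\quad\text{for all } t\in[0,T],\ x\in\mathbb{R}^d .$$ Then there exists a constant $\rho>0$, depending only on $m$, $L$ and $T$, such that for every $x$ the map $$t\mapsto \theta\, t^{\rho\theta}\,\kappa(t,x)\,\varphi(u(t,x))$$ is non-decreasing in $[0,T]$ (in $(0,T]$ when $\theta=-1$).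
   Context: Property (P) of the operator $A$: if $u\in L^1(\mathbb{R}^d)\cap L^\infty(\mathbb{R}^d)$ (with $A(u)$ defined), $\beta$ is a monotone graph in $\mathbb{R}\times\mathbb{R}$ with $0\in\beta(0)$, and $v\in\beta(u)$ almost everywhere, then $\int_{\mathbb{R}^d} v\,A(u)\,dx\ge 0$. The model case is $A=-\Delta$. "$m$-accretive" is the standard notion for operators in a Banach space (the letter $m$ there is unrelated to the constant $m$ in the claim). A classical solution is one for which the derivatives involved exist and the equation holds pointwise. No regularity of $\kappa$ in $x$ is assumed.
   Formalization: A classical solution is also required to have its time derivative continuous in t on (0,T] with values in L^1; "for every x" is proved as for almost every x, and for every x at which κ(t,·)φ(u(t,·)) is continuous for all t in the interval. *)

theory Defs
  imports "HOL-Analysis.Analysis"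
begin

text \<open>
  \<open>R^d\<close> is rendered as the space of real functions on \<open>{..<d}\<close> (extensional, i.e. \<open>undefined\<close>
  outside \<open>{..<d}\<close>), so that the dimension is an ordinary natural number and constants can be
  asserted not to depend on it.
\<close>

definition leb :: "nat \<Rightarrow> (nat \<Rightarrow> real) measure" where
  "leb d = completion (Pi\<^sub>M {..<d} (\<lambda>_. lborel))"

definition L1 :: "'a measure \<Rightarrow> ('a \<Rightarrow> real) set" where
  "L1 M = {f. integrable M f}"

definition Linf :: "'a measure \<Rightarrow> ('a \<Rightarrow> real) set" where
  "Linf M = {f \<in> borel_measurable M. \<exists>C. AE x in M. \<bar>f x\<bar> \<le> C}"

definition norm1 :: "'a measure \<Rightarrow> ('a \<Rightarrow> real) \<Rightarrow> real" where
  "norm1 M f = (LINT x|M. \<bar>f x\<bar>)"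

text \<open>
  Elements of the Banach space \<open>L^1\<close> are handled through representatives.  An operator is given by
  its graph \<open>A\<close>: \<open>(f, g) \<in> A\<close> means that \<open>f\<close> represents an element of the domain and \<open>g\<close>
  represents its image.  The saturation clause makes \<open>A\<close> a relation between a.e.-classes.
\<close>

type_synonym 'a l1_operator = "(('a \<Rightarrow> real) \<times> ('a \<Rightarrow> real)) set"

definition linear_operator_L1 :: "'a measure \<Rightarrow> 'a l1_operator \<Rightarrow> bool" where
  "linear_operator_L1 M A \<longleftrightarrow>
     A \<subseteq> L1 M \<times> L1 M \<and>
     (\<forall>f g f' g'. (f, g) \<in> A \<and> f' \<in> L1 M \<and> g' \<in> L1 M \<and>
        (AE x in M. f' x = f x) \<and> (AE x in M. g' x = g x) \<longrightarrow> (f', g') \<in> A) \<and>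
     (\<forall>f g g'. (f, g) \<in> A \<and> (f, g') \<in> A \<longrightarrow> (AE x in M. g x = g' x)) \<and>
     ((\<lambda>_. 0), (\<lambda>_. 0)) \<in> A \<and>
     (\<forall>f g f' g'. (f, g) \<in> A \<and> (f', g') \<in> A \<longrightarrow> ((\<lambda>x. f x + f' x), (\<lambda>x. g x + g' x)) \<in> A) \<and>
     (\<forall>c f g. (f, g) \<in> A \<longrightarrow> ((\<lambda>x. c * f x), (\<lambda>x. c * g x)) \<in> A)"

definition densely_defined_L1 :: "'a measure \<Rightarrow> 'a l1_operator \<Rightarrow> bool" where
  "densely_defined_L1 M A \<longleftrightarrow>
     (\<forall>f \<in> L1 M. \<forall>\<epsilon>>0. \<exists>g \<in> Domain A. norm1 M (\<lambda>x. f x - g x) < \<epsilon>)"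

definition accretive_L1 :: "'a measure \<Rightarrow> 'a l1_operator \<Rightarrow> bool" where
  "accretive_L1 M A \<longleftrightarrow>
     (\<forall>r>0. \<forall>f g f' g'. (f, g) \<in> A \<and> (f', g') \<in> A \<longrightarrow>
        norm1 M (\<lambda>x. f x - f' x) \<le> norm1 M (\<lambda>x. (f x - f' x) + r * (g x - g' x)))"

definition m_accretive_L1 :: "'a measure \<Rightarrow> 'a l1_operator \<Rightarrow> bool" where
  "m_accretive_L1 M A \<longleftrightarrow> accretive_L1 M A \<and>
     (\<forall>r>0. \<forall>h \<in> L1 M. \<exists>(f, g) \<in> A. AE x in M. f x + r * g x = h x)"

definition monotone_graph :: "(real \<times> real) set \<Rightarrow> bool" where
  "monotone_graph \<beta> \<longleftrightarrow> (\<forall>(a, b) \<in> \<beta>. \<forall>(a', b') \<in> \<beta>. (a - a') * (b - b') \<ge> 0)"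

text \<open>In property (P) the selection \<open>v\<close> ranges over those for which the integral makes sense.\<close>

definition property_P :: "'a measure \<Rightarrow> 'a l1_operator \<Rightarrow> bool" where
  "property_P M A \<longleftrightarrow>
     (\<forall>u g \<beta> v. u \<in> L1 M \<inter> Linf M \<and> (u, g) \<in> A \<and>
        monotone_graph \<beta> \<and> (0, 0) \<in> \<beta> \<and>
        v \<in> borel_measurable M \<and> (AE x in M. (u x, v x) \<in> \<beta>) \<and>
        integrable M (\<lambda>x. v x * g x)
        \<longrightarrow> (LINT x|M. v x * g x) \<ge> 0)"

text \<open>
  The time derivative exists at every point (one-sided at \<open>0\<close> and \<open>T\<close>), the equation holds for
  every \<open>t \<in> [0,T]\<close> as an identity in \<open>L^1\<close>, and \<open>t \<mapsto> \<partial>\<^sub>t u(t)\<close> is continuous into \<open>L^1\<close> on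
  \<open>(0,T]\<close>, as in the usual notion of a classical solution of an abstract Cauchy problem.
  The last requirement cannot be dropped: for \<open>A = -\<Delta>\<close>, \<open>\<kappa> = 1\<close>, \<open>\<phi>(u) = u^p\<close> with \<open>1 < p < 2\<close>,
  let \<open>u\<close> vanish for \<open>t \<le> t\<^sub>0\<close> and be the Barenblatt solution issued from a Dirac mass
  at \<open>(t\<^sub>0, 0)\<close> afterwards, redefined as \<open>0\<close> on the null set \<open>x = 0\<close>.
\<close>

definition classical_solution ::
  "'a measure \<Rightarrow> 'a l1_operator \<Rightarrow> (real \<Rightarrow> 'a \<Rightarrow> real) \<Rightarrow> (real \<Rightarrow> real) \<Rightarrow> real \<Rightarrow>
   (real \<Rightarrow> 'a \<Rightarrow> real) \<Rightarrow> bool" where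
  "classical_solution M A \<kappa> \<phi> T u \<longleftrightarrow>
     (\<exists>u\<^sub>t.
        (\<forall>t \<in> {0..T}. \<forall>x \<in> space M.
           ((\<lambda>s. u s x) has_real_derivative u\<^sub>t t x) (at t within {0..T})) \<and>
        (\<forall>t \<in> {0..T}. ((\<lambda>x. \<kappa> t x * \<phi> (u t x)), (\<lambda>x. - u\<^sub>t t x)) \<in> A) \<and>
        (\<forall>t \<in> {0<..T}.
           ((\<lambda>s. norm1 M (\<lambda>x. u\<^sub>t s x - u\<^sub>t t x)) \<longlongrightarrow> 0) (at t within {0<..T})))"

definition admissible_coefficient ::
  "'a measure \<Rightarrow> real \<Rightarrow> real \<Rightarrow> (real \<Rightarrow> 'a \<Rightarrow> real) \<Rightarrow> bool" where
  "admissible_coefficient M T L \<kappa> \<longleftrightarrow>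
     (\<forall>t \<in> {0..T}. \<kappa> t \<in> borel_measurable M) \<and>
     (\<exists>\<kappa>\<^sub>t \<kappa>\<^sub>t\<^sub>t. \<forall>t \<in> {0..T}. \<forall>x \<in> space M.
        ((\<lambda>s. \<kappa> s x) has_real_derivative \<kappa>\<^sub>t t x) (at t within {0..T}) \<and>
        ((\<lambda>s. \<kappa>\<^sub>t s x) has_real_derivative \<kappa>\<^sub>t\<^sub>t t x) (at t within {0..T}) \<and>
        0 < \<kappa> t x \<and> \<kappa> t x \<le> L \<and> inverse (\<kappa> t x) \<le> L \<and>
        \<bar>\<kappa>\<^sub>t t x\<bar> \<le> L \<and> \<bar>\<kappa>\<^sub>t\<^sub>t t x\<bar> \<le> L)"

text \<open>
  Only the values of \<open>\<phi>\<close> on \<open>[0,\<infinity>)\<close> matter, and \<open>\<phi>\<close> need not be differentiable at \<open>0\<close>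
  (e.g. \<open>u^p\<close> with \<open>p < 1\<close>).  Since \<open>m > 0\<close> and \<open>x / 0 = 0\<close>, the last clause forces
  \<open>deriv \<phi> u \<noteq> 0\<close> for \<open>u > 0\<close>.
\<close>

definition admissible_nonlinearity :: "real \<Rightarrow> real \<Rightarrow> (real \<Rightarrow> real) \<Rightarrow> bool" where
  "admissible_nonlinearity m \<theta> \<phi> \<longleftrightarrow>
     mono_on {0..} \<phi> \<and> \<phi> 0 = 0 \<and> continuous_on {0..} \<phi> \<and>
     (\<forall>r>0. \<phi> differentiable (at r) \<and> deriv \<phi> differentiable (at r)) \<and>
     (INF r \<in> {0<..}. ereal (\<theta> * (\<phi> r * deriv (deriv \<phi>) r / (deriv \<phi> r)\<^sup>2))) \<ge> ereal m"

end

theory Submission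
  imports Defs
begin

text \<open>
Let \<open>w = \<kappa> \<phi>(u)\<close>, and let \<open>v = t^(\<theta> \<rho>) w\<close> be the function in question.  The equation says that
\<open>A v = - f\<close> with \<open>f = t^(\<theta> \<rho>) \<partial>\<^sub>t u\<close>.  Property (P), applied to \<open>\<theta> (v(t) - v(s))\<close> and the Heaviside graph, gives
for all \<open>s < t\<close> that the integral of \<open>\<theta> (f(t) - f(s))\<close> over the set where \<open>\<theta> v(t) < \<theta> v(s)\<close> is
non-negative (\<open>half_space_test\<close>).  These bad sets have to be shown to be null.

If one divides by \<open>t - s\<close> and lets \<open>t - s\<close> tend to \<open>0\<close>, one arrives at the usual argument, a maximum
principle for \<open>t \<partial>\<^sub>t w + \<theta> \<rho> w\<close>.  It needs a second time derivative of \<open>u\<close>, or else, for difference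
quotients, it meets a product of \<open>\<partial>\<^sub>t u\<close> with \<open>\<phi> \<phi>'' / \<phi>'\<^sup>2\<close>, which is bounded from one side only.  The proof
therefore works with all pairs of times at once: the inequality is integrated over \<open>s < t\<close> with a
weight that behaves like \<open>1 / (t - s)\<close>.  Then, at each point \<open>x\<close> separately, all time derivatives of
\<open>u\<close> can be removed by integration by parts, in \<open>s\<close> for the part with \<open>f(s)\<close> and in \<open>t\<close> for the part with
\<open>f(t)\<close> (\<open>path_inequality\<close>).  For this one compares \<open>u(s)\<close> with the value at time \<open>s\<close> that has the weighted
level \<open>v(t)\<close>, and \<open>u(t)\<close> with the value at time \<open>t\<close> that has the weighted level \<open>v(s)\<close>.  These transported
values satisfy an ordinary differential equation with the rate \<open>V = \<phi> / \<phi>'\<close>, so that no derivative of \<open>V\<close>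
occurs.

What remains in the interior is non-negative by a pointwise inequality between the four values
(\<open>lag_inequality\<close>).  The curvature condition means that \<open>exp (- (\<theta> - m) y) V\<close> is non-increasing as a function
of \<open>y = \<theta> ln \<phi>\<close>.  A monotone function is at the end of an interval at most its mean over the interval
(\<open>shift_average_inequality\<close>), and with the weight \<open>1 / (t - s)\<close> exactly these means occur.  The exponent \<open>\<rho>\<close>
has to be large compared with \<open>1 / m\<close> and with the bounds of \<open>ln \<kappa>\<close>.

Three boundary terms are left.  The one at the last time controls the size of the bad sets.  The
one on the diagonal vanishes in the limit, since both comparisons measure the violation by
the same amount to first order (\<open>crossing_defect_small\<close>) and the difference quotients of \<open>u\<close> converge in
\<open>L\<^sup>1\<close> (\<open>defect_tendsto\<close>).  The one at the first time vanishes because time is measured logarithmically from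
a positive instant \<open>s\<^sub>0\<close>: in \<open>\<sigma> = ln (t - s\<^sub>0)\<close> the initial time is \<open>-\<infinity>\<close>, where the derivative of \<open>u\<close>
decays like \<open>exp \<sigma>\<close> (\<open>final_zero\<close>).  Hence \<open>\<theta> (t - s\<^sub>0)^(\<theta> \<rho>) w\<close> is non-decreasing almost everywhere, and \<open>s\<^sub>0\<close>
tends to \<open>0\<close>.
\<close>

section \<open>Integration by parts on the set where a function is positive\<close>

text \<open>
The function \<open>F\<close> may change sign infinitely often, and its derivative is merely integrable; the
set where \<open>F\<close> is positive then contributes no boundary terms besides those of the interval.
\<close>

lemma integral_positive_part_by_parts:
  fixes F F' w w' :: "real \<Rightarrow> real"
  assumes ab: "a \<le> b"
    and F: "\<And>x. x \<in> {a..b} \<Longrightarrow> (F has_real_derivative F' x) (at x within {a..b})"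
    and F'_int: "set_integrable lborel {a..b} F'"
    and w: "\<And>x. x \<in> {a..b} \<Longrightarrow> (w has_real_derivative w' x) (at x within {a..b})"
    and w'_cont: "continuous_on {a..b} w'"
  shows "(LBINT x:{a..b}. w x * (if 0 < F x then F' x else 0)) =
    w b * max 0 (F b) - w a * max 0 (F a) - (LBINT x:{a..b}. w' x * max 0 (F x))"
proof -
  define e where "e n = 1 / real (Suc n)" for n
  have e_pos: "0 < e n" for n by (simp add: e_def)
  have e_lim: "e \<longlonglongrightarrow> 0" unfolding e_def by (rule LIMSEQ_Suc[OF lim_1_over_n])
  \<comment> \<open>The square root smooths the positive part into functions \<open>\<eta> n\<close> that are differentiable
    everywhere and whose derivative at \<open>0\<close> is \<open>0\<close>, so that it tends to the indicator of
    \<open>{0<..}\<close> also on the set where \<open>F\<close> vanishes.\<close>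
  define \<eta> where "\<eta> n r = sqrt ((max 0 r)\<^sup>2 + e n)" for n and r :: real
  have sqpos: "0 < (max 0 r)\<^sup>2 + e n" for r n
    using e_pos[of n] by (simp add: add_nonneg_pos)
  have \<eta>_pos: "0 < \<eta> n r" for n r using sqpos by (simp add: \<eta>_def)
  have sq_deriv: "((\<lambda>r. (max 0 r)\<^sup>2) has_real_derivative 2 * max 0 r) (at r)" for r :: real
  proof -
    consider "r < 0" | "r = 0" | "0 < r" by linarith
    then show ?thesis
    proof cases
      case 1
      have "((\<lambda>r. 0) has_real_derivative 2 * max 0 r) (at r)" using 1 by auto
      then show ?thesis
        by (rule has_field_derivative_transform_within[where d="-r"]) (use 1 in \<open>auto simp: dist_real_def\<close>)
    next
      case 2
      have "((\<lambda>h. (max 0 h)\<^sup>2 / h) \<longlongrightarrow> 0) (at (0::real))"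
      proof (rule Lim_null_comparison)
        show "\<forall>\<^sub>F x in at (0::real). norm ((max 0 x)\<^sup>2 / x) \<le> \<bar>x\<bar>"
          by (intro always_eventually) (auto simp: max_def power2_eq_square)
        show "((\<lambda>x::real. \<bar>x\<bar>) \<longlongrightarrow> 0) (at 0)"
          by (rule tendsto_eq_intros | simp)+
      qed
      then show ?thesis using 2 by (simp add: has_field_derivative_iff)
    next
      case 3
      have "((\<lambda>r. r\<^sup>2) has_real_derivative 2 * max 0 r) (at r)" using 3
        by (auto intro!: derivative_eq_intros)
      then show ?thesis
        by (rule has_field_derivative_transform_within[where d="r"]) (use 3 in \<open>auto simp: dist_real_def max_def\<close>)
    qed
  qed
  have \<eta>_deriv: "(\<eta> n has_real_derivative max 0 r / \<eta> n r) (at r)" for n r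
  proof -
    have "((\<lambda>r. (max 0 r)\<^sup>2 + e n) has_real_derivative 2 * max 0 r) (at r)"
      using DERIV_add[OF sq_deriv[of r] DERIV_const[of "e n"]] by simp
    from DERIV_chain2[OF DERIV_real_sqrt[OF sqpos] this] show ?thesis
      by (simp add: \<eta>_def[abs_def] field_simps)
  qed
  have Fc: "continuous_on {a..b} F"
    by (rule DERIV_continuous_on[OF F])
  have wc: "continuous_on {a..b} w"
    by (rule DERIV_continuous_on[OF w])
  have \<eta>c: "continuous_on UNIV (\<eta> n)" for n
    using \<eta>_deriv by (auto intro!: continuous_at_imp_continuous_on DERIV_isCont)
  have \<eta>Fc: "continuous_on {a..b} (\<lambda>x. \<eta> n (F x))" for n
    using continuous_on_compose2[OF \<eta>c Fc] by auto
  define q where "q n x = max 0 (F x) / \<eta> n (F x)" for n x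
  have qc: "continuous_on {a..b} (q n)" for n
    unfolding q_def using \<eta>_pos by (intro continuous_intros \<eta>Fc Fc) (metis less_irrefl)
  have q01: "0 \<le> q n x" "q n x \<le> 1" for n x
  proof -
    show "0 \<le> q n x" using \<eta>_pos[of n "F x"] by (simp add: q_def)
    have "max 0 (F x) = sqrt ((max 0 (F x))\<^sup>2)" by simp
    also have "\<dots> \<le> \<eta> n (F x)" unfolding \<eta>_def using e_pos[of n] by (intro real_sqrt_le_mono) simp
    finally show "q n x \<le> 1" using \<eta>_pos[of n "F x"] by (simp add: q_def)
  qed
  obtain K where K: "\<And>x. x \<in> {a..b} \<Longrightarrow> \<bar>w x\<bar> \<le> K"
  proof -
    obtain k where "\<forall>x\<in>{a..b}. \<bar>w x\<bar> \<le> k"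
      using compact_imp_bounded[OF compact_continuous_image[OF wc]] by (auto simp: bounded_iff)
    then show ?thesis using that by blast
  qed
  have meas: "set_borel_measurable lborel {a..b} f" if "continuous_on {a..b} f" for f :: "real \<Rightarrow> real"
    unfolding set_borel_measurable_def
    using borel_measurable_continuous_on_indicator[of "{a..b}" f] that by simp
  have F'm: "(\<lambda>x. indicator {a..b} x * F' x) \<in> borel_measurable borel"
    using borel_measurable_integrable[OF F'_int[unfolded set_integrable_def]] by simp
  have qm: "(\<lambda>x. indicator {a..b} x * q n x) \<in> borel_measurable borel" for n
    using meas[OF qc] by (simp add: set_borel_measurable_def)
  have wm: "(\<lambda>x. indicator {a..b} x * w x) \<in> borel_measurable borel"
    using meas[OF wc] by (simp add: set_borel_measurable_def)
  have prod_m: "(\<lambda>x. indicator {a..b} x * (w x * (q n x * F' x))) \<in> borel_measurable borel" for n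
  proof -
    have "(\<lambda>x. (indicator {a..b} x * w x) * ((indicator {a..b} x * q n x) * (indicator {a..b} x * F' x)))
        \<in> borel_measurable borel" using F'm qm wm by measurable
    then show ?thesis by (rule measurable_cong[THEN iffD1, rotated]) (auto split: split_indicator)
  qed
  have bnd: "integrable lborel (\<lambda>x. K * (indicator {a..b} x * \<bar>F' x\<bar>))"
    using set_integrable_abs[OF F'_int] by (auto simp: set_integrable_def)
  have dom: "\<bar>indicator {a..b} x * (w x * (q n x * F' x))\<bar> \<le> K * (indicator {a..b} x * \<bar>F' x\<bar>)" for n x
  proof (cases "x \<in> {a..b}")
    case True
    have "\<bar>w x\<bar> * (q n x * \<bar>F' x\<bar>) \<le> K * (1 * \<bar>F' x\<bar>)"
      by (intro mult_mono K True q01) (auto simp: q01 order_trans[OF abs_ge_zero K[OF True]])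
    then show ?thesis using True q01[of n x] by (simp add: abs_mult)
  qed simp
  have i1: "set_integrable lborel {a..b} (\<lambda>x. w x * (q n x * F' x))" for n
    unfolding set_integrable_def
    by (rule Bochner_Integration.integrable_bound[OF bnd], use prod_m in simp)
      (intro AE_I2, simp only: real_norm_def real_scaleR_def, rule order_trans[OF dom abs_ge_self])
  have i2: "set_integrable lborel {a..b} (\<lambda>x. w' x * \<eta> n (F x))" for n
    by (intro borel_integrable_compact[of "{a..b}", folded set_integrable_def] continuous_intros w'_cont \<eta>Fc) auto
  have ftc: "(LBINT x:{a..b}. w x * (q n x * F' x)) + (LBINT x:{a..b}. w' x * \<eta> n (F x))
      = w b * \<eta> n (F b) - w a * \<eta> n (F a)" for n
  proof -
    have "((\<lambda>x. w x * (q n x * F' x) + w' x * \<eta> n (F x)) has_integral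
        (w b * \<eta> n (F b) - w a * \<eta> n (F a))) {a..b}"
    proof (rule fundamental_theorem_of_calculus[OF ab])
      fix x assume x: "x \<in> {a..b}"
      have "((\<lambda>x. \<eta> n (F x)) has_real_derivative q n x * F' x) (at x within {a..b})"
        using DERIV_chain2[OF \<eta>_deriv F[OF x]] by (simp add: q_def)
      from DERIV_mult[OF w[OF x] this]
      show "((\<lambda>x. w x * \<eta> n (F x)) has_vector_derivative w x * (q n x * F' x) + w' x * \<eta> n (F x)) (at x within {a..b})"
        by (simp add: has_real_derivative_iff_has_vector_derivative algebra_simps)
    qed
    moreover have "((\<lambda>x. w x * (q n x * F' x) + w' x * \<eta> n (F x)) has_integral
        ((LBINT x:{a..b}. w x * (q n x * F' x)) + (LBINT x:{a..b}. w' x * \<eta> n (F x)))) {a..b}"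
      using set_borel_integral_eq_integral[OF i1] set_borel_integral_eq_integral[OF i2]
      by (intro has_integral_add) (auto simp: has_integral_integral)
    ultimately show ?thesis using has_integral_unique by blast
  qed
  have \<eta>_lim: "(\<lambda>n. \<eta> n r) \<longlonglongrightarrow> max 0 r" for r
  proof -
    have "(\<lambda>n. sqrt ((max 0 r)\<^sup>2 + e n)) \<longlonglongrightarrow> sqrt ((max 0 r)\<^sup>2 + 0)"
      by (intro tendsto_intros e_lim)
    then show ?thesis by (simp add: \<eta>_def)
  qed
  have q_lim: "(\<lambda>n. q n x) \<longlonglongrightarrow> (if 0 < F x then 1 else 0)" for x
  proof (cases "0 < F x")
    case True
    have "(\<lambda>n. max 0 (F x) / \<eta> n (F x)) \<longlonglongrightarrow> max 0 (F x) / max 0 (F x)"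
      by (intro tendsto_intros \<eta>_lim) (use True in auto)
    then show ?thesis using True by (simp add: q_def)
  qed (simp add: q_def)
  have L1: "(\<lambda>n. LBINT x:{a..b}. w x * (q n x * F' x))
      \<longlonglongrightarrow> (LBINT x:{a..b}. w x * (if 0 < F x then F' x else 0))"
    unfolding set_lebesgue_integral_def real_scaleR_def
  proof (rule integral_dominated_convergence[where w="\<lambda>x. K * (indicator {a..b} x * \<bar>F' x\<bar>)"])
    have lim: "(\<lambda>n. indicator {a..b} x * (w x * (q n x * F' x))) \<longlonglongrightarrow>
        indicator {a..b} x * (w x * (if 0 < F x then F' x else 0))" for x
      using tendsto_mult_left[OF tendsto_mult_left[OF tendsto_mult_right[OF q_lim[of x], of "F' x"], of "w x"], of "indicator {a..b} x"]
      by (auto split: if_splits)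
    then show "AE x in lborel. (\<lambda>n. indicator {a..b} x * (w x * (q n x * F' x))) \<longlonglongrightarrow>
        indicator {a..b} x * (w x * (if 0 < F x then F' x else 0))" by simp
    show "(\<lambda>x. indicator {a..b} x * (w x * (if 0 < F x then F' x else 0))) \<in> borel_measurable lborel"
      using borel_measurable_LIMSEQ_real[OF lim prod_m] by simp
  qed (use bnd prod_m dom in auto)
  obtain K2 where K2: "\<And>x. x \<in> {a..b} \<Longrightarrow> \<bar>w' x\<bar> * (\<bar>F x\<bar> + 1) \<le> K2"
  proof -
    have "continuous_on {a..b} (\<lambda>x. \<bar>w' x\<bar> * (\<bar>F x\<bar> + 1))" by (intro continuous_intros w'_cont Fc)
    from compact_imp_bounded[OF compact_continuous_image[OF this]] show ?thesis
      using that by (force simp: bounded_iff)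
  qed
  have L2: "(\<lambda>n. LBINT x:{a..b}. w' x * \<eta> n (F x)) \<longlonglongrightarrow> (LBINT x:{a..b}. w' x * max 0 (F x))"
    unfolding set_lebesgue_integral_def real_scaleR_def
  proof (rule integral_dominated_convergence[where w="\<lambda>x. indicator {a..b} x * K2"])
    have "integrable lborel (indicator {a..b} :: real \<Rightarrow> real)"
      by (rule integrable_real_indicator) (auto simp: emeasure_lborel_Icc_eq)
    then show "integrable lborel (\<lambda>x. indicator {a..b} x * K2)" by simp
    have "continuous_on {a..b} (\<lambda>x. w' x * max 0 (F x))" by (intro continuous_intros w'_cont Fc)
    from meas[OF this] show "(\<lambda>x. indicator {a..b} x * (w' x * max 0 (F x))) \<in> borel_measurable lborel"
      by (simp add: set_borel_measurable_def)
    fix n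
    have "continuous_on {a..b} (\<lambda>x. w' x * \<eta> n (F x))" by (intro continuous_intros w'_cont \<eta>Fc)
    from meas[OF this] show "(\<lambda>x. indicator {a..b} x * (w' x * \<eta> n (F x))) \<in> borel_measurable lborel"
      by (simp add: set_borel_measurable_def)
    have "\<eta> n r \<le> \<bar>r\<bar> + 1" for r
    proof -
      have "(max 0 r)\<^sup>2 + e n \<le> (\<bar>r\<bar> + 1)\<^sup>2"
      proof -
        have "(max 0 r)\<^sup>2 \<le> \<bar>r\<bar>\<^sup>2" by (intro power_mono) auto
        moreover have "e n \<le> 1" by (simp add: e_def)
        ultimately show ?thesis by (simp add: power2_sum)
      qed
      then show ?thesis unfolding \<eta>_def by (intro real_le_lsqrt) auto
    qed
    then have "\<bar>w' x\<bar> * \<eta> n (F x) \<le> K2" if "x \<in> {a..b}" for x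
      using order_trans[OF mult_left_mono[OF _ abs_ge_zero] K2[OF that]] by blast
    then have "norm (indicator {a..b} x * (w' x * \<eta> n (F x))) \<le> indicator {a..b} x * K2" for x
      using \<eta>_pos[of n "F x"] by (cases "x \<in> {a..b}") (simp_all add: abs_mult)
    then show "AE x in lborel. norm (indicator {a..b} x * (w' x * \<eta> n (F x))) \<le> indicator {a..b} x * K2"
      by simp
    show "AE x in lborel. (\<lambda>n. indicator {a..b} x * (w' x * \<eta> n (F x))) \<longlonglongrightarrow> indicator {a..b} x * (w' x * max 0 (F x))"
      by (intro AE_I2 tendsto_intros \<eta>_lim)
  qed
  have L3: "(\<lambda>n. w b * \<eta> n (F b) - w a * \<eta> n (F a)) \<longlonglongrightarrow> w b * max 0 (F b) - w a * max 0 (F a)"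
    by (intro tendsto_intros \<eta>_lim)
  have "(\<lambda>n. LBINT x:{a..b}. w x * (q n x * F' x)) =
      (\<lambda>n. (w b * \<eta> n (F b) - w a * \<eta> n (F a)) - (LBINT x:{a..b}. w' x * \<eta> n (F x)))"
    using ftc by (auto simp: algebra_simps fun_eq_iff)
  from L1[unfolded this] tendsto_diff[OF L3 L2] show ?thesis by (rule LIMSEQ_unique)
qed

section \<open>The inequality behind the choice of the weight\<close>

text \<open>
The value of \<open>A\<close> at the shifted left end point is compared with integrals of \<open>A\<close> and of its
translate.  A non-increasing function \<open>g\<close> is at \<open>c + \<delta>\<close> at most its mean over \<open>{c..c + \<delta>}\<close>, and
the variation of this mean over \<open>{c..a}\<close> is the integral of \<open>g (y + \<delta>) - g y\<close> divided by \<open>\<delta>\<close>.  So a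
pointwise value is traded for an integral, however steep \<open>g\<close> is; here
\<open>g y = exp (- p * y) * A y\<close>, and \<open>S\<close> and \<open>I\<close> are the integrals of \<open>exp (p * y) * g (y + \<delta>)\<close> and of
\<open>exp (p * y) * (g y - g (y + \<delta>))\<close>, written with the antiderivative \<open>\<Psi>\<close> of \<open>A\<close>.
\<close>

lemma shift_average_inequality:
  fixes \<Psi> A :: "real \<Rightarrow> real" and p :: real
  assumes ca: "c \<le> a" and \<delta>: "0 < \<delta>"
    and \<Psi>: "\<And>y. c \<le> y \<Longrightarrow> y \<le> a + \<delta> \<Longrightarrow> (\<Psi> has_real_derivative A y) (at y)"
    and A_cont: "continuous_on {c..a + \<delta>} A"
    and dec: "\<And>x y. c \<le> x \<Longrightarrow> x \<le> y \<Longrightarrow> y \<le> a + \<delta> \<Longrightarrow> exp (- p * y) * A y \<le> exp (- p * x) * A x"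
  defines "S \<equiv> exp (- p * \<delta>) * (\<Psi> (a + \<delta>) - \<Psi> (c + \<delta>))"
  defines "I \<equiv> \<Psi> a - \<Psi> c - S"
  shows "0 \<le> I" "exp (- p * \<delta>) * A (c + \<delta>) \<le> (1 / \<delta> + \<bar>p\<bar>) * I + A a - p * S"
proof -
  define g where "g y = exp (- p * y) * A y" for y
  have A_g: "A y = exp (p * y) * g y" for y by (simp add: g_def exp_minus)
  have Ash_g: "exp (- p * \<delta>) * A (y + \<delta>) = exp (p * y) * g (y + \<delta>)" for y
    by (simp add: g_def algebra_simps exp_add[symmetric] flip: mult.assoc)
  have g_dec: "g y \<le> g x" if "c \<le> x" "x \<le> y" "y \<le> a + \<delta>" for x y
    using dec[OF that] by (simp add: g_def)
  have shift: "((\<lambda>y. \<Psi> (y + \<delta>)) has_real_derivative A (y + \<delta>)) (at y)" if "c \<le> y" "y \<le> a" for y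
    using \<Psi>[of "y + \<delta>"] that \<delta> by (simp add: DERIV_shift)
  define J where "J y = \<Psi> y - exp (- p * \<delta>) * \<Psi> (y + \<delta>)" for y
  have J_deriv: "(J has_real_derivative exp (p * y) * (g y - g (y + \<delta>))) (at y)" if y: "c \<le> y" "y \<le> a" for y
  proof -
    have "(J has_real_derivative A y - exp (- p * \<delta>) * A (y + \<delta>)) (at y)"
      unfolding J_def using \<delta> y by (auto intro!: derivative_eq_intros \<Psi> shift)
    then show ?thesis unfolding Ash_g unfolding A_g by (simp add: algebra_simps)
  qed
  have I_J: "I = J a - J c" by (simp add: I_def S_def J_def algebra_simps)
  have "J c \<le> J a"
  proof (rule DERIV_nonneg_imp_nondecreasing[OF ca])
    fix y assume y: "c \<le> y" "y \<le> a"
    with g_dec[of y "y + \<delta>"] \<delta> show "\<exists>d. (J has_real_derivative d) (at y) \<and> 0 \<le> d"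
      using J_deriv[OF y] by fastforce
  qed
  then show "0 \<le> I" by (simp add: I_J)
  have g_cont: "continuous_on {c..a + \<delta>} g" unfolding g_def by (intro continuous_intros A_cont)
  define G where "G x = integral {c..x} g" for x
  have G: "(G has_real_derivative g x) (at x within {c..a + \<delta>})" if "x \<in> {c..a + \<delta>}" for x
    unfolding G_def has_real_derivative_iff_has_vector_derivative
    by (rule integral_has_vector_derivative[OF g_cont that])
  have G_in: "(G has_real_derivative g x) (at x)" if "c < x" "x < a + \<delta>" for x
    using G[of x] that at_within_Icc_at[of c x "a + \<delta>"] by simp
  have G_cont: "continuous_on {c..a + \<delta>} G"
    by (rule DERIV_continuous_on[OF G])
  have avg: "\<delta> * g (y + \<delta>) \<le> G (y + \<delta>) - G y \<and> G (y + \<delta>) - G y \<le> \<delta> * g y"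
    if y: "c \<le> y" "y \<le> a" for y
  proof -
    have "\<exists>l z. y < z \<and> z < y + \<delta> \<and> (G has_real_derivative l) (at z) \<and> G (y + \<delta>) - G y = (y + \<delta> - y) * l"
    proof (rule MVT)
      show "continuous_on {y..y + \<delta>} G" using G_cont by (rule continuous_on_subset) (use y in auto)
      show "G differentiable at x" if "y < x" "x < y + \<delta>" for x
        using G_in[of x] that y by (auto simp: real_differentiable_def)
    qed (use \<delta> in auto)
    then obtain l z where z: "y < z" "z < y + \<delta>" "(G has_real_derivative l) (at z)" "G (y + \<delta>) - G y = \<delta> * l" by auto
    have "l = g z" using DERIV_unique[OF z(3) G_in] z y by auto
    note z = z(1,2,4)[unfolded this]
    with y \<delta> g_dec[of y z] g_dec[of z "y + \<delta>"] show ?thesis by auto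
  qed
  \<comment> \<open>\<open>B y\<close> is the mean of \<open>g\<close> over \<open>{y..y + \<delta>}\<close>; it lies between the two end values because
    \<open>g\<close> is non-increasing, and its derivative is the difference of the end values over \<open>\<delta>\<close>.\<close>
  define B where "B y = (G (y + \<delta>) - G y) / \<delta>" for y
  have B_bnd: "g (y + \<delta>) \<le> B y" "B y \<le> g y" if "c \<le> y" "y \<le> a" for y
    using avg[OF that] \<delta> by (auto simp: B_def field_simps)
  \<comment> \<open>At \<open>y = a\<close> the last two terms vanish, at \<open>y = c\<close> they are the ones of the claim.  The
    summand with \<open>\<bar>p\<bar>\<close> makes \<open>X\<close> non-decreasing for both signs of \<open>p\<close>.\<close>
  define X where "X y = exp (p * y) * B y - (1 / \<delta> + \<bar>p\<bar>) * (J a - J y)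
      + p * (exp (- p * \<delta>) * (\<Psi> (a + \<delta>) - \<Psi> (y + \<delta>)))" for y
  have X_mono: "X c \<le> X a"
  proof (rule DERIV_nonneg_imp_increasing_open[OF ca])
    fix y assume y: "c < y" "y < a"
    have GS: "((\<lambda>y. G (y + \<delta>)) has_real_derivative g (y + \<delta>)) (at y)"
      using G_in[of "y + \<delta>"] y \<delta> by (simp add: DERIV_shift)
    have "(X has_real_derivative (p * exp (p * y) * B y + exp (p * y) * ((g (y + \<delta>) - g y) / \<delta>)
        + (1 / \<delta> + \<bar>p\<bar>) * (exp (p * y) * (g y - g (y + \<delta>))) - p * (exp (- p * \<delta>) * A (y + \<delta>)))) (at y)"
      unfolding X_def B_def
      apply (rule derivative_eq_intros G_in GS J_deriv shift refl | use y \<delta> in force)+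
      using \<delta> by (simp add: field_simps)
    also have "p * exp (p * y) * B y + exp (p * y) * ((g (y + \<delta>) - g y) / \<delta>)
        + (1 / \<delta> + \<bar>p\<bar>) * (exp (p * y) * (g y - g (y + \<delta>))) - p * (exp (- p * \<delta>) * A (y + \<delta>))
       = exp (p * y) * (p * (B y - g (y + \<delta>)) + \<bar>p\<bar> * (g y - g (y + \<delta>)))"
      unfolding Ash_g by (simp add: algebra_simps diff_divide_distrib)
    finally have D: "(X has_real_derivative \<dots>) (at y)" .
    have "0 \<le> p * (B y - g (y + \<delta>)) + \<bar>p\<bar> * (g y - g (y + \<delta>))"
    proof (cases "0 \<le> p")
      case True
      then show ?thesis using B_bnd[of y] y g_dec[of y "y + \<delta>"] \<delta> by (intro add_nonneg_nonneg mult_nonneg_nonneg) auto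
    next
      case False
      then have "p * (B y - g (y + \<delta>)) + \<bar>p\<bar> * (g y - g (y + \<delta>)) = (- p) * (g y - B y)"
        by (simp add: algebra_simps)
      also have "\<dots> \<ge> 0" using False B_bnd[of y] y by (intro mult_nonneg_nonneg) auto
      finally show ?thesis .
    qed
    with D show "\<exists>d. (X has_real_derivative d) (at y) \<and> 0 \<le> d" by force
  next
    have "continuous_on {c..a} (\<lambda>y. G (y + \<delta>))"
      by (rule continuous_on_compose2[OF G_cont]) (use \<delta> in \<open>auto intro!: continuous_intros\<close>)
    moreover have "continuous_on {c..a} G" using G_cont by (rule continuous_on_subset) (use \<delta> in auto)
    moreover have "continuous_on {c..a} J"
      using J_deriv by (auto intro!: continuous_at_imp_continuous_on DERIV_isCont)
    moreover have "continuous_on {c..a} (\<lambda>y. \<Psi> (y + \<delta>))"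
      using shift by (auto intro!: continuous_at_imp_continuous_on DERIV_isCont)
    ultimately show "continuous_on {c..a} X"
      unfolding X_def B_def by (intro continuous_intros) (use \<delta> in auto)
  qed
  have "exp (- p * \<delta>) * A (c + \<delta>) = exp (p * c) * g (c + \<delta>)" by (rule Ash_g)
  also have "\<dots> \<le> exp (p * c) * B c" using B_bnd[of c] ca by simp
  also have "\<dots> = X c + (1 / \<delta> + \<bar>p\<bar>) * I - p * S" by (simp add: X_def I_J S_def)
  also have "X c \<le> X a" by (rule X_mono)
  also have "X a = exp (p * a) * B a" by (simp add: X_def)
  also have "\<dots> \<le> A a" unfolding A_g using B_bnd[of a] ca by simp
  finally show "exp (- p * \<delta>) * A (c + \<delta>) \<le> (1 / \<delta> + \<bar>p\<bar>) * I + A a - p * S" by simp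
qed

text \<open>
The coefficients of \<open>Aa\<close>, \<open>I\<close> and \<open>S\<close> are compared one by one.  Write \<open>\<xi> = exp (p * \<delta> - k * H)\<close>,
which is \<open>exp (- \<nu> * H)\<close> with \<open>\<nu> \<ge> 1\<close>.  The factor \<open>1 / H\<close> balances \<open>Rs / \<delta>\<close> up to an error of order
one, because \<open>\<delta> / H\<close> is a mean of the slopes between \<open>Rs\<close> and \<open>Rt\<close>; the errors that come from the
variation of these slopes are absorbed by the decay of \<open>\<xi>\<close> and by the large constant \<open>B\<close>.
\<close>

lemma lag_kernel_algebra:
  fixes H :: real
  assumes H: "0 < H" and nonneg: "0 \<le> I" "0 \<le> S" "0 \<le> Aa"
    and avg: "exp (- p * \<delta>) * Ac \<le> (1 / \<delta> + \<bar>p\<bar>) * I + Aa - p * S"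
    and R: "1 \<le> Rs" "1 \<le> Rt" "Rs \<le> K" and \<delta>: "H \<le> \<delta>"
    and lip: "\<bar>Rs - Rt\<bar> \<le> C * H" "\<bar>Rs - \<delta> / H\<bar> \<le> C * H"
    and \<nu>: "1 \<le> k - p * \<delta> / H" and C: "0 \<le> C" "C \<le> Rt"
    and B: "\<bar>p\<bar> * K + C * (1 + \<bar>p\<bar>) \<le> B"
  shows "Rs * (exp (- k * H) * Ac) \<le>
    Rt * Aa + (1 / H + B) * (I + S) - (1 / H + B + k) * (exp (- k * H) * (exp (p * \<delta>) * S))"
proof -
  define \<xi> where "\<xi> = exp (p * \<delta> - k * H)"
  define \<nu> where "\<nu> = k - p * \<delta> / H"
  have \<nu>1: "1 \<le> \<nu>" using \<nu> by (simp add: \<nu>_def)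
  have \<xi>: "\<xi> = exp (- (\<nu> * H))" using H by (simp add: \<xi>_def \<nu>_def algebra_simps)
  have \<xi>_pos: "0 < \<xi>" by (simp add: \<xi>_def)
  have \<xi>le1: "\<xi> \<le> 1" using \<nu>1 H by (simp add: \<xi>)
  have \<xi>b: "\<xi> * (1 + \<nu> * H) \<le> 1"
  proof -
    have "\<xi> * (1 + \<nu> * H) \<le> \<xi> * exp (\<nu> * H)" using \<xi>_pos exp_ge_add_one_self by simp
    also have "\<dots> = 1" by (simp add: \<xi> exp_minus)
    finally show ?thesis .
  qed
  have "0 \<le> \<bar>p\<bar> * K" "0 \<le> C * \<bar>p\<bar>" using R C by auto
  moreover have "\<bar>p\<bar> * K + (C + C * \<bar>p\<bar>) \<le> B" using B by (simp add: distrib_left)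
  ultimately have B0: "0 \<le> B" "C + \<bar>p\<bar> * K \<le> B" "C * \<bar>p\<bar> \<le> B" using C by linarith+
  have cA: "Rs * \<xi> \<le> Rt"
  proof -
    have "Rs \<le> Rt + C * H" using lip by linarith
    also have "\<dots> \<le> Rt * (1 + \<nu> * H)"
    proof -
      have "C * 1 \<le> Rt * \<nu>" using C \<nu>1 R by (intro mult_mono) auto
      then have "C * H \<le> (Rt * \<nu>) * H" using H by (intro mult_right_mono) auto
      then show ?thesis by (simp add: algebra_simps)
    qed
    finally have "Rs * \<xi> \<le> Rt * (\<xi> * (1 + \<nu> * H))" using \<xi>_pos by (simp add: mult.commute mult.left_commute)
    also have "\<dots> \<le> Rt * 1" using \<xi>b R by (intro mult_left_mono) auto
    finally show ?thesis by simp
  qed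
  have cI: "Rs * \<xi> * (1 / \<delta> + \<bar>p\<bar>) \<le> 1 / H + B"
  proof -
    have dpos: "0 < \<delta>" using H \<delta> by linarith
    have "Rs \<le> \<delta> / H + C * H" using lip by linarith
    then have "Rs * (1 / \<delta>) \<le> (\<delta> / H + C * H) * (1 / \<delta>)" using dpos by (intro mult_right_mono) auto
    also have "\<dots> = 1 / H + C * (H / \<delta>)" using dpos H by (simp add: field_simps)
    also have "\<dots> \<le> 1 / H + C * 1" using dpos \<delta> C by (intro add_left_mono mult_left_mono) auto
    finally have "Rs * (1 / \<delta>) \<le> 1 / H + C" by simp
    moreover have "Rs * \<bar>p\<bar> \<le> K * \<bar>p\<bar>" using R by (intro mult_right_mono) auto
    ultimately have "Rs * (1 / \<delta> + \<bar>p\<bar>) \<le> 1 / H + B" using B0 by (simp add: algebra_simps)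
    moreover have "Rs * \<xi> * (1 / \<delta> + \<bar>p\<bar>) \<le> Rs * 1 * (1 / \<delta> + \<bar>p\<bar>)"
      using \<xi>le1 R dpos by (intro mult_right_mono mult_left_mono) auto
    ultimately show ?thesis by simp
  qed
  have cS: "k * \<xi> - p * (Rs * \<xi>) \<le> (1 / H + B) * (1 - \<xi>)"
  proof -
    have "k - p * Rs = \<nu> + p * (\<delta> / H - Rs)" by (simp add: \<nu>_def algebra_simps)
    also have "\<dots> \<le> \<nu> + \<bar>p\<bar> * (C * H)"
    proof -
      have "p * (\<delta> / H - Rs) \<le> \<bar>p\<bar> * \<bar>\<delta> / H - Rs\<bar>" by (metis abs_ge_self abs_mult)
      also have "\<dots> \<le> \<bar>p\<bar> * (C * H)" using lip by (intro mult_left_mono) (auto simp: abs_minus_commute)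
      finally show ?thesis by simp
    qed
    also have "\<dots> \<le> \<nu> + B * (\<nu> * H)"
    proof -
      have "(C * \<bar>p\<bar>) * (1 * H) \<le> B * (\<nu> * H)"
        using B0 \<nu>1 H C by (intro mult_mono) auto
      then show ?thesis by (simp add: algebra_simps)
    qed
    also have "\<dots> = (1 / H + B) * (\<nu> * H)" using H by (simp add: field_simps)
    finally have "\<xi> * (k - p * Rs) \<le> \<xi> * ((1 / H + B) * (\<nu> * H))" using \<xi>_pos by simp
    also have "\<dots> = (1 / H + B) * (\<xi> * (1 + \<nu> * H) - \<xi>)" by (simp add: algebra_simps)
    also have "\<dots> \<le> (1 / H + B) * (1 - \<xi>)"
      using \<xi>b B0 H by (intro mult_left_mono) auto
    finally show ?thesis by (simp add: algebra_simps)
  qed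
  have "Rs * (exp (- k * H) * Ac) = Rs * \<xi> * (exp (- p * \<delta>) * Ac)"
    by (simp add: \<xi>_def exp_diff exp_minus field_simps)
  also have "\<dots> \<le> Rs * \<xi> * ((1 / \<delta> + \<bar>p\<bar>) * I + Aa - p * S)"
    using avg R \<xi>_pos by (intro mult_left_mono) auto
  also have "\<dots> = (Rs * \<xi> * (1 / \<delta> + \<bar>p\<bar>)) * I + (Rs * \<xi>) * Aa + (k * \<xi> - p * (Rs * \<xi>)) * S - k * \<xi> * S"
    by (simp add: algebra_simps)
  also have "\<dots> \<le> (1 / H + B) * I + Rt * Aa + ((1 / H + B) * (1 - \<xi>)) * S - k * \<xi> * S"
    using mult_right_mono[OF cI nonneg(1)] mult_right_mono[OF cA nonneg(3)] mult_right_mono[OF cS nonneg(2)]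
    by linarith
  also have "\<dots> = Rt * Aa + (1 / H + B) * (I + S) - (1 / H + B + k) * (\<xi> * S)"
    by (simp add: algebra_simps add_divide_distrib diff_divide_distrib)
  also have "\<xi> * S = exp (- k * H) * (exp (p * \<delta>) * S)"
    by (simp add: \<xi>_def exp_diff exp_minus field_simps)
  finally show ?thesis .
qed

section \<open>The nonlinearity\<close>

text \<open>
The inverse of \<open>\<phi>\<close> on its range; at a level below the range the set is empty and at a level above
it is unbounded, and the value is arbitrary.
\<close>

definition level_inverse :: "(real \<Rightarrow> real) \<Rightarrow> real \<Rightarrow> real" where
  "level_inverse \<phi> y = Sup {r. 0 \<le> r \<and> \<phi> r \<le> y}"

locale nonlinearity =
  fixes m \<theta> :: real and \<phi> :: "real \<Rightarrow> real"
  assumes m: "0 < m" and \<theta>: "\<theta> \<in> {-1, 1}" and admissible: "admissible_nonlinearity m \<theta> \<phi>"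
begin

text \<open>
\<open>V\<close> is the derivative of the inverse of \<open>\<phi>\<close> as a function of the logarithm of the level.
\<close>

definition V :: "real \<Rightarrow> real" where "V r = \<phi> r / deriv \<phi> r"

lemma phi_0 [simp]: "\<phi> 0 = 0" and V_0 [simp]: "V 0 = 0"
  using admissible by (simp_all add: admissible_nonlinearity_def V_def)

lemma \<theta>_sq [simp]: "\<theta> * \<theta> = 1" "\<theta> * (\<theta> * x) = x" "\<bar>\<theta>\<bar> = 1"
  using \<theta> by auto

lemma phi_deriv: "0 < r \<Longrightarrow> (\<phi> has_real_derivative deriv \<phi> r) (at r)"
  and phi_deriv2: "0 < r \<Longrightarrow> (deriv \<phi> has_real_derivative deriv (deriv \<phi>) r) (at r)"
  using admissible by (auto simp: admissible_nonlinearity_def DERIV_deriv_iff_real_differentiable)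

lemma phi_cont: "continuous_on {0..} \<phi>" and phi_mono: "mono_on {0..} \<phi>"
  using admissible by (auto simp: admissible_nonlinearity_def)

lemma curvature_bound:
  assumes "0 < r"
  shows "m \<le> \<theta> * (\<phi> r * deriv (deriv \<phi>) r / (deriv \<phi> r)\<^sup>2)"
proof -
  have "ereal m \<le> (INF r \<in> {0<..}. ereal (\<theta> * (\<phi> r * deriv (deriv \<phi>) r / (deriv \<phi> r)\<^sup>2)))"
    using admissible by (auto simp: admissible_nonlinearity_def)
  also have "\<dots> \<le> ereal (\<theta> * (\<phi> r * deriv (deriv \<phi>) r / (deriv \<phi> r)\<^sup>2))"
    by (rule INF_lower) (use assms in simp)
  finally show ?thesis by simp
qed

lemma phi_pos: "0 < r \<Longrightarrow> 0 < \<phi> r" and phi'_pos: "0 < r \<Longrightarrow> 0 < deriv \<phi> r"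
proof -
  assume r: "0 < r"
  have "\<phi> r \<noteq> 0" "deriv \<phi> r \<noteq> 0" using curvature_bound[OF r] m by auto
  moreover have "\<phi> 0 \<le> \<phi> r" using mono_onD[OF phi_mono, of 0 r] r by simp
  moreover have "0 \<le> deriv \<phi> r"
    by (rule mono_on_imp_deriv_nonneg[OF phi_mono phi_deriv[OF r]]) (use r in simp)
  ultimately show "0 < \<phi> r" "0 < deriv \<phi> r" by auto
qed

lemma phi_less:
  assumes *: "0 \<le> x" "x < y"
  shows "\<phi> x < \<phi> y"
proof (rule DERIV_pos_imp_increasing_open[OF *(2)])
  show "\<exists>d. (\<phi> has_real_derivative d) (at z) \<and> 0 < d" if "x < z" "z < y" for z
    using phi_deriv[of z] phi'_pos[of z] that * by auto
  show "continuous_on {x..y} \<phi>" by (rule continuous_on_subset[OF phi_cont]) (use * in auto)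
qed

lemma phi_less_iff: "0 \<le> x \<Longrightarrow> 0 \<le> y \<Longrightarrow> \<phi> x < \<phi> y \<longleftrightarrow> x < y"
  using phi_less[of x y] phi_less[of y x] by (cases x y rule: linorder_cases) auto

lemma phi_le_iff: "0 \<le> x \<Longrightarrow> 0 \<le> y \<Longrightarrow> \<phi> x \<le> \<phi> y \<longleftrightarrow> x \<le> y"
  using phi_less_iff[of y x] by (auto simp: not_less[symmetric])

lemma phi_nonneg: "0 \<le> x \<Longrightarrow> 0 \<le> \<phi> x"
  using phi_le_iff[of 0 x] by simp

lemma V_pos: "0 < r \<Longrightarrow> 0 < V r"
  by (simp add: V_def phi_pos phi'_pos)

lemma V_nonneg: "0 \<le> r \<Longrightarrow> 0 \<le> V r"
  using V_pos[of r] by (cases "r = 0") auto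

text \<open>
The curvature condition as a one-sided bound: \<open>V' = 1 - \<phi> \<phi>'' / \<phi>'\<^sup>2\<close>, so \<open>\<theta> V' \<le> \<theta> - m\<close>.  In
the other direction the slope of \<open>V\<close> may be unbounded, even on compact intervals.
\<close>

lemma V_deriv:
  assumes "0 < r"
  shows "\<exists>D. (V has_real_derivative D) (at r) \<and> \<theta> * D \<le> \<theta> - m"
proof -
  have "(V has_real_derivative (deriv \<phi> r * deriv \<phi> r - \<phi> r * deriv (deriv \<phi>) r) / (deriv \<phi> r * deriv \<phi> r)) (at r)"
    unfolding V_def[abs_def]
    using DERIV_divide[OF phi_deriv[OF assms] phi_deriv2[OF assms]] phi'_pos[OF assms] by simp
  also have "(deriv \<phi> r * deriv \<phi> r - \<phi> r * deriv (deriv \<phi>) r) / (deriv \<phi> r * deriv \<phi> r)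
      = 1 - \<phi> r * deriv (deriv \<phi>) r / (deriv \<phi> r)\<^sup>2"
    using phi'_pos[OF assms] by (simp add: diff_divide_distrib power2_eq_square)
  finally show ?thesis using curvature_bound[OF assms] by (intro exI conjI) (auto simp: algebra_simps)
qed

text \<open>
For \<open>\<theta> = 1\<close> the function \<open>\<phi>\<close> is convex, hence \<open>V r \<le> r\<close>.  For \<open>\<theta> = -1\<close> the function \<open>V\<close> is
increasing, and a positive limit at \<open>0\<close> would make \<open>ln \<phi>\<close> bounded near \<open>0\<close>.
\<close>

lemma V_small:
  assumes e: "0 < e"
  shows "\<exists>d>0. \<forall>r. 0 \<le> r \<and> r < d \<longrightarrow> V r < e"
proof (cases "\<theta> = 1")
  case True
  have le: "V r \<le> r" if r: "0 < r" for r
  proof -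
    have "\<exists>l z. 0 < z \<and> z < r \<and> (\<phi> has_real_derivative l) (at z) \<and> \<phi> r - \<phi> 0 = (r - 0) * l"
      by (rule MVT) (use r phi_deriv phi_cont in \<open>auto simp: real_differentiable_def intro: continuous_on_subset\<close>)
    then obtain l z where z: "0 < z" "z < r" "(\<phi> has_real_derivative l) (at z)" "\<phi> r = r * l" by auto
    have l: "l = deriv \<phi> z" using DERIV_unique[OF z(3) phi_deriv[OF z(1)]] .
    have "deriv \<phi> z \<le> deriv \<phi> r"
    proof (rule DERIV_nonneg_imp_nondecreasing[of z r "deriv \<phi>"])
      fix x assume x: "z \<le> x" "x \<le> r"
      then have x0: "0 < x" using z by linarith
      have "0 < \<phi> x * deriv (deriv \<phi>) x / (deriv \<phi> x)\<^sup>2" using curvature_bound[OF x0] m True by simp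
      then have "0 < deriv (deriv \<phi>) x"
        using phi_pos[OF x0] phi'_pos[OF x0] by (simp add: zero_less_divide_iff zero_less_mult_iff)
      then show "\<exists>y. (deriv \<phi> has_real_derivative y) (at x) \<and> 0 \<le> y"
        using phi_deriv2[OF x0] by (intro exI[of _ "deriv (deriv \<phi>) x"]) auto
    qed (use z in auto)
    then show ?thesis using z l r phi'_pos[OF r] by (simp add: V_def divide_le_eq)
  qed
  have "V r < e" if "0 \<le> r" "r < e" for r
  proof (cases "r = 0")
    case False
    then show ?thesis using le[of r] that by linarith
  qed (use e in simp)
  then show ?thesis using e by (intro exI[of _ e]) auto
next
  case False
  then have th: "\<theta> = -1" using \<theta> by auto
  have mono: "V x \<le> V y" if xy: "0 < x" "x \<le> y" for x y
  proof (rule DERIV_nonneg_imp_nondecreasing[OF xy(2), of V])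
    fix z assume "x \<le> z" "z \<le> y"
    then obtain D where "(V has_real_derivative D) (at z)" "\<theta> * D \<le> \<theta> - m" using V_deriv[of z] xy by force
    then show "\<exists>D. (V has_real_derivative D) (at z) \<and> 0 \<le> D" using th m by (intro exI[of _ D]) auto
  qed
  have "\<exists>d>0. V d < e"
  proof (rule ccontr)
    assume "\<not> (\<exists>d>0. V d < e)"
    then have ge: "e \<le> V r" if "0 < r" for r using that by (metis not_less)
    \<comment> \<open>If \<open>e \<le> V\<close>, then \<open>\<phi>' \<le> \<phi> / e\<close>: so \<open>g\<close> decreases from \<open>g 0 = 0\<close>, although \<open>\<phi>\<close> is positive.\<close>
    define g where "g r = \<phi> r * exp (- r / e)" for r
    have "g 1 \<le> g 0"
    proof (rule DERIV_nonpos_imp_decreasing_open[of 0 1 g])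
      fix r :: real assume r: "0 < r" "r < 1"
      have "(g has_real_derivative (deriv \<phi> r - \<phi> r / e) * exp (- r / e)) (at r)"
        unfolding g_def using e by (auto intro!: derivative_eq_intros phi_deriv r(1) simp: field_simps)
      moreover have "deriv \<phi> r \<le> \<phi> r / e"
        using ge[OF r(1)] phi'_pos[OF r(1)] e by (simp add: V_def field_simps)
      ultimately show "\<exists>y. (g has_real_derivative y) (at r) \<and> y \<le> 0"
        by (intro exI conjI) (auto simp: mult_le_0_iff)
    qed (use e in \<open>auto simp: g_def intro!: continuous_intros continuous_on_subset[OF phi_cont]\<close>)
    then show False using phi_pos[of 1] by (simp add: g_def mult_le_0_iff)
  qed
  then obtain d where d: "0 < d" "V d < e" by auto
  have "V r < e" if "0 \<le> r" "r < d" for r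
    using that mono[of r d] d e by (cases "r = 0") auto
  then show ?thesis using d by (intro exI[of _ d]) auto
qed

lemma V_cont: "continuous_on {0..} V"
proof (intro continuous_on_eq_continuous_within[THEN iffD2] ballI)
  fix r :: real assume r: "r \<in> {0..}"
  show "continuous (at r within {0..}) V"
  proof (cases "r = 0")
    case True
    have "(V \<longlongrightarrow> 0) (at 0 within {0..})"
    proof (rule tendstoI)
      fix e :: real assume "0 < e"
      from V_small[OF this] obtain d where "0 < d" "\<forall>r. 0 \<le> r \<and> r < d \<longrightarrow> V r < e" by auto
      then show "\<forall>\<^sub>F x in at 0 within {0..}. dist (V x) 0 < e"
        unfolding eventually_at by (intro exI[of _ d]) (auto simp: dist_real_def V_nonneg)
    qed
    then show ?thesis using True by (simp add: continuous_within)
  next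
    case False
    with r have "0 < r" by simp
    from V_deriv[OF this] show ?thesis by (auto intro: DERIV_isCont continuous_at_imp_continuous_at_within)
  qed
qed

lemma level_inverse_phi: "0 \<le> r \<Longrightarrow> level_inverse \<phi> (\<phi> r) = r"
  unfolding level_inverse_def by (rule cSup_eq_maximum) (auto simp: phi_le_iff)

lemma phi_surj: "0 \<le> y \<Longrightarrow> y \<le> \<phi> M \<Longrightarrow> 0 \<le> M \<Longrightarrow> \<exists>r. 0 \<le> r \<and> r \<le> M \<and> \<phi> r = y"
  using IVT'[of \<phi> 0 y M] continuous_on_subset[OF phi_cont, of "{0..M}"] by auto

lemma phi_level_inverse:
  assumes "0 \<le> y" "y \<le> \<phi> M" "0 \<le> M"
  shows "\<phi> (level_inverse \<phi> y) = y" "0 \<le> level_inverse \<phi> y" "level_inverse \<phi> y \<le> M"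
  using phi_surj[OF assms] level_inverse_phi by auto

lemma level_inverse_cont: "0 \<le> M \<Longrightarrow> continuous_on {0..\<phi> M} (level_inverse \<phi>)"
proof -
  assume M: "0 \<le> M"
  have "continuous_on (\<phi> ` {0..M}) (level_inverse \<phi>)"
    by (rule continuous_on_inv) (auto simp: level_inverse_phi intro: continuous_on_subset[OF phi_cont])
  moreover have "\<phi> ` {0..M} = {0..\<phi> M}"
    using phi_surj[OF _ _ M] M by (fastforce simp: phi_le_iff phi_nonneg)
  ultimately show ?thesis by simp
qed

lemma level_inverse_deriv:
  assumes "0 < y" "y < \<phi> M" "0 \<le> M"
  shows "(level_inverse \<phi> has_real_derivative V (level_inverse \<phi> y) / y) (at y)"
proof -
  let ?r = "level_inverse \<phi> y"
  have r: "\<phi> ?r = y" "0 \<le> ?r" using phi_level_inverse[of y M] assms by auto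
  then have r0: "0 < ?r" using assms by (cases "?r = 0") auto
  have "(level_inverse \<phi> has_real_derivative inverse (deriv \<phi> ?r)) (at y)"
  proof (rule DERIV_inverse_function[of \<phi>])
    show "\<phi> (level_inverse \<phi> x) = x" if "0 < x" "x < \<phi> M" for x
      using phi_level_inverse[of x M] that assms by auto
    show "isCont (level_inverse \<phi>) y"
      using level_inverse_cont[OF assms(3)] assms
      by (metis continuous_on_interior interior_atLeastAtMost_real greaterThanLessThan_iff)
  qed (use assms phi_deriv[OF r0] phi'_pos[OF r0] in auto)
  moreover have "inverse (deriv \<phi> ?r) = V ?r / y" using assms r by (simp add: V_def inverse_eq_divide)
  ultimately show ?thesis by simp
qed

text \<open>
In the variable \<open>y = \<theta> ln \<phi>\<close> the function \<open>A y\<close>, which is \<open>V\<close> at the value of level \<open>y\<close>, is such that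
\<open>exp (- (\<theta> - m) y) A y\<close> is non-increasing.  The levels of \<open>c\<close> and \<open>b\<close>, and those of \<open>z\<close> and \<open>a\<close>, differ
by the shift \<open>\<delta> = \<theta> d\<close>.  Hence \<open>\<theta> (z - c)\<close> and \<open>\<theta> (a - b)\<close> are the integrals of \<open>A\<close> and of its
translate over the same interval, \<open>V b\<close> is the shifted value at its left end and \<open>V z\<close> the value
at its right end: this is the situation of \<open>shift_average_inequality\<close>.
\<close>

lemma lag_inequality_pos:
  assumes pos: "0 < c" "0 < a" "0 < z" "0 < b"
    and za: "\<phi> z = \<phi> a * exp (- d)" and bc: "\<phi> b = \<phi> c * exp d"
    and bad: "0 \<le> \<theta> * (z - c)"
    and H: "0 < H" "H \<le> \<theta> * d"
    and R: "1 \<le> Rs" "1 \<le> Rt" "Rs \<le> K"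
    and lip: "\<bar>Rs - Rt\<bar> \<le> C * H" "\<bar>Rs - \<theta> * d / H\<bar> \<le> C * H"
    and k: "1 \<le> k - (\<theta> - m) * (\<theta> * d) / H" and C: "0 \<le> C" "C \<le> Rt"
    and B: "(1 + m) * K + C * (2 + m) \<le> B"
  shows "exp (- k * H) * ((1 / H + B + k) * (\<theta> * (a - b)) + Rs * V b) \<le> (1 / H + B) * (\<theta> * (z - c)) + Rt * V z"
proof -
  define \<delta> p where "\<delta> = \<theta> * d" and "p = \<theta> - m"
  \<comment> \<open>All values stay strictly below \<open>M\<close>, so the inverse of \<open>\<phi>\<close> is differentiable at every level
    that occurs.\<close>
  define M where "M = Max {a, b, c, z} + 1"
  have M: "a < M" "b < M" "c < M" "z < M" by (auto simp: M_def intro: less_add_one le_less_trans)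
  have M0: "0 \<le> M" using M pos by linarith
  define \<psi> where "\<psi> y = level_inverse \<phi> (exp y)" for y
  define Y where "Y r = \<theta> * ln (\<phi> r)" for r
  have \<psi>Y: "\<psi> (\<theta> * Y r) = r" if "0 < r" for r
    using that phi_pos[OF that] by (simp add: \<psi>_def Y_def level_inverse_phi)
  have dpos: "0 < \<delta>" using H by (simp add: \<delta>_def)
  have Ya: "Y a = Y z + \<delta>" using pos za phi_pos[of a] by (simp add: Y_def \<delta>_def ln_mult algebra_simps)
  have Yb: "Y b = Y c + \<delta>" using pos bc phi_pos[of c] by (simp add: Y_def \<delta>_def ln_mult algebra_simps)
  have Ycz: "Y c \<le> Y z"
  proof (cases "\<theta> = 1")
    case True
    with bad pos have "\<phi> c \<le> \<phi> z" by (simp add: phi_le_iff)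
    then show ?thesis using True pos phi_pos[of c] phi_pos[of z] by (simp add: Y_def)
  next
    case False
    with \<theta> have th: "\<theta> = -1" by auto
    with bad pos have "\<phi> z \<le> \<phi> c" by (simp add: phi_le_iff)
    then show ?thesis using th pos phi_pos[of c] phi_pos[of z] by (simp add: Y_def)
  qed
  have dom: "exp (\<theta> * y) < \<phi> M" if y: "Y c \<le> y" "y \<le> Y z + \<delta>" for y
  proof (cases "\<theta> = 1")
    case True
    then have "exp (\<theta> * y) \<le> exp (Y a)" using y Ya by simp
    also have "\<dots> = \<phi> a" using True pos phi_pos[of a] by (simp add: Y_def)
    also have "\<dots> < \<phi> M" using M pos by (intro phi_less) auto
    finally show ?thesis .
  next
    case False
    with \<theta> have th: "\<theta> = -1" by auto
    then have "exp (\<theta> * y) \<le> exp (- Y c)" using y by simp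
    also have "\<dots> = \<phi> c" using th pos phi_pos[of c] by (simp add: Y_def)
    also have "\<dots> < \<phi> M" using M pos by (intro phi_less) auto
    finally show ?thesis .
  qed
  have \<psi>_pos: "0 < \<psi> (\<theta> * y)" if "Y c \<le> y" "y \<le> Y z + \<delta>" for y
  proof -
    have "\<phi> (\<psi> (\<theta> * y)) = exp (\<theta> * y)" "0 \<le> \<psi> (\<theta> * y)"
      using phi_level_inverse[of "exp (\<theta> * y)" M] dom[OF that] M0 by (auto simp: \<psi>_def)
    then show ?thesis by (cases "\<psi> (\<theta> * y) = 0") auto
  qed
  define \<Psi> A where "\<Psi> y = \<theta> * \<psi> (\<theta> * y)" and "A y = V (\<psi> (\<theta> * y))" for y
  have \<psi>_deriv: "((\<lambda>y. \<psi> (\<theta> * y)) has_real_derivative \<theta> * A y) (at y)" if "Y c \<le> y" "y \<le> Y z + \<delta>" for y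
  proof -
    have "((\<lambda>y. exp (\<theta> * y)) has_real_derivative \<theta> * exp (\<theta> * y)) (at y)"
      by (auto intro!: derivative_eq_intros)
    from DERIV_chain2[OF level_inverse_deriv[OF exp_gt_zero dom[OF that] M0] this]
    show ?thesis by (simp add: \<psi>_def A_def mult.commute)
  qed
  have \<Psi>_deriv: "(\<Psi> has_real_derivative A y) (at y)" if "Y c \<le> y" "y \<le> Y z + \<delta>" for y
    using DERIV_cmult[OF \<psi>_deriv[OF that], of \<theta>] by (simp add: \<Psi>_def[abs_def])
  have A_pos: "0 < A y" if "Y c \<le> y" "y \<le> Y z + \<delta>" for y
    using V_pos[OF \<psi>_pos[OF that]] by (simp add: A_def)
  have A_deriv: "\<exists>D. (A has_real_derivative D * (\<theta> * A y)) (at y) \<and> \<theta> * D \<le> p" if "Y c \<le> y" "y \<le> Y z + \<delta>" for y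
    using V_deriv[OF \<psi>_pos[OF that]] DERIV_chain2[OF _ \<psi>_deriv[OF that]] unfolding A_def[abs_def] p_def by blast
  have A_cont: "continuous_on {Y c..Y z + \<delta>} A"
    using A_deriv by (intro continuous_at_imp_continuous_on ballI) (auto intro: DERIV_isCont)
  have dec: "exp (- p * y) * A y \<le> exp (- p * x) * A x" if "Y c \<le> x" "x \<le> y" "y \<le> Y z + \<delta>" for x y
  proof (rule DERIV_nonpos_imp_nonincreasing[OF that(2), of "\<lambda>t. exp (- p * t) * A t"])
    fix t assume t: "x \<le> t" "t \<le> y"
    then have tt: "Y c \<le> t" "t \<le> Y z + \<delta>" using that by auto
    from A_deriv[OF tt] obtain D where D: "(A has_real_derivative D * (\<theta> * A t)) (at t)" "\<theta> * D \<le> p" by auto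
    have "((\<lambda>t. exp (- p * t) * A t) has_real_derivative exp (- p * t) * ((\<theta> * D - p) * A t)) (at t)"
      by (auto intro!: derivative_eq_intros D simp: algebra_simps)
    moreover have "exp (- p * t) * ((\<theta> * D - p) * A t) \<le> 0"
      using D(2) A_pos[OF tt] by (simp add: mult_le_0_iff)
    ultimately show "\<exists>y. ((\<lambda>t. exp (- p * t) * A t) has_real_derivative y) (at t) \<and> y \<le> 0" by blast
  qed
  define S where "S = exp (- p * \<delta>) * (\<Psi> (Y z + \<delta>) - \<Psi> (Y c + \<delta>))"
  define I where "I = \<Psi> (Y z) - \<Psi> (Y c) - S"
  note avg = shift_average_inequality[OF Ycz dpos \<Psi>_deriv A_cont dec, folded S_def, folded I_def]
  have \<Psi>Y: "\<Psi> (Y r) = \<theta> * r" if "0 < r" for r using \<psi>Y[OF that] by (simp add: \<Psi>_def)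
  have AY: "A (Y r) = V r" if "0 < r" for r using \<psi>Y[OF that] by (simp add: A_def)
  have "0 \<le> \<Psi> (Y z + \<delta>) - \<Psi> (Y c + \<delta>)"
  proof -
    have "\<Psi> (Y c + \<delta>) \<le> \<Psi> (Y z + \<delta>)"
    proof (rule DERIV_nonneg_imp_nondecreasing[of "Y c + \<delta>" "Y z + \<delta>" \<Psi>])
      fix x assume "Y c + \<delta> \<le> x" "x \<le> Y z + \<delta>"
      then show "\<exists>y. (\<Psi> has_real_derivative y) (at x) \<and> 0 \<le> y"
        using \<Psi>_deriv[of x] A_pos[of x] dpos by (intro exI[of _ "A x"]) auto
    qed (use Ycz in auto)
    then show ?thesis by simp
  qed
  then have S0: "0 \<le> S" by (simp add: S_def)
  have pm: "\<bar>p\<bar> \<le> 1 + m" using \<theta> m by (auto simp: p_def)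
  have "\<bar>p\<bar> * K \<le> (1 + m) * K" "C * (1 + \<bar>p\<bar>) \<le> C * (2 + m)"
    using pm R C by (auto intro: mult_right_mono mult_left_mono)
  with B have B': "\<bar>p\<bar> * K + C * (1 + \<bar>p\<bar>) \<le> B" by linarith
  have ineq: "Rs * (exp (- k * H) * A (Y c + \<delta>)) \<le>
      Rt * A (Y z) + (1 / H + B) * (I + S) - (1 / H + B + k) * (exp (- k * H) * (exp (p * \<delta>) * S))"
    by (rule lag_kernel_algebra[OF H(1) avg(1) S0 _ avg(2) R _ lip(1) _ _ C B'])
      (use A_pos[of "Y z"] Ycz dpos H lip k in \<open>auto simp: \<delta>_def p_def intro: less_imp_le\<close>)
  have eS: "exp (p * \<delta>) * S = \<theta> * a - \<theta> * b"
    using pos by (simp add: S_def Ya[symmetric] Yb[symmetric] \<Psi>Y mult.assoc[symmetric] exp_add[symmetric])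
  have eA: "A (Y c + \<delta>) = V b" "A (Y z) = V z" using pos by (simp_all add: Yb[symmetric] AY)
  have eI: "I + S = \<theta> * z - \<theta> * c" using pos by (simp add: I_def \<Psi>Y)
  from ineq[unfolded eS eA eI] show ?thesis by (simp add: algebra_simps)
qed

text \<open>
If \<open>\<theta> = 1\<close>, then \<open>c\<close> and \<open>b\<close> may vanish, and if \<open>\<theta> = -1\<close>, then \<open>a\<close> and \<open>z\<close>: these cases follow by
continuity, because \<open>V\<close> vanishes at \<open>0\<close>.
\<close>

lemma lag_inequality:
  assumes nonneg: "0 \<le> c" "0 \<le> a" "0 \<le> z" "0 \<le> b"
    and za: "\<phi> z = \<phi> a * exp (- d)" and bc: "\<phi> b = \<phi> c * exp d"
    and bad: "0 < \<theta> * (z - c)"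
    and H: "0 < H" "H \<le> \<theta> * d"
    and R: "1 \<le> Rs" "1 \<le> Rt" "Rs \<le> K"
    and lip: "\<bar>Rs - Rt\<bar> \<le> C * H" "\<bar>Rs - \<theta> * d / H\<bar> \<le> C * H"
    and k: "1 \<le> k - (\<theta> - m) * (\<theta> * d) / H" and C: "0 \<le> C" "C \<le> Rt"
    and B: "(1 + m) * K + C * (2 + m) \<le> B"
  shows "exp (- k * H) * ((1 / H + B + k) * (\<theta> * (a - b)) + Rs * V b) \<le> (1 / H + B) * (\<theta> * (z - c)) + Rt * V z"
proof -
  have zero_iff: "x = 0 \<longleftrightarrow> y = 0" if "\<phi> x = \<phi> y * exp t" "0 \<le> x" "0 \<le> y" for x y t
    using that phi_pos[of x] phi_pos[of y] by (cases "x = 0"; cases "y = 0") auto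
  have az: "z = 0 \<longleftrightarrow> a = 0" and cb: "b = 0 \<longleftrightarrow> c = 0" using za bc nonneg zero_iff by blast+
  have pos_case: "exp (- k * H) * ((1 / H + B + k) * (\<theta> * (a - b)) + Rs * V b) \<le> (1 / H + B) * (\<theta> * (z - c)) + Rt * V z"
    if "0 < c" "0 < a" "0 < z" "0 < b" "\<phi> z = \<phi> a * exp (- d)" "\<phi> b = \<phi> c * exp d" "0 \<le> \<theta> * (z - c)" for a b c z
    by (rule lag_inequality_pos[OF that H R lip k C B])
  \<comment> \<open>If a value vanishes, so does the value of the same level at the other time; both are
    approximated by positive values \<open>x n\<close> and \<open>x' n\<close> whose levels keep the required ratio.\<close>
  define x where "x n = 1 / real (Suc n)" for n
  have x_pos: "0 < x n" for n by (simp add: x_def)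
  have x_lim: "x \<longlonglongrightarrow> 0" unfolding x_def by (rule LIMSEQ_Suc[OF lim_1_over_n])
  define x' where "x' n = level_inverse \<phi> (\<phi> (x n) * exp (- \<bar>d\<bar>))" for n
  have x': "\<phi> (x' n) = \<phi> (x n) * exp (- \<bar>d\<bar>)" "0 < x' n" "x' n \<le> x n" for n
  proof -
    have "\<phi> (x n) * exp (- \<bar>d\<bar>) \<le> \<phi> (x n) * 1" using phi_pos[OF x_pos[of n]] by (intro mult_left_mono) auto
    then have *: "\<phi> (x n) * exp (- \<bar>d\<bar>) \<le> \<phi> (x n)" "0 < \<phi> (x n) * exp (- \<bar>d\<bar>)" using phi_pos[OF x_pos[of n]] by auto
    then show 1: "\<phi> (x' n) = \<phi> (x n) * exp (- \<bar>d\<bar>)"  "x' n \<le> x n"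
      using phi_level_inverse[of "\<phi> (x n) * exp (- \<bar>d\<bar>)" "x n"] x_pos[of n] by (auto simp: x'_def)
    have "0 \<le> x' n" using phi_level_inverse[of "\<phi> (x n) * exp (- \<bar>d\<bar>)" "x n"] x_pos[of n] * by (auto simp: x'_def)
    then show "0 < x' n" using 1 *(2) by (cases "x' n = 0") auto
  qed
  have x'_lim: "x' \<longlonglongrightarrow> 0"
    by (rule tendsto_sandwich[OF _ _ tendsto_const x_lim]) (use x' in \<open>auto intro!: always_eventually less_imp_le\<close>)
  have V_lim: "(\<lambda>n. V (y n)) \<longlonglongrightarrow> 0" if "y \<longlonglongrightarrow> 0" "\<And>n. 0 < y n" for y
    using continuous_on_tendsto_compose[OF V_cont that(1)] that(2) by (auto intro: less_imp_le always_eventually)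
  consider "0 < c" "0 < a" | "c = 0" "\<theta> = 1" "0 < a" | "a = 0" "\<theta> = -1" "0 < c"
    using nonneg bad az \<theta> by (cases "c = 0"; cases "a = 0") auto
  then show ?thesis
  proof cases
    case 1
    then show ?thesis using nonneg az cb za bc bad by (intro pos_case) auto
  next
    case 2
    then have d: "\<bar>d\<bar> = d" and z: "0 < z" and b: "b = 0" using H bad cb by auto
    have ev: "\<forall>\<^sub>F n in sequentially. exp (- k * H) * ((1 / H + B + k) * (\<theta> * (a - x n)) + Rs * V (x n))
        \<le> (1 / H + B) * (\<theta> * (z - x' n)) + Rt * V z"
    proof -
      have "\<forall>\<^sub>F n in sequentially. x' n < z" using x'_lim z by (simp add: order_tendstoD)
      then show ?thesis
      proof eventually_elim
        case (elim n)
        show ?case using elim x'[of n] x_pos[of n] z 2 za d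
          by (intro pos_case) (auto simp: exp_minus)
      qed
    qed
    show ?thesis
    proof (rule tendsto_le[OF sequentially_bot _ _ ev])
      show "(\<lambda>n. (1 / H + B) * (\<theta> * (z - x' n)) + Rt * V z) \<longlonglongrightarrow> (1 / H + B) * (\<theta> * (z - c)) + Rt * V z"
        unfolding \<open>c = 0\<close> by (intro tendsto_intros x'_lim)
      show "(\<lambda>n. exp (- k * H) * ((1 / H + B + k) * (\<theta> * (a - x n)) + Rs * V (x n)))
          \<longlonglongrightarrow> exp (- k * H) * ((1 / H + B + k) * (\<theta> * (a - b)) + Rs * V b)"
        unfolding b V_0 by (intro tendsto_intros x_lim V_lim x_pos)
    qed
  next
    case 3
    then have d: "\<bar>d\<bar> = - d" and z: "z = 0" and b: "0 < b" using H bad cb az nonneg by auto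
    have ev: "\<forall>\<^sub>F n in sequentially. exp (- k * H) * ((1 / H + B + k) * (\<theta> * (x' n - b)) + Rs * V b)
        \<le> (1 / H + B) * (\<theta> * (x n - c)) + Rt * V (x n)"
    proof -
      have "\<forall>\<^sub>F n in sequentially. x n < c" using x_lim 3 by (simp add: order_tendstoD)
      then show ?thesis
      proof eventually_elim
        case (elim n)
        show ?case using elim x'[of n] x_pos[of n] b 3 bc d
          by (intro pos_case) (auto simp: exp_minus)
      qed
    qed
    show ?thesis
    proof (rule tendsto_le[OF sequentially_bot _ _ ev])
      show "(\<lambda>n. (1 / H + B) * (\<theta> * (x n - c)) + Rt * V (x n)) \<longlonglongrightarrow> (1 / H + B) * (\<theta> * (z - c)) + Rt * V z"
        unfolding z V_0 by (intro tendsto_intros x_lim V_lim x_pos)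
      show "(\<lambda>n. exp (- k * H) * ((1 / H + B + k) * (\<theta> * (x' n - b)) + Rs * V b))
          \<longlonglongrightarrow> exp (- k * H) * ((1 / H + B + k) * (\<theta> * (a - b)) + Rs * V b)"
        unfolding \<open>a = 0\<close> by (intro tendsto_intros x'_lim)
    qed
  qed
qed

end

section \<open>A single trajectory\<close>

lemma (in pair_sigma_finite) integrable_mult_fst_snd:
  fixes f g :: "_ \<Rightarrow> real"
  assumes "integrable M1 f" "integrable M2 g"
  shows "integrable (M1 \<Otimes>\<^sub>M M2) (\<lambda>(x, y). f x * g y)"
proof (rule Fubini_integrable)
  have [measurable]: "f \<in> borel_measurable M1" "g \<in> borel_measurable M2" using assms by auto
  show "(\<lambda>(x, y). f x * g y) \<in> borel_measurable (M1 \<Otimes>\<^sub>M M2)" by measurable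
qed (use assms in \<open>auto simp: abs_mult\<close>)

text \<open>
The form in which integration by parts is used: the derivative of \<open>f\<close> splits into a rough part
\<open>u'\<close>, which is to be eliminated, and a continuous part \<open>g\<close>.
\<close>

lemma integral_on_positive_set:
  fixes f w w' g u' :: "real \<Rightarrow> real" and c :: real
  assumes lh: "l \<le> h"
    and f: "\<And>x. x \<in> {l..h} \<Longrightarrow> (f has_real_derivative c * u' x + g x) (at x within {l..h})"
    and u': "set_integrable lborel {l..h} u'"
    and w: "\<And>x. x \<in> {l..h} \<Longrightarrow> (w has_real_derivative w' x) (at x within {l..h})"
    and w': "continuous_on {l..h} w'" and g: "continuous_on {l..h} g"
  shows "(LBINT x:{l..h}. if 0 < f x then w x * (c * u' x) else 0) =
    w h * max 0 (f h) - w l * max 0 (f l) - (LBINT x:{l..h}. if 0 < f x then w' x * f x + w x * g x else 0)"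
proof -
  let ?I = "{l..h}"
  define p where "p x = (if 0 < f x then 1 else 0 :: real)" for x
  have fc: "continuous_on ?I f" by (rule DERIV_continuous_on[OF f])
  have wc: "continuous_on ?I w" by (rule DERIV_continuous_on[OF w])
  have cI: "set_integrable lborel ?I k" if "continuous_on ?I k" for k :: "real \<Rightarrow> real"
    unfolding set_integrable_def by (rule borel_integrable_compact) (use that in auto)
  have pm: "(\<lambda>x. indicator ?I x * p x) \<in> borel_measurable lborel"
  proof -
    have "(\<lambda>x. indicator ?I x * f x) \<in> borel_measurable borel"
      using borel_measurable_continuous_on_indicator[OF _ fc] by simp
    then have "(\<lambda>x. if 0 < indicator ?I x * f x then 1 else 0 :: real) \<in> borel_measurable lborel" by simp
    then show ?thesis
      by (rule measurable_cong[THEN iffD1, rotated]) (auto simp: p_def split: split_indicator)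
  qed
  have pI: "set_integrable lborel ?I (\<lambda>x. p x * k x)" if "set_integrable lborel ?I k" for k :: "real \<Rightarrow> real"
    unfolding set_integrable_def
  proof (rule Bochner_Integration.integrable_bound[OF that[unfolded set_integrable_def]])
    have "(\<lambda>x. (indicator ?I x * p x) * (indicator ?I x * k x)) \<in> borel_measurable lborel"
      using pm borel_measurable_integrable[OF that[unfolded set_integrable_def]] by simp
    then show "(\<lambda>x. indicator ?I x *\<^sub>R (p x * k x)) \<in> borel_measurable lborel"
      by (rule measurable_cong[THEN iffD1, rotated]) (auto split: split_indicator)
  qed (auto simp: p_def split: split_indicator)
  have wu': "set_integrable lborel ?I (\<lambda>x. w x * (c * u' x))"
  proof -
    obtain K where K: "\<forall>x\<in>?I. \<bar>w x\<bar> \<le> K"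
      using compact_imp_bounded[OF compact_continuous_image[OF wc]] by (auto simp: bounded_iff)
    have cu': "set_integrable lborel ?I (\<lambda>x. c * u' x)" using u' by simp
    have Ki: "integrable lborel (\<lambda>x. K * \<bar>indicator ?I x *\<^sub>R (c * u' x)\<bar>)"
      using cu' unfolding set_integrable_def by (intro integrable_mult_right integrable_abs)
    show ?thesis unfolding set_integrable_def
    proof (rule Bochner_Integration.integrable_bound[OF Ki])
      have "(\<lambda>x. (indicator ?I x * w x) * (indicator ?I x * (c * u' x))) \<in> borel_measurable lborel"
        using borel_measurable_continuous_on_indicator[OF _ wc] borel_measurable_integrable[OF cu'[unfolded set_integrable_def]]
        by simp
      then show "(\<lambda>x. indicator ?I x *\<^sub>R (w x * (c * u' x))) \<in> borel_measurable lborel"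
        by (rule measurable_cong[THEN iffD1, rotated]) (auto split: split_indicator)
      show "AE x in lborel. norm (indicator ?I x *\<^sub>R (w x * (c * u' x))) \<le> norm (K * \<bar>indicator ?I x *\<^sub>R (c * u' x)\<bar>)"
      proof (rule AE_I2)
        fix x
        show "norm (indicator ?I x *\<^sub>R (w x * (c * u' x))) \<le> norm (K * \<bar>indicator ?I x *\<^sub>R (c * u' x)\<bar>)"
        proof (cases "x \<in> ?I")
          case True
          then have "\<bar>w x\<bar> \<le> \<bar>K\<bar>" using K by force
          then have "\<bar>w x\<bar> * \<bar>c * u' x\<bar> \<le> \<bar>K\<bar> * \<bar>c * u' x\<bar>" by (rule mult_right_mono) simp
          then show ?thesis using True by (simp add: abs_mult)
        qed simp
      qed
    qed
  qed
  have wg: "set_integrable lborel ?I (\<lambda>x. w' x * f x + w x * g x)" by (intro cI continuous_intros w' fc wc g)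
  have m: "set_integrable lborel ?I (\<lambda>x. w' x * max 0 (f x))" by (intro cI continuous_intros w' fc)
  have f'I: "set_integrable lborel ?I (\<lambda>x. c * u' x + g x)"
    using set_integral_add(1)[OF set_integrable_mult_right[of c, OF u'] cI[OF g]] by simp
  have "(LBINT x:?I. w x * (if 0 < f x then c * u' x + g x else 0))
     = (LBINT x:?I. (p x * (w x * (c * u' x)) + p x * (w' x * f x + w x * g x)) - w' x * max 0 (f x))"
    by (rule set_lebesgue_integral_cong) (auto simp: p_def max_def algebra_simps)
  also have "\<dots> = (LBINT x:?I. p x * (w x * (c * u' x))) + (LBINT x:?I. p x * (w' x * f x + w x * g x))
      - (LBINT x:?I. w' x * max 0 (f x))"
    using pI[OF wu'] pI[OF wg] m by (simp add: set_integral_add set_integral_diff)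
  finally have "(LBINT x:?I. p x * (w x * (c * u' x))) =
      w h * max 0 (f h) - w l * max 0 (f l) - (LBINT x:?I. p x * (w' x * f x + w x * g x))"
    using integral_positive_part_by_parts[OF lh f f'I w w'] by simp
  moreover have "(LBINT x:?I. p x * k x) = (LBINT x:?I. if 0 < f x then k x else 0)" for k
    by (rule set_lebesgue_integral_cong) (auto simp: p_def)
  ultimately show ?thesis by simp
qed

text \<open>
The weight of a pair of times at distance \<open>h\<close>.  The singularity \<open>1 / h\<close> is what balances the term
with \<open>1 / \<delta>\<close> in \<open>shift_average_inequality\<close>; on the diagonal it meets violations of the order of \<open>h\<close>.
\<close>

definition lag_weight :: "real \<Rightarrow> real \<Rightarrow> real" where
  "lag_weight c h = exp (- c * h) / h"

lemma lag_weight_deriv: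
  "0 < h \<Longrightarrow> (lag_weight c has_real_derivative - (1 / h + c) * lag_weight c h) (at h)"
  unfolding lag_weight_def[abs_def] by (auto intro!: derivative_eq_intros simp: field_simps power2_eq_square)

lemma lag_weight_add: "lag_weight (c + k) h = exp (- k * h) * lag_weight c h"
  by (simp add: lag_weight_def exp_add[symmetric] algebra_simps)

lemma lag_weight_pos: "0 < h \<Longrightarrow> 0 < lag_weight c h"
  by (simp add: lag_weight_def)

lemma lag_weight_measurable [measurable]: "lag_weight c \<in> borel_measurable borel"
  unfolding lag_weight_def[abs_def] by measurable

text \<open>
At a fixed point of space, \<open>u\<close> is the value of the solution and \<open>v\<close> its weighted level:
\<open>u t = B (v t * exp (- r t))\<close>, where \<open>B\<close> inverts the nonlinearity.  If \<open>v\<close> were constant, \<open>u\<close>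
would follow the flow \<open>tr\<close>, whose rate is governed by \<open>E y = y * B' y\<close>.
\<close>

locale transported_path =
  fixes \<theta> k \<beta> a b :: real and u u' r r' v :: "real \<Rightarrow> real" and B E :: "real \<Rightarrow> real"
  assumes \<theta>_cases: "\<theta> \<in> {-1, 1}" and ab: "a < b"
    and u_deriv: "\<And>t. t \<in> {a..b} \<Longrightarrow> (u has_real_derivative u' t) (at t within {a..b})"
    and u'_int: "set_integrable lborel {a..b} u'"
    and r_deriv: "\<And>t. t \<in> {a..b} \<Longrightarrow> (r has_real_derivative r' t) (at t within {a..b})"
    and r'_cont: "continuous_on {a..b} r'"
    and B_cont: "continuous_on {0..} B" and E_cont: "continuous_on {0..} E" and E_0: "E 0 = 0"
    and B_deriv: "\<And>y. 0 < y \<Longrightarrow> (B has_real_derivative E y / y) (at y)"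
    and B_less: "\<And>x y. 0 \<le> x \<Longrightarrow> x < y \<Longrightarrow> B x < B y"
    and v_nonneg: "\<And>t. t \<in> {a..b} \<Longrightarrow> 0 \<le> v t"
    and v_cont: "continuous_on {a..b} v"
    and u_B: "\<And>t. t \<in> {a..b} \<Longrightarrow> u t = B (v t * exp (- r t))"
begin

text \<open>
The flow line that meets the path at time \<open>s\<close>, evaluated at time \<open>t\<close>.
\<close>

definition tr :: "real \<Rightarrow> real \<Rightarrow> real" where "tr s t = B (v s * exp (- r t))"

text \<open>
A pair \<open>s < t\<close> is bad if it violates the monotonicity of \<open>\<theta> v\<close>.  The violation is measured at
time \<open>s\<close> by \<open>F\<close> and at time \<open>t\<close> by \<open>G\<close>; both are positive exactly on the bad pairs.
\<close>

definition F :: "real \<Rightarrow> real \<Rightarrow> real" where "F s t = \<theta> * (u s - tr t s)"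

definition G :: "real \<Rightarrow> real \<Rightarrow> real" where "G s t = \<theta> * (tr s t - u t)"

definition bad :: "real \<Rightarrow> real \<Rightarrow> bool" where "bad s t \<longleftrightarrow> \<theta> * (v t - v s) < 0"

lemma r_cont: "continuous_on {a..b} r" by (rule DERIV_continuous_on[OF r_deriv])

lemma u_cont: "continuous_on {a..b} u" by (rule DERIV_continuous_on[OF u_deriv])

lemma B_less_iff: "0 \<le> x \<Longrightarrow> 0 \<le> y \<Longrightarrow> B x < B y \<longleftrightarrow> x < y"
  using B_less[of x y] B_less[of y x] by (cases x y rule: linorder_cases) auto

lemma bad_F: "s \<in> {a..b} \<Longrightarrow> t \<in> {a..b} \<Longrightarrow> bad s t \<longleftrightarrow> 0 < F s t"
  and bad_G: "s \<in> {a..b} \<Longrightarrow> t \<in> {a..b} \<Longrightarrow> bad s t \<longleftrightarrow> 0 < G s t"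
proof -
  assume s: "s \<in> {a..b}" and t: "t \<in> {a..b}"
  note nn = v_nonneg[OF s] v_nonneg[OF t]
  have *: "B (x * exp (- y)) < B (x' * exp (- y)) \<longleftrightarrow> x < x'" if "0 \<le> x" "0 \<le> x'" for x x' y
    using that by (subst B_less_iff) auto
  show "bad s t \<longleftrightarrow> 0 < F s t" "bad s t \<longleftrightarrow> 0 < G s t"
    using \<theta>_cases *[OF nn] *[OF nn(2,1)] by (auto simp: bad_def F_def G_def tr_def u_B[OF s] u_B[OF t])
qed

lemma tr_deriv:
  assumes s: "s \<in> {a..b}" and t: "t \<in> {a..b}"
  shows "(tr s has_real_derivative - r' t * E (v s * exp (- r t))) (at t within {a..b})"
proof (cases "v s = 0")
  case True
  then show ?thesis by (simp add: tr_def[abs_def] E_0)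
next
  case False
  then have pos: "0 < v s * exp (- r t)" using v_nonneg[OF s] by simp
  have "((\<lambda>t. v s * exp (- r t)) has_real_derivative - (v s * exp (- r t)) * r' t) (at t within {a..b})"
    by (auto intro!: derivative_eq_intros r_deriv[OF t])
  from DERIV_chain2[OF B_deriv[OF pos] this] show ?thesis
    using False by (simp add: tr_def[abs_def] field_simps)
qed

lemma transport_cont:
  assumes K: "continuous_on {0..} K"
  shows "continuous_on ({a..b} \<times> {a..b}) (\<lambda>(s, t). K (v s * exp (- r t)))"
  unfolding case_prod_beta
  by (rule continuous_on_compose2[OF K])
    (auto intro!: continuous_intros continuous_on_compose2[OF v_cont] continuous_on_compose2[OF r_cont] mult_nonneg_nonneg v_nonneg)

end

locale transported_path_lag = transported_path +
  assumes lag: "\<And>s t. a \<le> s \<Longrightarrow> s < t \<Longrightarrow> t \<le> b \<Longrightarrow> \<theta> * (v t - v s) < 0 \<Longrightarrow>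
     exp (- k * (t - s)) * ((1 / (t - s) + \<beta> + k) * (\<theta> * (u s - B (v t * exp (- r s)))) + \<theta> * r' s * E (v t * exp (- r s)))
     \<le> (1 / (t - s) + \<beta>) * (\<theta> * (B (v s * exp (- r t)) - u t)) + \<theta> * r' t * E (v s * exp (- r t))"
begin

abbreviation W1 :: "real \<Rightarrow> real" where "W1 \<equiv> lag_weight \<beta>"
abbreviation W2 :: "real \<Rightarrow> real" where "W2 \<equiv> lag_weight (\<beta> + k)"

lemma W1_deriv: "0 < h \<Longrightarrow> (W1 has_real_derivative - (1 / h + \<beta>) * W1 h) (at h)"
  by (rule lag_weight_deriv)

lemma W2_deriv: "0 < h \<Longrightarrow> (W2 has_real_derivative - (1 / h + \<beta> + k) * W2 h) (at h)"
  using lag_weight_deriv[of h "\<beta> + k"] by (simp add: add.assoc)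

lemma W_cont: "continuous_on {0<..} W1" "continuous_on {0<..} W2"
  using W1_deriv W2_deriv by (auto intro!: continuous_at_imp_continuous_on DERIV_isCont)

lemma W2_W1: "W2 h = exp (- k * h) * W1 h"
  by (rule lag_weight_add)

text \<open>
The double integral on the right is the one to which the equation gives a sign after integration
in space.  In its part with \<open>u' s\<close> one integrates by parts in \<open>s\<close>, where \<open>F s t\<close> has the derivative
\<open>\<theta> u' s\<close> plus a continuous term; in the part with \<open>u' t\<close> one integrates by parts in \<open>t\<close>, with \<open>G s t\<close>.
The boundary terms are those of the claim: the last time \<open>b\<close>, the diagonal \<open>t = s + e\<close> and the
first time \<open>a\<close>.  The interior terms have a sign by the lag inequality.
\<close>

lemma path_inequality:
  assumes e: "0 < e" "e < b - a"
  defines "D \<equiv> {(s, t). a \<le> s \<and> s + e \<le> t \<and> t \<le> b}"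
  defines "Y \<equiv> \<lambda>s t. indicator D (s, t) * (if bad s t then \<theta> * (W2 (t - s) * u' s - W1 (t - s) * u' t) else 0)"
  shows "(LBINT s:{a..b - e}. W1 (b - s) * max 0 (G s b))
      - (LBINT s:{a..b - e}. W1 e * max 0 (G s (s + e)) - W2 e * max 0 (F s (s + e)))
      - (LBINT t:{a + e..b}. W2 (t - a) * max 0 (F a t))
    \<le> (\<integral>x. case_prod Y x \<partial>(lborel \<Otimes>\<^sub>M lborel))"
proof -
  have D_closed: "closed D"
    unfolding D_def case_prod_unfold by (intro closed_Collect_conj closed_Collect_le continuous_intros)
  have D_sub: "D \<subseteq> {a..b} \<times> {a..b}" using e by (auto simp: D_def)
  have D_comp: "compact D" using compact_Int_closed[OF compact_Times[OF compact_Icc compact_Icc] D_closed, of a b a b] D_sub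
    by (simp add: Int_absorb1)
  have D_meas[measurable]: "D \<in> sets (lborel \<Otimes>\<^sub>M lborel)"
    unfolding lborel_prod using D_closed by simp
  have D_lag: "e \<le> t - s" "a \<le> s" "s \<le> b" "a \<le> t" "t \<le> b" "0 < t - s" if "(s, t) \<in> D" for s t
    using that e by (auto simp: D_def)
  have D_less: "fst x < snd x" if "x \<in> D" for x using that e by (auto simp: D_def)
  have contD: "continuous_on D f" if "continuous_on ({a..b} \<times> {a..b}) f" for f :: "real \<times> real \<Rightarrow> real"
    using that D_sub by (rule continuous_on_subset)
  have comp_int: "integrable (lborel \<Otimes>\<^sub>M lborel) (\<lambda>x. indicator D x * f x)" if "continuous_on D f" for f :: "real \<times> real \<Rightarrow> real"
    unfolding lborel_prod using borel_integrable_compact[OF D_comp that] by simp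
  have lagc: "continuous_on D (\<lambda>x. snd x - fst x)" "continuous_on D (\<lambda>x. 1 / (snd x - fst x))"
  proof -
    show *: "continuous_on D (\<lambda>x. snd x - fst x)" by (intro continuous_intros)
    have "snd x - fst x \<noteq> 0" if "x \<in> D" for x using D_less[OF that] by simp
    then show "continuous_on D (\<lambda>x. 1 / (snd x - fst x))"
      by (intro continuous_on_divide continuous_on_const * ballI)
  qed
  have Wc: "continuous_on D (\<lambda>x. W1 (snd x - fst x))" "continuous_on D (\<lambda>x. W2 (snd x - fst x))"
    by (rule continuous_on_compose2[OF W_cont(1) lagc(1)] continuous_on_compose2[OF W_cont(2) lagc(1)],
        use D_less in force)+
  have one: "continuous_on D (\<lambda>x. f (fst x))" "continuous_on D (\<lambda>x. f (snd x))" if "continuous_on {a..b} f" for f :: "real \<Rightarrow> real"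
    by (rule continuous_on_compose2[OF that]; use D_sub in \<open>auto intro!: continuous_intros\<close>)+
  have tc: "continuous_on D (\<lambda>x. K (v (fst x) * exp (- r (snd x))))" "continuous_on D (\<lambda>x. K (v (snd x) * exp (- r (fst x))))"
    if "continuous_on {0..} K" for K :: "real \<Rightarrow> real"
  proof -
    show "continuous_on D (\<lambda>x. K (v (fst x) * exp (- r (snd x))))"
      using contD[OF transport_cont[OF that]] by (simp add: case_prod_beta)
    have "continuous_on D (\<lambda>x. (snd x, fst x))" by (intro continuous_intros)
    from continuous_on_compose2[OF transport_cont[OF that] this]
    show "continuous_on D (\<lambda>x. K (v (snd x) * exp (- r (fst x))))" using D_sub by (force simp: case_prod_beta)
  qed
  define bi where "bi x = (if bad (fst x) (snd x) then 1 else 0 :: real)" for x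
  have bad_meas: "(\<lambda>x. indicator D x * bi x) \<in> borel_measurable (lborel \<Otimes>\<^sub>M lborel)"
  proof -
    have "continuous_on D (\<lambda>x. - (\<theta> * (v (snd x) - v (fst x))))" by (intro continuous_intros one v_cont)
    from borel_measurable_integrable[OF comp_int[OF this]]
    have [measurable]: "(\<lambda>x. indicator D x * - (\<theta> * (v (snd x) - v (fst x)))) \<in> borel_measurable (lborel \<Otimes>\<^sub>M lborel)" .
    have "(\<lambda>x. if 0 < indicator D x * - (\<theta> * (v (snd x) - v (fst x))) then 1 else 0 :: real) \<in> borel_measurable (lborel \<Otimes>\<^sub>M lborel)"
      by measurable
    then show ?thesis by (rule measurable_cong[THEN iffD1, rotated]) (auto simp: bi_def bad_def split: split_indicator)
  qed
  have bad_int: "integrable (lborel \<Otimes>\<^sub>M lborel) (\<lambda>x. indicator D x * (bi x * f x))"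
    if "integrable (lborel \<Otimes>\<^sub>M lborel) (\<lambda>x. indicator D x * f x)" for f
  proof (rule Bochner_Integration.integrable_bound[OF that])
    have "(\<lambda>x. (indicator D x * bi x) * (indicator D x * f x)) \<in> borel_measurable (lborel \<Otimes>\<^sub>M lborel)"
      using bad_meas borel_measurable_integrable[OF that] by measurable
    then show "(\<lambda>x. indicator D x * (bi x * f x)) \<in> borel_measurable (lborel \<Otimes>\<^sub>M lborel)"
      by (rule measurable_cong[THEN iffD1, rotated]) (auto split: split_indicator)
  qed (auto simp: bi_def split: split_indicator)
  define X1 where "X1 s t = W2 (t - s) * ((1 / (t - s) + \<beta> + k) * F s t + \<theta> * r' s * E (v t * exp (- r s)))" for s t
  define X2 where "X2 s t = W1 (t - s) * ((1 / (t - s) + \<beta>) * G s t + \<theta> * r' t * E (v s * exp (- r t)))" for s t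
  have F_cont: "continuous_on D (\<lambda>x. F (fst x) (snd x))" and G_cont: "continuous_on D (\<lambda>x. G (fst x) (snd x))"
    unfolding F_def G_def tr_def by (intro continuous_intros one u_cont tc B_cont)+
  have X1_int: "integrable (lborel \<Otimes>\<^sub>M lborel) (\<lambda>x. indicator D x * (bi x * X1 (fst x) (snd x)))"
    unfolding X1_def by (intro bad_int comp_int continuous_intros Wc lagc F_cont one r'_cont tc E_cont)
  have X2_int: "integrable (lborel \<Otimes>\<^sub>M lborel) (\<lambda>x. indicator D x * (bi x * X2 (fst x) (snd x)))"
    unfolding X2_def by (intro bad_int comp_int continuous_intros Wc lagc G_cont one r'_cont tc E_cont)
  have u'_meas: "(\<lambda>x. indicator {a..b} x * u' x) \<in> borel_measurable borel"
    using borel_measurable_integrable[OF u'_int[unfolded set_integrable_def]] by simp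
  define U where "U x = indicator {a..b} x * u' x" for x
  have U_int: "integrable lborel U" using u'_int by (simp add: set_integrable_def U_def[abs_def])
  have ind_int: "integrable lborel (indicator {a..b} :: real \<Rightarrow> real)"
    by (rule integrable_real_indicator) (auto simp: emeasure_lborel_Icc_eq)
  have prod_int: "integrable (lborel \<Otimes>\<^sub>M lborel) (\<lambda>x. indicator D x * (c x * U (fst x)))"
      "integrable (lborel \<Otimes>\<^sub>M lborel) (\<lambda>x. indicator D x * (c x * U (snd x)))" if c: "continuous_on D c" for c
  proof -
    obtain K where K: "\<And>x. x \<in> D \<Longrightarrow> \<bar>c x\<bar> \<le> K"
    proof -
      obtain K where "\<forall>x\<in>D. \<bar>c x\<bar> \<le> K"
        using compact_imp_bounded[OF compact_continuous_image[OF c D_comp]] by (auto simp: bounded_iff)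
      then show ?thesis using that by blast
    qed
    have [measurable]: "U \<in> borel_measurable borel" using U_int by auto
    have cm[measurable]: "(\<lambda>x. indicator D x * c x) \<in> borel_measurable (lborel \<Otimes>\<^sub>M lborel)"
      using comp_int[OF c] by (rule borel_measurable_integrable)
    have m: "(\<lambda>x. (indicator D x * c x) * U (fst x)) \<in> borel_measurable (lborel \<Otimes>\<^sub>M lborel)"
      "(\<lambda>x. (indicator D x * c x) * U (snd x)) \<in> borel_measurable (lborel \<Otimes>\<^sub>M lborel)" by measurable
    have Ua: "integrable lborel (\<lambda>x. \<bar>U x\<bar>)" using U_int by simp
    have Kin: "integrable lborel (\<lambda>x. K * indicator {a..b} x)" using ind_int by simp
    have i1: "integrable (lborel \<Otimes>\<^sub>M lborel) (\<lambda>(x, y). \<bar>U x\<bar> * (K * indicator {a..b} y))"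
      and i2: "integrable (lborel \<Otimes>\<^sub>M lborel) (\<lambda>(x, y). (K * indicator {a..b} x) * \<bar>U y\<bar>)"
      using lborel_pair.integrable_mult_fst_snd[OF Ua Kin] lborel_pair.integrable_mult_fst_snd[OF Kin Ua] .
    show "integrable (lborel \<Otimes>\<^sub>M lborel) (\<lambda>x. indicator D x * (c x * U (fst x)))"
    proof (rule Bochner_Integration.integrable_bound[OF i1])
      show "AE x in lborel \<Otimes>\<^sub>M lborel. norm (indicator D x * (c x * U (fst x))) \<le> norm (case x of (x, y) \<Rightarrow> \<bar>U x\<bar> * (K * indicator {a..b} y))"
      proof (rule AE_I2)
        fix x :: "real \<times> real"
        show "norm (indicator D x * (c x * U (fst x))) \<le> norm (case x of (x, y) \<Rightarrow> \<bar>U x\<bar> * (K * indicator {a..b} y))"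
        proof (cases "x \<in> D")
          case True
          then have "\<bar>c x\<bar> * \<bar>U (fst x)\<bar> \<le> \<bar>K\<bar> * \<bar>U (fst x)\<bar>" using K[OF True] by (intro mult_right_mono) auto
          then show ?thesis using True D_sub by (auto simp: case_prod_beta abs_mult mult.commute)
        qed simp
      qed
    qed (use m in \<open>simp add: mult.assoc\<close>)
    show "integrable (lborel \<Otimes>\<^sub>M lborel) (\<lambda>x. indicator D x * (c x * U (snd x)))"
    proof (rule Bochner_Integration.integrable_bound[OF i2])
      show "AE x in lborel \<Otimes>\<^sub>M lborel. norm (indicator D x * (c x * U (snd x))) \<le> norm (case x of (x, y) \<Rightarrow> (K * indicator {a..b} x) * \<bar>U y\<bar>)"
      proof (rule AE_I2)
        fix x :: "real \<times> real"
        show "norm (indicator D x * (c x * U (snd x))) \<le> norm (case x of (x, y) \<Rightarrow> (K * indicator {a..b} x) * \<bar>U y\<bar>)"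
        proof (cases "x \<in> D")
          case True
          then have "\<bar>c x\<bar> * \<bar>U (snd x)\<bar> \<le> \<bar>K\<bar> * \<bar>U (snd x)\<bar>" using K[OF True] by (intro mult_right_mono) auto
          then show ?thesis using True D_sub by (auto simp: case_prod_beta abs_mult mult.commute)
        qed simp
      qed
    qed (use m in \<open>simp add: mult.assoc\<close>)
  qed
  define Y1 where "Y1 s t = indicator D (s, t) * (bi (s, t) * (\<theta> * W2 (t - s) * U s))" for s t
  define Y2 where "Y2 s t = indicator D (s, t) * (bi (s, t) * (- \<theta> * W1 (t - s) * U t))" for s t
  define Z1 where "Z1 s t = indicator D (s, t) * (bi (s, t) * X1 s t)" for s t
  define Z2 where "Z2 s t = indicator D (s, t) * (bi (s, t) * X2 s t)" for s t
  have Z1: "integrable (lborel \<Otimes>\<^sub>M lborel) (case_prod Z1)" and Z2: "integrable (lborel \<Otimes>\<^sub>M lborel) (case_prod Z2)"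
    using X1_int X2_int by (simp_all add: Z1_def[abs_def] Z2_def[abs_def] case_prod_beta' )
  have Y1: "integrable (lborel \<Otimes>\<^sub>M lborel) (case_prod Y1)" and Y2: "integrable (lborel \<Otimes>\<^sub>M lborel) (case_prod Y2)"
  proof -
    have "continuous_on D (\<lambda>x. \<theta> * W2 (snd x - fst x))" "continuous_on D (\<lambda>x. - \<theta> * W1 (snd x - fst x))"
      by (intro continuous_intros Wc)+
    from bad_int[OF prod_int(1)[OF this(1)]] bad_int[OF prod_int(2)[OF this(2)]]
    show "integrable (lborel \<Otimes>\<^sub>M lborel) (case_prod Y1)" "integrable (lborel \<Otimes>\<^sub>M lborel) (case_prod Y2)"
      by (simp_all add: Y1_def[abs_def] Y2_def[abs_def] case_prod_beta')
  qed
  have Y_eq: "Y s t = Y1 s t + Y2 s t" for s t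
    using D_sub by (auto simp: Y_def Y1_def Y2_def U_def bi_def algebra_simps split: split_indicator)
  have bad_pos: "bad s t \<longleftrightarrow> 0 < F s t" "bad s t \<longleftrightarrow> 0 < G s t" if "(s, t) \<in> D" for s t
    using bad_F[of s t] bad_G[of s t] D_lag[OF that] by auto
  \<comment> \<open>What the two integrations by parts leave in the interior has a sign by the lag inequality.\<close>
  have Z_le: "Z1 s t \<le> Z2 s t" for s t
  proof (cases "(s, t) \<in> D \<and> bad s t")
    case True
    then have l: "a \<le> s" "s < t" "t \<le> b" using D_lag[of s t] by auto
    have "X1 s t = W1 (t - s) * (exp (- k * (t - s)) * ((1 / (t - s) + \<beta> + k) * F s t + \<theta> * r' s * E (v t * exp (- r s))))"
      by (simp add: X1_def W2_W1 algebra_simps)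
    also have "\<dots> \<le> X2 s t"
      unfolding X2_def F_def G_def tr_def using lag[OF l] True l
      by (intro mult_left_mono) (auto simp: bad_def lag_weight_def)
    finally show ?thesis using True by (simp add: Z1_def Z2_def bi_def)
  qed (auto simp: Z1_def Z2_def bi_def)
  have inner1: "(\<integral>s. Y1 s t \<partial>lborel) = indicator {a + e..b} t * (W2 e * max 0 (F (t - e) t) - W2 (t - a) * max 0 (F a t)) - (\<integral>s. Z1 s t \<partial>lborel)" for t
  proof (cases "t \<in> {a + e..b}")
    case False
    then have "(s, t) \<notin> D" for s by (auto simp: D_def)
    then show ?thesis using False by (simp add: Y1_def Z1_def)
  next
    case True
    let ?I = "{a..t - e}"
    have sub: "?I \<subseteq> {a..b}" and tI: "t \<in> {a..b}" using True e by auto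
    have D_iff: "(s, t) \<in> D \<longleftrightarrow> s \<in> ?I" for s using True by (auto simp: D_def)
    have deriv: "((\<lambda>s. F s t) has_real_derivative \<theta> * u' s + \<theta> * (r' s * E (v t * exp (- r s)))) (at s within ?I)" if "s \<in> ?I" for s
    proof -
      have "s \<in> {a..b}" using that sub by auto
      from DERIV_cmult[OF DERIV_diff[OF u_deriv[OF this] tr_deriv[OF tI this]], of \<theta>]
      have "((\<lambda>s. F s t) has_real_derivative \<theta> * u' s + \<theta> * (r' s * E (v t * exp (- r s)))) (at s within {a..b})"
        unfolding F_def by (rule DERIV_cong) (simp add: algebra_simps)
      then show ?thesis by (rule DERIV_subset[OF _ sub])
    qed
    have Ec: "continuous_on ?I (\<lambda>s. E (v t * exp (- r s)))"
      by (rule continuous_on_compose2[OF E_cont])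
        (use sub tI v_nonneg[OF tI] in \<open>auto intro!: continuous_intros continuous_on_subset[OF r_cont]\<close>)
    have r'c: "continuous_on ?I r'" by (rule continuous_on_subset[OF r'_cont sub])
    have Fc: "continuous_on ?I (\<lambda>s. F s t)" by (rule DERIV_continuous_on[OF deriv])
    have wd: "((\<lambda>s. W2 (t - s)) has_real_derivative (1 / (t - s) + \<beta> + k) * W2 (t - s)) (at s within ?I)" if "s \<in> ?I" for s
    proof -
      have pos: "0 < t - s" using that e by simp
      have "((\<lambda>s. t - s) has_real_derivative - 1) (at s within ?I)" by (auto intro!: derivative_eq_intros)
      from DERIV_chain2[OF W2_deriv[OF pos] this] show ?thesis
        by (rule DERIV_cong) (simp add: algebra_simps)
    qed
    have W2c: "continuous_on ?I (\<lambda>s. W2 (t - s))" by (rule DERIV_continuous_on[OF wd])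
    have lc: "continuous_on ?I (\<lambda>s. 1 / (t - s))" using e by (auto intro!: continuous_intros)
    have w'c: "continuous_on ?I (\<lambda>s. (1 / (t - s) + \<beta> + k) * W2 (t - s))" by (intro continuous_intros lc W2c)
    have gc: "continuous_on ?I (\<lambda>s. \<theta> * (r' s * E (v t * exp (- r s))))" by (intro continuous_intros r'c Ec)
    have u'I: "set_integrable lborel ?I u'" by (rule set_integrable_subset[OF u'_int]) (use sub in auto)
    have "(\<integral>s. Y1 s t \<partial>lborel) = (LBINT s:?I. if 0 < F s t then W2 (t - s) * (\<theta> * u' s) else 0)"
      unfolding set_lebesgue_integral_def
      by (rule Bochner_Integration.integral_cong)
        (use sub D_iff bad_pos in \<open>auto simp: Y1_def U_def bi_def split: split_indicator\<close>)
    moreover have "(\<integral>s. Z1 s t \<partial>lborel) = (LBINT s:?I. if 0 < F s t then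
        (1 / (t - s) + \<beta> + k) * W2 (t - s) * F s t + W2 (t - s) * (\<theta> * (r' s * E (v t * exp (- r s)))) else 0)"
      unfolding set_lebesgue_integral_def
      by (rule Bochner_Integration.integral_cong)
        (use sub D_iff bad_pos in \<open>auto simp: Z1_def X1_def bi_def algebra_simps split: split_indicator\<close>)
    ultimately show ?thesis
      using integral_on_positive_set[OF _ deriv u'I wd w'c gc] True by simp
  qed
  have inner2: "(\<integral>t. Y2 s t \<partial>lborel) = indicator {a..b - e} s * (W1 (b - s) * max 0 (G s b) - W1 e * max 0 (G s (s + e))) + (\<integral>t. Z2 s t \<partial>lborel)" for s
  proof (cases "s \<in> {a..b - e}")
    case False
    then have "(s, t) \<notin> D" for t by (auto simp: D_def)
    then show ?thesis using False by (simp add: Y2_def Z2_def)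
  next
    case True
    let ?I = "{s + e..b}"
    have sub: "?I \<subseteq> {a..b}" and sI: "s \<in> {a..b}" using True e by auto
    have D_iff: "(s, t) \<in> D \<longleftrightarrow> t \<in> ?I" for t using True by (auto simp: D_def)
    have deriv: "((\<lambda>t. G s t) has_real_derivative - \<theta> * u' t + - \<theta> * (r' t * E (v s * exp (- r t)))) (at t within ?I)" if "t \<in> ?I" for t
    proof -
      have "t \<in> {a..b}" using that sub by auto
      from DERIV_cmult[OF DERIV_diff[OF tr_deriv[OF sI this] u_deriv[OF this]], of \<theta>]
      have "(G s has_real_derivative - \<theta> * u' t + - \<theta> * (r' t * E (v s * exp (- r t)))) (at t within {a..b})"
        unfolding G_def[abs_def] by (rule DERIV_cong) (simp add: algebra_simps)
      then show ?thesis by (rule DERIV_subset[OF _ sub])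
    qed
    have Ec: "continuous_on ?I (\<lambda>t. E (v s * exp (- r t)))"
      by (rule continuous_on_compose2[OF E_cont])
        (use sub sI v_nonneg[OF sI] in \<open>auto intro!: continuous_intros continuous_on_subset[OF r_cont]\<close>)
    have r'c: "continuous_on ?I r'" by (rule continuous_on_subset[OF r'_cont sub])
    have wd: "((\<lambda>t. W1 (t - s)) has_real_derivative - (1 / (t - s) + \<beta>) * W1 (t - s)) (at t within ?I)" if "t \<in> ?I" for t
    proof -
      have pos: "0 < t - s" using that e by simp
      have "((\<lambda>t. t - s) has_real_derivative 1) (at t within ?I)" by (auto intro!: derivative_eq_intros)
      from DERIV_chain2[OF W1_deriv[OF pos] this] show ?thesis
        by (rule DERIV_cong) (simp add: algebra_simps)
    qed
    have W1c: "continuous_on ?I (\<lambda>t. W1 (t - s))" by (rule DERIV_continuous_on[OF wd])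
    have lc: "continuous_on ?I (\<lambda>t. 1 / (t - s))" using e by (auto intro!: continuous_intros)
    have w'c: "continuous_on ?I (\<lambda>t. - (1 / (t - s) + \<beta>) * W1 (t - s))" by (intro continuous_intros lc W1c)
    have gc: "continuous_on ?I (\<lambda>t. - \<theta> * (r' t * E (v s * exp (- r t))))" by (intro continuous_intros r'c Ec)
    have u'I: "set_integrable lborel ?I u'" by (rule set_integrable_subset[OF u'_int]) (use sub in auto)
    have "(\<integral>t. Y2 s t \<partial>lborel) = (LBINT t:?I. if 0 < G s t then W1 (t - s) * (- \<theta> * u' t) else 0)"
      unfolding set_lebesgue_integral_def
      by (rule Bochner_Integration.integral_cong)
        (use sub D_iff bad_pos in \<open>auto simp: Y2_def U_def bi_def split: split_indicator\<close>)
    moreover have "(\<integral>t. Z2 s t \<partial>lborel) = - (LBINT t:?I. if 0 < G s t then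
        - (1 / (t - s) + \<beta>) * W1 (t - s) * G s t + W1 (t - s) * (- \<theta> * (r' t * E (v s * exp (- r t)))) else 0)"
      unfolding set_lebesgue_integral_def integral_minus[symmetric]
      by (rule Bochner_Integration.integral_cong)
        (use sub D_iff bad_pos in \<open>auto simp: Z2_def X2_def bi_def algebra_simps split: split_indicator\<close>)
    ultimately show ?thesis
      using integral_on_positive_set[OF _ deriv u'I wd w'c gc] True by simp
  qed
  have Gd: "continuous_on {a..b - e} (\<lambda>s. G s (s + e))" and Fd: "continuous_on {a..b - e} (\<lambda>s. F s (s + e))"
    and Gb: "continuous_on {a..b - e} (\<lambda>s. G s b)" and Fa: "continuous_on {a + e..b} (\<lambda>t. F a t)"
    and Fd': "continuous_on {a + e..b} (\<lambda>t. F (t - e) t)"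
    using e by (auto intro!: continuous_intros continuous_on_compose2[OF G_cont, where f="\<lambda>s. (s, s + e)", simplified]
      continuous_on_compose2[OF F_cont, where f="\<lambda>s. (s, s + e)", simplified]
      continuous_on_compose2[OF G_cont, where f="\<lambda>s. (s, b)", simplified]
      continuous_on_compose2[OF F_cont, where f="\<lambda>t. (a, t)", simplified]
      continuous_on_compose2[OF F_cont, where f="\<lambda>t. (t - e, t)", simplified] simp: D_def)
  have Wd: "continuous_on {a..b - e} (\<lambda>s. W1 (b - s))" "continuous_on {a + e..b} (\<lambda>t. W2 (t - a))"
    using e by (auto intro!: continuous_intros continuous_on_compose2[OF W_cont(1)] continuous_on_compose2[OF W_cont(2)])
  have ci: "set_integrable lborel {x..y} f" if "continuous_on {x..y} f" for x y and f :: "real \<Rightarrow> real"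
    unfolding set_integrable_def by (rule borel_integrable_compact) (use that in auto)
  have i_final: "set_integrable lborel {a..b - e} (\<lambda>s. W1 (b - s) * max 0 (G s b))"
    and i_G: "set_integrable lborel {a..b - e} (\<lambda>s. W1 e * max 0 (G s (s + e)))"
    and i_F: "set_integrable lborel {a..b - e} (\<lambda>s. W2 e * max 0 (F s (s + e)))"
    and i_F': "set_integrable lborel {a + e..b} (\<lambda>t. W2 e * max 0 (F (t - e) t))"
    and i_a: "set_integrable lborel {a + e..b} (\<lambda>t. W2 (t - a) * max 0 (F a t))"
    by (intro ci continuous_intros Gd Fd Gb Fa Fd' Wd)+
  have J1: "(\<integral>x. case_prod Y1 x \<partial>(lborel \<Otimes>\<^sub>M lborel)) =
      (LBINT t:{a + e..b}. W2 e * max 0 (F (t - e) t)) - (LBINT t:{a + e..b}. W2 (t - a) * max 0 (F a t))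
      - (\<integral>x. case_prod Z1 x \<partial>(lborel \<Otimes>\<^sub>M lborel))"
  proof -
    have "(\<integral>x. case_prod Y1 x \<partial>(lborel \<Otimes>\<^sub>M lborel)) = (\<integral>t. (\<integral>s. Y1 s t \<partial>lborel) \<partial>lborel)"
      using lborel_pair.integral_snd[OF Y1] by simp
    also have "\<dots> = (\<integral>t. indicator {a + e..b} t *\<^sub>R (W2 e * max 0 (F (t - e) t) - W2 (t - a) * max 0 (F a t)) - (\<integral>s. Z1 s t \<partial>lborel) \<partial>lborel)"
      by (simp add: inner1)
    also have "\<dots> = (LBINT t:{a + e..b}. W2 e * max 0 (F (t - e) t) - W2 (t - a) * max 0 (F a t)) - (\<integral>t. (\<integral>s. Z1 s t \<partial>lborel) \<partial>lborel)"
      unfolding set_lebesgue_integral_def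
      by (rule Bochner_Integration.integral_diff[OF set_integral_diff(1)[OF i_F' i_a, unfolded set_integrable_def] lborel_pair.integrable_snd[OF Z1]])
    also have "(\<integral>t. (\<integral>s. Z1 s t \<partial>lborel) \<partial>lborel) = (\<integral>x. case_prod Z1 x \<partial>(lborel \<Otimes>\<^sub>M lborel))"
      by (rule lborel_pair.integral_snd[OF Z1])
    finally show ?thesis by (simp add: set_integral_diff(2)[OF i_F' i_a])
  qed
  have J2: "(\<integral>x. case_prod Y2 x \<partial>(lborel \<Otimes>\<^sub>M lborel)) =
      (LBINT s:{a..b - e}. W1 (b - s) * max 0 (G s b)) - (LBINT s:{a..b - e}. W1 e * max 0 (G s (s + e)))
      + (\<integral>x. case_prod Z2 x \<partial>(lborel \<Otimes>\<^sub>M lborel))"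
  proof -
    have "(\<integral>x. case_prod Y2 x \<partial>(lborel \<Otimes>\<^sub>M lborel)) = (\<integral>s. (\<integral>t. Y2 s t \<partial>lborel) \<partial>lborel)"
      using lborel_pair.integral_fst[OF Y2] by simp
    also have "\<dots> = (\<integral>s. indicator {a..b - e} s *\<^sub>R (W1 (b - s) * max 0 (G s b) - W1 e * max 0 (G s (s + e))) + (\<integral>t. Z2 s t \<partial>lborel) \<partial>lborel)"
      by (simp add: inner2)
    also have "\<dots> = (LBINT s:{a..b - e}. W1 (b - s) * max 0 (G s b) - W1 e * max 0 (G s (s + e))) + (\<integral>s. (\<integral>t. Z2 s t \<partial>lborel) \<partial>lborel)"
      unfolding set_lebesgue_integral_def
      by (rule Bochner_Integration.integral_add[OF set_integral_diff(1)[OF i_final i_G, unfolded set_integrable_def] lborel_pair.integrable_fst[OF Z2]])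
    also have "(\<integral>s. (\<integral>t. Z2 s t \<partial>lborel) \<partial>lborel) = (\<integral>x. case_prod Z2 x \<partial>(lborel \<Otimes>\<^sub>M lborel))"
      by (rule lborel_pair.integral_fst[OF Z2])
    finally show ?thesis by (simp add: set_integral_diff(2)[OF i_final i_G])
  qed
  have shift: "(LBINT t:{a + e..b}. W2 e * max 0 (F (t - e) t)) = (LBINT s:{a..b - e}. W2 e * max 0 (F s (s + e)))"
    unfolding set_lebesgue_integral_def
    by (subst lborel_integral_real_affine[of 1 _ e]) (auto intro!: Bochner_Integration.integral_cong simp: add.commute split: split_indicator)
  have ZZ: "(\<integral>x. case_prod Z1 x \<partial>(lborel \<Otimes>\<^sub>M lborel)) \<le> (\<integral>x. case_prod Z2 x \<partial>(lborel \<Otimes>\<^sub>M lborel))"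
    by (rule integral_mono[OF Z1 Z2]) (auto simp: Z_le)
  have "(\<integral>x. case_prod Y x \<partial>(lborel \<Otimes>\<^sub>M lborel)) = (\<integral>x. case_prod Y1 x + case_prod Y2 x \<partial>(lborel \<Otimes>\<^sub>M lborel))"
    by (simp add: Y_eq case_prod_beta')
  also have "\<dots> = (\<integral>x. case_prod Y1 x \<partial>(lborel \<Otimes>\<^sub>M lborel)) + (\<integral>x. case_prod Y2 x \<partial>(lborel \<Otimes>\<^sub>M lborel))"
    by (rule Bochner_Integration.integral_add[OF Y1 Y2])
  finally show ?thesis
    unfolding set_integral_diff(2)[OF i_G i_F] using J1[unfolded shift] J2 ZZ by linarith
qed

end

section \<open>The diagonal, and nonlinearities of bounded range\<close>

context transported_path
begin

lemma tr_self: "t \<in> {a..b} \<Longrightarrow> tr t t = u t"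
  by (simp add: tr_def u_B)

lemma tr_increment:
  assumes "p \<in> {a..b}" "a \<le> s" "s < t" "t \<le> b"
  obtains q where "s < q" "q < t" "tr p t - tr p s = (t - s) * (- r' q * E (v p * exp (- r q)))"
proof -
  have "\<exists>l z. s < z \<and> z < t \<and> (tr p has_real_derivative l) (at z) \<and> tr p t - tr p s = (t - s) * l"
  proof (rule MVT[OF \<open>s < t\<close>])
    have "continuous_on {a..b} (tr p)" by (rule DERIV_continuous_on[OF tr_deriv[OF assms(1)]])
    then show "continuous_on {s..t} (tr p)" by (rule continuous_on_subset) (use assms in auto)
    show "tr p differentiable (at z)" if "s < z" "z < t" for z
      using tr_deriv[OF assms(1), of z] at_within_Icc_at[of a z b] that assms
      by (auto simp: real_differentiable_def)
  qed
  then obtain l z where z: "s < z" "z < t" "(tr p has_real_derivative l) (at z)" "tr p t - tr p s = (t - s) * l"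
    by blast
  have "(tr p has_real_derivative - r' z * E (v p * exp (- r z))) (at z)"
    using tr_deriv[OF assms(1), of z] at_within_Icc_at[of a z b] z assms by auto
  from DERIV_unique[OF z(3) this] z show ?thesis using that by blast
qed

text \<open>
The two measures of a violation differ by the increments of two flow lines over the same time
interval of length \<open>e\<close>, and these lines meet the path at its two ends.  By the mean value theorem
the increments are \<open>e\<close> times values of a continuous function at points that approach each other.
\<close>

lemma crossing_defect_small:
  assumes s: "a \<le> s" "s < b"
  shows "((\<lambda>e. (G s (s + e) - F s (s + e)) / e) \<longlongrightarrow> 0) (at_right 0)"
proof (rule tendstoI)
  fix \<epsilon> :: real assume \<epsilon>: "0 < \<epsilon>"
  define g where "g = (\<lambda>x. r' (snd x) * E (v (fst x) * exp (- r (snd x))))"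
  have "continuous_on ({a..b} \<times> {a..b}) g"
    unfolding g_def
    by (intro continuous_intros transport_cont[OF E_cont, unfolded case_prod_beta] continuous_on_compose2[OF r'_cont]) auto
  then have "\<exists>d>0. \<forall>x\<in>{a..b} \<times> {a..b}. dist x (s, s) < d \<longrightarrow> dist (g x) (g (s, s)) < \<epsilon> / 2"
    using s \<epsilon> unfolding continuous_on_iff by (metis SigmaI atLeastAtMost_iff half_gt_zero less_imp_le order_refl)
  then obtain d where d: "0 < d" "\<And>x. x \<in> {a..b} \<times> {a..b} \<Longrightarrow> dist x (s, s) < d \<Longrightarrow> dist (g x) (g (s, s)) < \<epsilon> / 2"
    by blast
  have near: "\<bar>(G s (s + e) - F s (s + e)) / e\<bar> < \<epsilon>" if e: "0 < e" "e < min (d / 2) (b - s)" for e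
  proof -
    let ?t = "s + e"
    have sI: "s \<in> {a..b}" and tI: "?t \<in> {a..b}" and st: "s < ?t" "?t \<le> b" using s e by auto
    obtain q1 where q1: "s < q1" "q1 < ?t" "tr s ?t - tr s s = e * (- g (s, q1))"
      using tr_increment[OF sI s(1) st] by (auto simp: g_def)
    obtain q2 where q2: "s < q2" "q2 < ?t" "tr ?t ?t - tr ?t s = e * (- g (?t, q2))"
      using tr_increment[OF tI s(1) st] by (auto simp: g_def)
    have "G s ?t - F s ?t = \<theta> * ((tr s ?t - tr s s) - (tr ?t ?t - tr ?t s))"
      unfolding G_def F_def tr_self[OF sI] tr_self[OF tI] by (simp add: algebra_simps)
    also have "\<dots> = e * (\<theta> * (g (?t, q2) - g (s, q1)))" unfolding q1 q2 by (simp add: algebra_simps)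
    finally have eq: "\<bar>(G s ?t - F s ?t) / e\<bar> = \<bar>g (?t, q2) - g (s, q1)\<bar>"
      using e \<theta>_cases by (auto simp: abs_mult)
    have dd: "dist (x, y) (s, s) < d" if "\<bar>x - s\<bar> \<le> e" "\<bar>y - s\<bar> \<le> e" for x y
    proof -
      have "dist (x, y) (s, s) \<le> \<bar>x - s\<bar> + \<bar>y - s\<bar>"
        using sqrt_sum_squares_le_sum_abs[of "dist x s" "dist y s"] by (simp add: dist_Pair_Pair dist_real_def)
      with that e show ?thesis by auto
    qed
    have "dist (g (?t, q2)) (g (s, s)) < \<epsilon> / 2" "dist (g (s, q1)) (g (s, s)) < \<epsilon> / 2"
      by (rule d(2)[OF _ dd]; use q1 q2 sI tI e in simp)+
    then show ?thesis unfolding eq dist_real_def by linarith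
  qed
  show "\<forall>\<^sub>F e in at_right 0. dist ((G s (s + e) - F s (s + e)) / e) 0 < \<epsilon>"
    unfolding eventually_at_right_field using near d(1) s
    by (intro exI[of _ "min (d / 2) (b - s)"]) (auto simp: dist_real_def)
qed

end

context nonlinearity
begin

text \<open>
Above the level \<open>\<phi> M\<close> the inverse of \<open>\<phi>\<close> is continued linearly with the same slope, which makes
every level attainable even if \<open>\<phi>\<close> is bounded.
\<close>

definition ext_inverse :: "real \<Rightarrow> real \<Rightarrow> real" where
  "ext_inverse M y = (if y \<le> \<phi> M then level_inverse \<phi> y else M + (y - \<phi> M) / deriv \<phi> M)"

text \<open>
\<open>y\<close> times the derivative of \<open>ext_inverse M\<close> at \<open>y\<close>.
\<close>

definition ext_rate :: "real \<Rightarrow> real \<Rightarrow> real" where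
  "ext_rate M y = (if y \<le> \<phi> M then V (level_inverse \<phi> y) else y / deriv \<phi> M)"

lemma level_inverse_0 [simp]: "level_inverse \<phi> 0 = 0"
  using level_inverse_phi[of 0] by simp

lemma ext_inverse_deriv:
  assumes M: "0 < M" and y: "0 < y"
  shows "(ext_inverse M has_real_derivative ext_rate M y / y) (at y)"
proof -
  have nz: "\<phi> M \<noteq> 0" "deriv \<phi> M \<noteq> 0" using phi_pos[OF M] phi'_pos[OF M] by auto
  have inv: "(level_inverse \<phi> has_real_derivative V (level_inverse \<phi> y) / y) (at y)" if "y \<le> \<phi> M"
    by (rule level_inverse_deriv[of y "M + 1"]) (use that y M phi_less[of M "M + 1"] in auto)
  have lin: "((\<lambda>y. M + (y - \<phi> M) / deriv \<phi> M) has_real_derivative 1 / deriv \<phi> M) (at y)"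
    using nz by (auto intro!: derivative_eq_intros)
  consider "y < \<phi> M" | "y = \<phi> M" | "\<phi> M < y" by linarith
  then show ?thesis
  proof cases
    case 1
    show ?thesis
      by (rule has_field_derivative_transform_within[where d="\<phi> M - y" and f="level_inverse \<phi>"])
        (use 1 inv in \<open>auto simp: ext_rate_def ext_inverse_def dist_real_def\<close>)
  next
    case 3
    show ?thesis
      by (rule has_field_derivative_transform_within[where d="y - \<phi> M" and f="\<lambda>y. M + (y - \<phi> M) / deriv \<phi> M"])
        (use 3 lin y in \<open>auto simp: ext_rate_def ext_inverse_def dist_real_def\<close>)
  next
    case 2
    have LM: "level_inverse \<phi> (\<phi> M) = M" using M by (simp add: level_inverse_phi)
    have rate: "ext_rate M y / y = 1 / deriv \<phi> M" "V (level_inverse \<phi> y) / y = 1 / deriv \<phi> M"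
      unfolding ext_rate_def V_def 2 LM by (simp_all add: nz)
    have "(ext_inverse M has_real_derivative 1 / deriv \<phi> M) (at y within {..y})"
      by (rule has_field_derivative_transform_within[where d=1 and f="level_inverse \<phi>"])
        (use 2 inv[unfolded rate] in \<open>auto simp: ext_inverse_def intro: has_field_derivative_at_within\<close>)
    then have "(ext_inverse M has_real_derivative 1 / deriv \<phi> M) (at y within {..<y})"
      by (rule DERIV_subset) auto
    moreover have "(ext_inverse M has_real_derivative 1 / deriv \<phi> M) (at y within {y..})"
      by (rule has_field_derivative_transform_within[where d=1 and f="\<lambda>y. M + (y - \<phi> M) / deriv \<phi> M"])
        (use 2 lin LM in \<open>auto simp: ext_inverse_def intro: has_field_derivative_at_within\<close>)
    then have "(ext_inverse M has_real_derivative 1 / deriv \<phi> M) (at y within {y<..})"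
      by (rule DERIV_subset) auto
    ultimately show ?thesis
      unfolding rate has_field_derivative_iff by (simp add: filterlim_at_split)
  qed
qed

lemma ext_rate_cont: "0 < M \<Longrightarrow> continuous_on {0..} (ext_rate M)"
proof -
  assume M: "0 < M"
  have "continuous_on ({0..\<phi> M} \<union> {\<phi> M..}) (ext_rate M)"
    unfolding ext_rate_def[abs_def]
  proof (rule continuous_on_If)
    show "continuous_on {0..\<phi> M} (\<lambda>y. V (level_inverse \<phi> y))"
      by (rule continuous_on_compose2[OF V_cont level_inverse_cont])
        (use M phi_level_inverse[of _ M] in auto)
  qed (use M phi_pos[OF M] phi'_pos[OF M] in \<open>auto intro!: continuous_intros simp: level_inverse_phi V_def\<close>)
  moreover have "{0..\<phi> M} \<union> {\<phi> M..} = {0..}" using phi_pos[OF M] by auto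
  ultimately show ?thesis by simp
qed

lemma ext_inverse_cont: "0 < M \<Longrightarrow> continuous_on {0..} (ext_inverse M)"
proof -
  assume M: "0 < M"
  have "continuous_on ({0..\<phi> M} \<union> {\<phi> M..}) (ext_inverse M)"
    unfolding ext_inverse_def[abs_def]
    by (rule continuous_on_If)
      (use M phi_pos[OF M] phi'_pos[OF M] in \<open>auto intro!: continuous_intros level_inverse_cont simp: level_inverse_phi\<close>)
  moreover have "{0..\<phi> M} \<union> {\<phi> M..} = {0..}" using phi_pos[OF M] by auto
  ultimately show ?thesis by simp
qed

lemma ext_inverse_phi: "0 \<le> r \<Longrightarrow> r \<le> M \<Longrightarrow> ext_inverse M (\<phi> r) = r"
  by (simp add: ext_inverse_def phi_le_iff level_inverse_phi)

lemma ext_inverse_less: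
  assumes M: "0 < M" and xy: "0 \<le> x" "x < y"
  shows "ext_inverse M x < ext_inverse M y"
proof (rule DERIV_pos_imp_increasing_open[OF xy(2)])
  fix z assume z: "x < z" "z < y"
  then have z0: "0 < z" using xy by linarith
  have "0 < ext_rate M z"
  proof (cases "z \<le> \<phi> M")
    case True
    then have "\<phi> (level_inverse \<phi> z) = z" "0 \<le> level_inverse \<phi> z" using phi_level_inverse[of z M] z0 M by auto
    then have "0 < level_inverse \<phi> z" using z0 by (cases "level_inverse \<phi> z = 0") auto
    then show ?thesis using True V_pos by (simp add: ext_rate_def)
  next
    case False
    then show ?thesis using z0 phi'_pos[OF M] by (simp add: ext_rate_def)
  qed
  then show "\<exists>d. (ext_inverse M has_real_derivative d) (at z) \<and> 0 < d"
    using ext_inverse_deriv[OF M z0] z0 by (intro exI[of _ "ext_rate M z / z"]) simp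
qed (use xy in \<open>auto intro: continuous_on_subset[OF ext_inverse_cont[OF M]]\<close>)

end

section \<open>The evolution in logarithmic time\<close>

text \<open>
The variable \<open>t\<close> is the logarithm of the time elapsed since some positive initial time; it ranges
over \<open>{..b}\<close>.  \<open>U\<close> is the solution, \<open>exp (r t x) * \<phi> (U t x)\<close> its weighted level, and \<open>pairing\<close> is what
property (P) gives for the difference of the weighted levels at two times, tested with the
indicator of the bad points.
\<close>

locale degenerate_evolution = nonlinearity m \<theta> \<phi> + sigma_finite_measure M
  for m \<theta> :: real and \<phi> :: "real \<Rightarrow> real" and M :: "'a measure" +
  fixes k \<beta> b C c R\<^sub>0 R\<^sub>1 :: real and U U' r r' :: "real \<Rightarrow> 'a \<Rightarrow> real"
  assumes U_meas: "\<And>t. t \<le> b \<Longrightarrow> U t \<in> borel_measurable M"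
    and U_nonneg: "\<And>t x. t \<le> b \<Longrightarrow> x \<in> space M \<Longrightarrow> 0 \<le> U t x"
    and U_deriv: "\<And>t x. t \<le> b \<Longrightarrow> x \<in> space M \<Longrightarrow> ((\<lambda>s. U s x) has_real_derivative U' t x) (at t within {..b})"
    and U'_int: "\<And>t. t \<le> b \<Longrightarrow> integrable M (U' t)"
    and U'_bound: "\<And>t. t \<le> b \<Longrightarrow> (\<integral>x. \<bar>U' t x\<bar> \<partial>M) \<le> C * exp t"
    and U'_cont: "\<And>t. t \<le> b \<Longrightarrow> ((\<lambda>s. \<integral>x. \<bar>U' s x - U' t x\<bar> \<partial>M) \<longlongrightarrow> 0) (at t within {..b})"
    and r_meas: "\<And>t. t \<le> b \<Longrightarrow> r t \<in> borel_measurable M"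
    and r_deriv: "\<And>t x. t \<le> b \<Longrightarrow> x \<in> space M \<Longrightarrow> ((\<lambda>s. r s x) has_real_derivative r' t x) (at t within {..b})"
    and r'_bound: "\<And>t x. t \<le> b \<Longrightarrow> x \<in> space M \<Longrightarrow> R\<^sub>0 \<le> \<theta> * r' t x \<and> \<theta> * r' t x \<le> R\<^sub>1"
    and r'_lip: "\<And>s t x. s \<le> b \<Longrightarrow> t \<le> b \<Longrightarrow> x \<in> space M \<Longrightarrow> \<bar>r' s x - r' t x\<bar> \<le> c * \<bar>s - t\<bar>"
    and const: "1 \<le> R\<^sub>0" "0 \<le> c" "c \<le> R\<^sub>0" "(1 + m) * R\<^sub>1 + c * (2 + m) \<le> \<beta>" "1 \<le> \<beta> + k" "0 \<le> \<beta>"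
    and rate: "\<And>D. R\<^sub>0 \<le> D \<Longrightarrow> D \<le> R\<^sub>1 \<Longrightarrow> 1 \<le> k - (\<theta> - m) * D"
    and pairing: "\<And>s t. s < t \<Longrightarrow> t \<le> b \<Longrightarrow>
       0 \<le> (\<integral>x. (if \<theta> * (\<phi> (U t x) * exp (r t x) - \<phi> (U s x) * exp (r s x)) < 0
          then \<theta> * (exp (k * t) * U' t x - exp (k * s) * U' s x) else 0) \<partial>M)"
begin

definition v :: "real \<Rightarrow> 'a \<Rightarrow> real" where "v t x = \<phi> (U t x) * exp (r t x)"

definition bad :: "real \<Rightarrow> real \<Rightarrow> 'a \<Rightarrow> bool" where "bad s t x \<longleftrightarrow> \<theta> * (v t x - v s x) < 0"

definition tr :: "real \<Rightarrow> real \<Rightarrow> 'a \<Rightarrow> real" where "tr s t x = level_inverse \<phi> (v s x * exp (- r t x))"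

definition F :: "real \<Rightarrow> real \<Rightarrow> 'a \<Rightarrow> real" where
  "F s t x = (if bad s t x then \<theta> * (U s x - tr t s x) else 0)"

definition G :: "real \<Rightarrow> real \<Rightarrow> 'a \<Rightarrow> real" where
  "G s t x = (if bad s t x then \<theta> * (tr s t x - U t x) else 0)"

lemma r_increment:
  assumes "s < t" "t \<le> b" "x \<in> space M"
  obtains q where "s < q" "q < t" "r t x - r s x = (t - s) * r' q x"
proof -
  have deriv: "((\<lambda>s. r s x) has_real_derivative r' q x) (at q within {s..t})" if "s \<le> q" "q \<le> t" for q
    using r_deriv[of q x] that assms by (auto intro: DERIV_subset)
  have "\<exists>l z. s < z \<and> z < t \<and> ((\<lambda>s. r s x) has_real_derivative l) (at z) \<and> r t x - r s x = (t - s) * l"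
  proof (rule MVT[OF \<open>s < t\<close>])
    show "continuous_on {s..t} (\<lambda>s. r s x)" by (rule DERIV_continuous_on[OF deriv]) auto
    show "(\<lambda>s. r s x) differentiable (at z)" if "s < z" "z < t" for z
      using deriv[of z] at_within_Icc_at[of s z t] that by (auto simp: real_differentiable_def)
  qed
  then obtain l z where z: "s < z" "z < t" "((\<lambda>s. r s x) has_real_derivative l) (at z)" "r t x - r s x = (t - s) * l"
    by blast
  have "((\<lambda>s. r s x) has_real_derivative r' z x) (at z)"
    using deriv[of z] at_within_Icc_at[of s z t] z by auto
  from DERIV_unique[OF z(3) this] z show ?thesis using that by blast
qed

lemma v_nonneg: "t \<le> b \<Longrightarrow> x \<in> space M \<Longrightarrow> 0 \<le> v t x"
  by (simp add: v_def phi_nonneg U_nonneg)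

text \<open>
On a bad pair the transported values lie between the values of the solution, up to the order given
by \<open>\<theta>\<close>; in particular their levels are in the range of \<open>\<phi>\<close>.
\<close>

lemma transport_bounds:
  assumes st: "s < t" "t \<le> b" and x: "x \<in> space M" and bad: "bad s t x"
  shows "\<phi> (tr s t x) = v s x * exp (- r t x)" "0 \<le> tr s t x" "tr s t x \<le> max (U s x) (U t x)"
    and "\<phi> (tr t s x) = v t x * exp (- r s x)" "0 \<le> tr t s x" "tr t s x \<le> max (U s x) (U t x)"
    and "0 < \<theta> * (tr s t x - U t x)" "0 < \<theta> * (U s x - tr t s x)"
    and "0 \<le> \<theta> * (U s x - tr s t x)" "0 \<le> \<theta> * (tr t s x - U t x)"
proof -
  have sb: "s \<le> b" using st by simp
  note Us = U_nonneg[OF sb x] and Ut = U_nonneg[OF st(2) x]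
  note vs = v_nonneg[OF sb x] and vt = v_nonneg[OF st(2) x]
  obtain q where q: "s < q" "q < t" "r t x - r s x = (t - s) * r' q x" using r_increment[OF st x] .
  have "0 < \<theta> * r' q x" using r'_bound[of q x] q st x const by force
  then have "0 < (t - s) * (\<theta> * r' q x)" using st by simp
  then have pos: "0 < \<theta> * (r t x - r s x)" unfolding q by (simp add: mult.left_commute)
  have bd: "\<theta> * (v t x - v s x) < 0" using bad by (simp add: bad_def)
  then have bd': "0 < \<theta> * (v s x - v t x)" by (simp add: algebra_simps)
  let ?M = "max (U s x) (U t x)"
  have M0: "0 \<le> ?M" using Us by simp
  have lev: "v s x * exp (- r s x) = \<phi> (U s x)" "v t x * exp (- r t x) = \<phi> (U t x)"
    by (simp_all add: v_def mult.assoc exp_add[symmetric])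
  have le: "v s x * exp (- r t x) \<le> \<phi> ?M \<and> v t x * exp (- r s x) \<le> \<phi> ?M"
  proof (cases "\<theta> = 1")
    case True
    then have vv: "v t x \<le> v s x" and rr: "exp (- r t x) \<le> exp (- r s x)" using bd pos by auto
    have "v s x * exp (- r t x) \<le> v s x * exp (- r s x)" using rr vs by (rule mult_left_mono)
    moreover have "v t x * exp (- r s x) \<le> v s x * exp (- r s x)" using vv by simp
    moreover have "\<phi> (U s x) \<le> \<phi> ?M" using Us M0 by (simp add: phi_le_iff)
    ultimately show ?thesis using lev by simp
  next
    case False
    with \<theta> have th: "\<theta> = -1" by auto
    then have vv: "v s x \<le> v t x" and rr: "exp (- r s x) \<le> exp (- r t x)" using bd pos by auto
    have "v t x * exp (- r s x) \<le> v t x * exp (- r t x)" using rr vt by (rule mult_left_mono)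
    moreover have "v s x * exp (- r t x) \<le> v t x * exp (- r t x)" using vv by simp
    moreover have "\<phi> (U t x) \<le> \<phi> ?M" using Ut M0 by (simp add: phi_le_iff)
    ultimately show ?thesis using lev by simp
  qed
  show z: "\<phi> (tr s t x) = v s x * exp (- r t x)" "0 \<le> tr s t x" "tr s t x \<le> ?M"
    unfolding tr_def using phi_level_inverse[of "v s x * exp (- r t x)" ?M] le vs M0 by auto
  show w: "\<phi> (tr t s x) = v t x * exp (- r s x)" "0 \<le> tr t s x" "tr t s x \<le> ?M"
    unfolding tr_def using phi_level_inverse[of "v t x * exp (- r s x)" ?M] le vt M0 by auto
  have iff: "0 < \<theta> * (p - q) \<longleftrightarrow> 0 < \<theta> * (\<phi> p - \<phi> q)" "0 \<le> \<theta> * (p - q) \<longleftrightarrow> 0 \<le> \<theta> * (\<phi> p - \<phi> q)"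
    if "0 \<le> p" "0 \<le> q" for p q
    using \<theta> phi_less_iff[OF that] phi_less_iff[OF that(2,1)] phi_le_iff[OF that] phi_le_iff[OF that(2,1)] by auto
  have e1: "\<theta> * (v s x * exp (- r t x) - \<phi> (U t x)) = (\<theta> * (v s x - v t x)) * exp (- r t x)"
    unfolding lev[symmetric] by (simp add: algebra_simps)
  show "0 < \<theta> * (tr s t x - U t x)"
    unfolding iff(1)[OF z(2) Ut] z(1) e1 by (rule mult_pos_pos[OF bd' exp_gt_zero])
  have e2: "\<theta> * (\<phi> (U s x) - v t x * exp (- r s x)) = (\<theta> * (v s x - v t x)) * exp (- r s x)"
    unfolding lev[symmetric] by (simp add: algebra_simps)
  show "0 < \<theta> * (U s x - tr t s x)"
    unfolding iff(1)[OF Us w(2)] w(1) e2 by (rule mult_pos_pos[OF bd' exp_gt_zero])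
  have ex: "0 \<le> \<theta> * (exp (- r s x) - exp (- r t x))" using pos \<theta> by auto
  have e3: "\<theta> * (\<phi> (U s x) - v s x * exp (- r t x)) = v s x * (\<theta> * (exp (- r s x) - exp (- r t x)))"
    unfolding lev[symmetric] by (simp add: algebra_simps)
  show "0 \<le> \<theta> * (U s x - tr s t x)"
    unfolding iff(2)[OF Us z(2)] z(1) e3 using ex vs by simp
  have e4: "\<theta> * (v t x * exp (- r s x) - \<phi> (U t x)) = v t x * (\<theta> * (exp (- r s x) - exp (- r t x)))"
    unfolding lev[symmetric] by (simp add: algebra_simps)
  show "0 \<le> \<theta> * (tr t s x - U t x)"
    unfolding iff(2)[OF w(2) Ut] w(1) e4 using ex vt by simp
qed

lemma F_bounds: "s < t \<Longrightarrow> t \<le> b \<Longrightarrow> x \<in> space M \<Longrightarrow> 0 \<le> F s t x \<and> F s t x \<le> \<bar>U t x - U s x\<bar>"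
  and G_bounds: "s < t \<Longrightarrow> t \<le> b \<Longrightarrow> x \<in> space M \<Longrightarrow> 0 \<le> G s t x \<and> G s t x \<le> \<bar>U t x - U s x\<bar>"
  using transport_bounds(7-10)[of s t x] \<theta> by (auto simp: F_def G_def)

lemma bad_lag_inequality:
  assumes st: "s < t" "t \<le> b" and x: "x \<in> space M" and bad: "bad s t x"
  shows "exp (- k * (t - s)) * ((1 / (t - s) + \<beta> + k) * (\<theta> * (U s x - tr t s x)) + \<theta> * r' s x * V (tr t s x))
     \<le> (1 / (t - s) + \<beta>) * (\<theta> * (tr s t x - U t x)) + \<theta> * r' t x * V (tr s t x)"
proof -
  have sb: "s \<le> b" using st by simp
  note tb = transport_bounds[OF st x bad]
  \<comment> \<open>The mean slope of \<open>r\<close> between \<open>s\<close> and \<open>t\<close> is its slope at \<open>q\<close>; this gives its bounds and its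
    distance from the slopes at the end points at once.\<close>
  obtain q where q: "s < q" "q < t" "r t x - r s x = (t - s) * r' q x" using r_increment[OF st x] .
  have qb: "q \<le> b" using q st by simp
  note Rs = r'_bound[OF sb x] and Rt = r'_bound[OF st(2) x] and Rq = r'_bound[OF qb x]
  have D: "\<theta> * (r t x - r s x) / (t - s) = \<theta> * r' q x" unfolding q using st by simp
  have lip: "\<bar>\<theta> * r' p x - \<theta> * r' p' x\<bar> \<le> c * (t - s)" if "p \<in> {s..t}" "p' \<in> {s..t}" for p p'
  proof -
    have "\<bar>\<theta> * r' p x - \<theta> * r' p' x\<bar> = \<bar>r' p x - r' p' x\<bar>"
      by (simp add: right_diff_distrib[symmetric] abs_mult)
    also have "\<dots> \<le> c * \<bar>p - p'\<bar>" using r'_lip[of p p' x] that st x by auto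
    also have "\<dots> \<le> c * (t - s)" using that const by (intro mult_left_mono) auto
    finally show ?thesis .
  qed
  show ?thesis
  proof (rule lag_inequality[where d="r t x - r s x" and K="R\<^sub>1" and C=c])
    show "\<phi> (tr s t x) = \<phi> (U s x) * exp (- (r t x - r s x))" "\<phi> (tr t s x) = \<phi> (U t x) * exp (r t x - r s x)"
      by (simp_all add: tb v_def exp_add[symmetric] mult.assoc)
    show "t - s \<le> \<theta> * (r t x - r s x)"
    proof -
      have "(t - s) * 1 \<le> (t - s) * (\<theta> * r' q x)" using Rq const st by (intro mult_left_mono) auto
      then show ?thesis unfolding q by (simp add: mult.left_commute)
    qed
    show "1 \<le> k - (\<theta> - m) * (\<theta> * (r t x - r s x)) / (t - s)"
      using rate[of "\<theta> * r' q x"] Rq D by (metis times_divide_eq_right)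
    show "\<bar>\<theta> * r' s x - \<theta> * (r t x - r s x) / (t - s)\<bar> \<le> c * (t - s)" unfolding D by (rule lip) (use q st in auto)
    show "\<bar>\<theta> * r' s x - \<theta> * r' t x\<bar> \<le> c * (t - s)" by (rule lip) (use st in auto)
  qed (use tb U_nonneg[OF sb x] U_nonneg[OF st(2) x] Rs Rt const st in auto)
qed

text \<open>
Each point of space yields a transported path, with the extension of the inverse nonlinearity
chosen according to the bound of that path.
\<close>

lemma path:
  assumes a: "a < b" and x: "x \<in> space M" and int: "set_integrable lborel {a..b} (\<lambda>t. U' t x)"
  obtains B E where "transported_path_lag \<theta> k \<beta> a b (\<lambda>t. U t x) (\<lambda>t. U' t x) (\<lambda>t. r t x) (\<lambda>t. r' t x) (\<lambda>t. v t x) B E"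
    and "\<And>s t. a \<le> s \<Longrightarrow> s < t \<Longrightarrow> t \<le> b \<Longrightarrow> bad s t x \<Longrightarrow>
        B (v s x * exp (- r t x)) = tr s t x \<and> B (v t x * exp (- r s x)) = tr t s x"
proof -
  have sub: "{a..b} \<subseteq> {..b}" by auto
  have Ud: "((\<lambda>s. U s x) has_real_derivative U' t x) (at t within {a..b})" if "t \<in> {a..b}" for t
    using U_deriv[of t x] that x by (auto intro: DERIV_subset)
  have rd: "((\<lambda>s. r s x) has_real_derivative r' t x) (at t within {a..b})" if "t \<in> {a..b}" for t
    using r_deriv[of t x] that x by (auto intro: DERIV_subset)
  have Uc: "continuous_on {a..b} (\<lambda>t. U t x)" by (rule DERIV_continuous_on[OF Ud])
  have rc: "continuous_on {a..b} (\<lambda>t. r t x)" by (rule DERIV_continuous_on[OF rd])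
  \<comment> \<open>\<open>\<phi>\<close> is replaced by a linear function above a bound \<open>N\<close> of the trajectory, so that every
    level has a preimage.  On the bad pairs nothing exceeds \<open>N\<close>, and there the two inverses agree.\<close>
  obtain N where N: "0 < N" "\<And>t. t \<in> {a..b} \<Longrightarrow> U t x \<le> N"
  proof -
    obtain N where "\<forall>t\<in>{a..b}. \<bar>U t x\<bar> \<le> N"
      using compact_imp_bounded[OF compact_continuous_image[OF Uc]] by (auto simp: bounded_iff)
    then have "0 < max 1 N \<and> (\<forall>t\<in>{a..b}. U t x \<le> max 1 N)" by force
    then show ?thesis using that by blast
  qed
  have lev: "v t x * exp (- r t x) = \<phi> (U t x)" for t by (simp add: v_def mult.assoc exp_add[symmetric])
  have r'c: "continuous_on {a..b} (\<lambda>t. r' t x)"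
  proof (rule lipschitz_on_continuous_on)
    show "c-lipschitz_on {a..b} (\<lambda>t. r' t x)"
      by (rule lipschitz_onI) (use r'_lip[OF _ _ x] const in \<open>auto simp: dist_real_def\<close>)
  qed
  have vc: "continuous_on {a..b} (\<lambda>t. v t x)"
    unfolding v_def by (intro continuous_intros rc continuous_on_compose2[OF phi_cont Uc]) (use U_nonneg x in auto)
  have ext: "ext_inverse N (v s x * exp (- r t x)) = tr s t x" "ext_rate N (v s x * exp (- r t x)) = V (tr s t x)"
    "ext_inverse N (v t x * exp (- r s x)) = tr t s x" "ext_rate N (v t x * exp (- r s x)) = V (tr t s x)"
    if "a \<le> s" "s < t" "t \<le> b" "bad s t x" for s t
  proof -
    note tb = transport_bounds[OF that(2,3) x that(4)]
    have "max (U s x) (U t x) \<le> N" using N(2)[of s] N(2)[of t] that by simp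
    then have "tr s t x \<le> N" "tr t s x \<le> N" using tb(3,6) by linarith+
    then have "v s x * exp (- r t x) \<le> \<phi> N" "v t x * exp (- r s x) \<le> \<phi> N"
      unfolding tb(1)[symmetric] tb(4)[symmetric] using tb(2,5) N(1) by (simp_all add: phi_le_iff)
    then show "ext_inverse N (v s x * exp (- r t x)) = tr s t x" "ext_rate N (v s x * exp (- r t x)) = V (tr s t x)"
      "ext_inverse N (v t x * exp (- r s x)) = tr t s x" "ext_rate N (v t x * exp (- r s x)) = V (tr t s x)"
      by (simp_all add: ext_inverse_def ext_rate_def tr_def)
  qed
  show ?thesis
  proof (rule that)
    show "transported_path_lag \<theta> k \<beta> a b (\<lambda>t. U t x) (\<lambda>t. U' t x) (\<lambda>t. r t x) (\<lambda>t. r' t x) (\<lambda>t. v t x) (ext_inverse N) (ext_rate N)"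
    proof (unfold_locales)
      show "U t x = ext_inverse N (v t x * exp (- r t x))" if "t \<in> {a..b}" for t
        unfolding lev using N(2)[OF that] that U_nonneg[of t x] x by (simp add: ext_inverse_phi)
      show "exp (- k * (t - s)) * ((1 / (t - s) + \<beta> + k) * (\<theta> * (U s x - ext_inverse N (v t x * exp (- r s x)))) + \<theta> * r' s x * ext_rate N (v t x * exp (- r s x)))
          \<le> (1 / (t - s) + \<beta>) * (\<theta> * (ext_inverse N (v s x * exp (- r t x)) - U t x)) + \<theta> * r' t x * ext_rate N (v s x * exp (- r t x))"
        if "a \<le> s" "s < t" "t \<le> b" "\<theta> * (v t x - v s x) < 0" for s t
      proof -
        have "bad s t x" using that by (simp add: bad_def)
        note ext[OF that(1-3) this]
        then show ?thesis using bad_lag_inequality[OF that(2,3) x \<open>bad s t x\<close>] by simp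
      qed
      show "ext_rate N 0 = 0" using phi_pos[OF N(1)] by (simp add: ext_rate_def)
      show "\<theta> \<in> {-1, 1}" by (rule \<theta>)
      show "0 \<le> v t x" if "t \<in> {a..b}" for t using v_nonneg[OF _ x, of t] that by simp
    qed (fact a Ud int rd r'c vc ext_rate_cont[OF N(1)] ext_inverse_cont[OF N(1)] ext_inverse_deriv[OF N(1)] ext_inverse_less[OF N(1)])+
  qed (use ext in blast)
qed

definition defect_region :: "real \<Rightarrow> real \<Rightarrow> (real \<times> real) set" where
  "defect_region a e = {(s, t). a \<le> s \<and> s + e \<le> t \<and> t \<le> b}"

lemma path_estimate:
  assumes a: "a < b" and x: "x \<in> space M" and int: "set_integrable lborel {a..b} (\<lambda>t. U' t x)"
    and e: "0 < e" "e < b - a"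
  shows "(LBINT s:{a..b - e}. lag_weight \<beta> (b - s) * G s b x)
      - (LBINT s:{a..b - e}. lag_weight \<beta> e * G s (s + e) x - lag_weight (\<beta> + k) e * F s (s + e) x)
      - (LBINT t:{a + e..b}. lag_weight (\<beta> + k) (t - a) * F a t x)
    \<le> (\<integral>(s, t). indicator (defect_region a e) (s, t) * (if bad s t x then \<theta> * (lag_weight (\<beta> + k) (t - s) * U' s x - lag_weight \<beta> (t - s) * U' t x) else 0)
         \<partial>(lborel \<Otimes>\<^sub>M lborel))"
proof -
  obtain B E where loc: "transported_path_lag \<theta> k \<beta> a b (\<lambda>t. U t x) (\<lambda>t. U' t x) (\<lambda>t. r t x) (\<lambda>t. r' t x) (\<lambda>t. v t x) B E"
    and tr: "\<And>s t. a \<le> s \<Longrightarrow> s < t \<Longrightarrow> t \<le> b \<Longrightarrow> bad s t x \<Longrightarrow>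
        B (v s x * exp (- r t x)) = tr s t x \<and> B (v t x * exp (- r s x)) = tr t s x"
    using path[OF a x int] by blast
  interpret P: transported_path_lag \<theta> k \<beta> a b "\<lambda>t. U t x" "\<lambda>t. U' t x" "\<lambda>t. r t x" "\<lambda>t. r' t x" "\<lambda>t. v t x" B E
    by (rule loc)
  have bad_eq: "P.bad s t = bad s t x" for s t by (simp add: P.bad_def bad_def)
  have FG: "max 0 (P.F s t) = F s t x" "max 0 (P.G s t) = G s t x" if "a \<le> s" "s < t" "t \<le> b" for s t
  proof -
    have sgn: "bad s t x \<longleftrightarrow> 0 < P.F s t" "bad s t x \<longleftrightarrow> 0 < P.G s t"
      using P.bad_F[of s t] P.bad_G[of s t] that by (simp_all add: bad_eq)
    show "max 0 (P.F s t) = F s t x" "max 0 (P.G s t) = G s t x"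
    proof (atomize (full), cases "bad s t x")
      case True
      then have "P.F s t = F s t x" "P.G s t = G s t x"
        using tr[OF that True] by (simp_all add: F_def G_def P.F_def P.G_def P.tr_def)
      moreover have "0 < P.F s t" "0 < P.G s t" using sgn True by blast+
      ultimately show "max 0 (P.F s t) = F s t x \<and> max 0 (P.G s t) = G s t x" by simp
    next
      case False
      then have "\<not> 0 < P.F s t" "\<not> 0 < P.G s t" using sgn by blast+
      then show "max 0 (P.F s t) = F s t x \<and> max 0 (P.G s t) = G s t x" using False by (simp add: F_def G_def)
    qed
  qed
  note est = P.path_inequality[OF e, unfolded bad_eq]
  have eq1: "(LBINT s:{a..b - e}. lag_weight \<beta> (b - s) * max 0 (P.G s b)) = (LBINT s:{a..b - e}. lag_weight \<beta> (b - s) * G s b x)"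
    by (rule set_lebesgue_integral_cong) (use FG e in auto)
  have eq2: "(LBINT s:{a..b - e}. lag_weight \<beta> e * max 0 (P.G s (s + e)) - lag_weight (\<beta> + k) e * max 0 (P.F s (s + e)))
      = (LBINT s:{a..b - e}. lag_weight \<beta> e * G s (s + e) x - lag_weight (\<beta> + k) e * F s (s + e) x)"
    by (rule set_lebesgue_integral_cong) (use FG e in auto)
  have eq3: "(LBINT t:{a + e..b}. lag_weight (\<beta> + k) (t - a) * max 0 (P.F a t)) = (LBINT t:{a + e..b}. lag_weight (\<beta> + k) (t - a) * F a t x)"
    by (rule set_lebesgue_integral_cong) (use FG e in auto)
  show ?thesis using est unfolding eq1 eq2 eq3 defect_region_def .
qed

lemma defect_small:
  assumes a: "a < b" and x: "x \<in> space M" and int: "set_integrable lborel {a..b} (\<lambda>t. U' t x)"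
    and s: "a \<le> s" "s < b"
  shows "((\<lambda>e. \<bar>G s (s + e) x - F s (s + e) x\<bar> / e) \<longlongrightarrow> 0) (at_right 0)"
proof -
  obtain B E where loc: "transported_path_lag \<theta> k \<beta> a b (\<lambda>t. U t x) (\<lambda>t. U' t x) (\<lambda>t. r t x) (\<lambda>t. r' t x) (\<lambda>t. v t x) B E"
    and tr: "\<And>s t. a \<le> s \<Longrightarrow> s < t \<Longrightarrow> t \<le> b \<Longrightarrow> bad s t x \<Longrightarrow>
        B (v s x * exp (- r t x)) = tr s t x \<and> B (v t x * exp (- r s x)) = tr t s x"
    using path[OF a x int] by blast
  interpret P: transported_path_lag \<theta> k \<beta> a b "\<lambda>t. U t x" "\<lambda>t. U' t x" "\<lambda>t. r t x" "\<lambda>t. r' t x" "\<lambda>t. v t x" B E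
    by (rule loc)
  show ?thesis
  proof (rule Lim_null_comparison[OF _ tendsto_rabs_zero[OF P.crossing_defect_small[OF s]]])
    have "\<forall>\<^sub>F e in at_right 0. 0 < e \<and> e < b - s"
      unfolding eventually_at_right_field using s by (intro exI[of _ "b - s"]) auto
    then show "\<forall>\<^sub>F e in at_right 0. norm (\<bar>G s (s + e) x - F s (s + e) x\<bar> / e) \<le> \<bar>(P.G s (s + e) - P.F s (s + e)) / e\<bar>"
    proof eventually_elim
      case (elim e)
      show ?case
      proof (cases "bad s (s + e) x")
        case True
        then have "P.F s (s + e) = F s (s + e) x" "P.G s (s + e) = G s (s + e) x"
          using tr[of s "s + e"] s elim by (simp_all add: F_def G_def P.F_def P.G_def P.tr_def)
        then show ?thesis using elim by (simp add: abs_divide)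
      qed (simp add: F_def G_def)
    qed
  qed
qed

end

section \<open>Joint measurability and increments\<close>

lemma caratheodory_measurable:
  fixes f :: "real \<Rightarrow> 'a \<Rightarrow> real"
  assumes meas: "\<And>s. f s \<in> borel_measurable M"
    and cont: "\<And>x. x \<in> space M \<Longrightarrow> continuous_on UNIV (\<lambda>s. f s x)"
  shows "(\<lambda>(s, x). f s x) \<in> borel_measurable (lborel \<Otimes>\<^sub>M M)"
proof (rule borel_measurable_LIMSEQ_real)
  define g where "g n z = f (real_of_int \<lfloor>real (Suc n) * fst z\<rfloor> / real (Suc n)) (snd z)" for n and z :: "real \<times> 'a"
  show "g n \<in> borel_measurable (lborel \<Otimes>\<^sub>M M)" for n
  proof -
    have "(\<lambda>z. f (real_of_int i / real (Suc n)) (snd z)) \<in> borel_measurable (lborel \<Otimes>\<^sub>M M)" for i :: int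
      by (rule measurable_compose[OF measurable_snd meas])
    moreover have "(\<lambda>z :: real \<times> 'a. \<lfloor>real (Suc n) * fst z\<rfloor>) \<in> (lborel \<Otimes>\<^sub>M M) \<rightarrow>\<^sub>M count_space UNIV" by measurable
    ultimately show ?thesis unfolding g_def[abs_def] by (rule measurable_compose_countable)
  qed
  fix z :: "real \<times> 'a" assume "z \<in> space (lborel \<Otimes>\<^sub>M M)"
  then have x: "snd z \<in> space M" by (auto simp: space_pair_measure)
  have "(\<lambda>n. real_of_int \<lfloor>real (Suc n) * fst z\<rfloor> / real (Suc n)) \<longlonglongrightarrow> fst z"
  proof (rule tendsto_sandwich)
    show "(\<lambda>n. fst z - 1 / real (Suc n)) \<longlonglongrightarrow> fst z"
      using tendsto_diff[OF tendsto_const[of "fst z"] LIMSEQ_Suc[OF lim_1_over_n]] by simp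
    show "\<forall>\<^sub>F n in sequentially. fst z - 1 / real (Suc n) \<le> real_of_int \<lfloor>real (Suc n) * fst z\<rfloor> / real (Suc n)"
    proof (intro always_eventually allI)
      fix n
      have "real (Suc n) * fst z - 1 \<le> real_of_int \<lfloor>real (Suc n) * fst z\<rfloor>" by linarith
      then have "(real (Suc n) * fst z - 1) / real (Suc n) \<le> real_of_int \<lfloor>real (Suc n) * fst z\<rfloor> / real (Suc n)"
        by (rule divide_right_mono) simp
      then show "fst z - 1 / real (Suc n) \<le> real_of_int \<lfloor>real (Suc n) * fst z\<rfloor> / real (Suc n)"
        by (simp add: diff_divide_distrib del: of_nat_Suc)
    qed
    show "\<forall>\<^sub>F n in sequentially. real_of_int \<lfloor>real (Suc n) * fst z\<rfloor> / real (Suc n) \<le> fst z"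
    proof (intro always_eventually allI)
      fix n
      have "real_of_int \<lfloor>real (Suc n) * fst z\<rfloor> \<le> real (Suc n) * fst z" by linarith
      then show "real_of_int \<lfloor>real (Suc n) * fst z\<rfloor> / real (Suc n) \<le> fst z"
        by (simp add: divide_le_eq mult.commute del: of_nat_Suc)
    qed
  qed simp
  from continuous_on_tendsto_compose[OF cont[OF x] this]
  show "(\<lambda>n. g n z) \<longlonglongrightarrow> (case z of (s, x) \<Rightarrow> f s x)" by (simp add: g_def case_prod_beta)
qed

lemma (in pair_sigma_finite) integrable_bounded_slices:
  fixes H :: "'a \<Rightarrow> 'b \<Rightarrow> real"
  assumes meas: "case_prod H \<in> borel_measurable (M1 \<Otimes>\<^sub>M M2)"
    and A: "A \<in> sets M1" "emeasure M1 A < \<infinity>"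
    and out: "\<And>z x. z \<notin> A \<Longrightarrow> H z x = 0"
    and slice: "\<And>z. z \<in> A \<Longrightarrow> integrable M2 (H z)" "\<And>z. z \<in> A \<Longrightarrow> (\<integral>x. \<bar>H z x\<bar> \<partial>M2) \<le> K"
  shows "integrable (M1 \<Otimes>\<^sub>M M2) (case_prod H)"
proof (rule Fubini_integrable[OF meas])
  have int: "integrable M2 (H z)" for z
  proof (cases "z \<in> A")
    case False
    then have "H z = (\<lambda>_. 0)" using out by auto
    then show ?thesis by simp
  qed (rule slice)
  then show "AE z in M1. integrable M2 (\<lambda>x. case_prod H (z, x))" by simp
  have [measurable]: "(\<lambda>(z, x). \<bar>H z x\<bar>) \<in> borel_measurable (M1 \<Otimes>\<^sub>M M2)" using meas by measurable
  have "integrable M1 (\<lambda>z. K * indicator A z)" using A by simp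
  then show "integrable M1 (\<lambda>z. \<integral>x. norm (case_prod H (z, x)) \<partial>M2)"
  proof (rule Bochner_Integration.integrable_bound)
    show "(\<lambda>z. \<integral>x. norm (case_prod H (z, x)) \<partial>M2) \<in> borel_measurable M1"
      using M2.borel_measurable_lebesgue_integral[of "\<lambda>z x. \<bar>H z x\<bar>" M1] by simp
    show "AE z in M1. norm (\<integral>x. norm (case_prod H (z, x)) \<partial>M2) \<le> norm (K * indicator A z)"
    proof (rule AE_I2)
      fix z
      show "norm (\<integral>x. norm (case_prod H (z, x)) \<partial>M2) \<le> norm (K * indicator A z)"
      proof (cases "z \<in> A")
        case True
        have "0 \<le> (\<integral>x. \<bar>H z x\<bar> \<partial>M2)" by simp
        with slice(2)[OF True] True show ?thesis by simp
      qed (simp add: out)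
    qed
  qed
qed

context nonlinearity
begin

text \<open>
A measurable version of \<open>level_inverse \<phi>\<close>, changed to \<open>0\<close> outside of the range.
\<close>

definition level_inverse\<^sub>0 :: "real \<Rightarrow> real" where
  "level_inverse\<^sub>0 y = (if \<exists>n. y \<in> {0..\<phi> (real n)} then level_inverse \<phi> y else 0)"

lemma level_inverse\<^sub>0_measurable [measurable]: "level_inverse\<^sub>0 \<in> borel_measurable borel"
proof (rule borel_measurable_LIMSEQ_real)
  show "(\<lambda>y. indicator {0..\<phi> (real n)} y * level_inverse \<phi> y) \<in> borel_measurable borel" for n
    using borel_measurable_continuous_on_indicator[OF _ level_inverse_cont[of "real n"]] by simp
  fix y :: real
  show "(\<lambda>n. indicator {0..\<phi> (real n)} y * level_inverse \<phi> y) \<longlonglongrightarrow> level_inverse\<^sub>0 y"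
  proof (cases "\<exists>n. y \<in> {0..\<phi> (real n)}")
    case True
    then obtain n0 where n0: "y \<in> {0..\<phi> (real n0)}" by blast
    have "indicator {0..\<phi> (real n)} y * level_inverse \<phi> y = level_inverse\<^sub>0 y" if "n0 \<le> n" for n
    proof -
      have "\<phi> (real n0) \<le> \<phi> (real n)" using that by (simp add: phi_le_iff)
      then have "y \<in> {0..\<phi> (real n)}" using n0 by auto
      then show ?thesis using True by (simp add: level_inverse\<^sub>0_def)
    qed
    then show ?thesis by (intro tendsto_eventually eventually_sequentiallyI)
  next
    case False
    then have "indicator {0..\<phi> (real n)} y * level_inverse \<phi> y = level_inverse\<^sub>0 y" for n
      by (auto simp: level_inverse\<^sub>0_def split: split_indicator)
    then show ?thesis by simp
  qed
qed

lemma phi_max_measurable [measurable]: "(\<lambda>r. \<phi> (max 0 r)) \<in> borel_measurable borel"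
  by (intro borel_measurable_continuous_onI continuous_on_compose2[OF phi_cont] continuous_intros) auto

end

context degenerate_evolution
begin

sublocale LM: pair_sigma_finite "lborel :: real measure" M ..

text \<open>
The functions are frozen after time \<open>b\<close>, so that they are defined and measurable on the whole line.
\<close>

definition Uc :: "real \<Rightarrow> 'a \<Rightarrow> real" where "Uc t x = U (min t b) x"
definition Uc' :: "real \<Rightarrow> 'a \<Rightarrow> real" where "Uc' t x = U' (min t b) x"
definition rc :: "real \<Rightarrow> 'a \<Rightarrow> real" where "rc t x = r (min t b) x"

lemma min_cont: "continuous_on UNIV (\<lambda>s. f (min s b))" if "continuous_on {..b} f" for f :: "real \<Rightarrow> real"
  by (rule continuous_on_compose2[OF that]) (auto intro!: continuous_intros)

lemma U_cont: "x \<in> space M \<Longrightarrow> continuous_on {..b} (\<lambda>t. U t x)"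
  by (rule DERIV_continuous_on[OF U_deriv]) auto

lemma r_cont: "x \<in> space M \<Longrightarrow> continuous_on {..b} (\<lambda>t. r t x)"
  by (rule DERIV_continuous_on[OF r_deriv]) auto

lemma v_cont: "x \<in> space M \<Longrightarrow> continuous_on {..b} (\<lambda>t. v t x)"
  unfolding v_def by (intro continuous_intros r_cont continuous_on_compose2[OF phi_cont U_cont]) (auto simp: U_nonneg)

lemma Uc_measurable: "(\<lambda>(s, x). Uc s x) \<in> borel_measurable (lborel \<Otimes>\<^sub>M M)"
proof (rule caratheodory_measurable)
  show "Uc s \<in> borel_measurable M" for s using U_meas[of "min s b"] by (simp add: Uc_def[abs_def])
qed (unfold Uc_def, rule min_cont[OF U_cont])

lemma rc_measurable: "(\<lambda>(s, x). rc s x) \<in> borel_measurable (lborel \<Otimes>\<^sub>M M)"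
proof (rule caratheodory_measurable)
  show "rc s \<in> borel_measurable M" for s using r_meas[of "min s b"] by (simp add: rc_def[abs_def])
qed (unfold rc_def, rule min_cont[OF r_cont])

lemma Uc'_measurable: "(\<lambda>(s, x). Uc' s x) \<in> borel_measurable (lborel \<Otimes>\<^sub>M M)"
proof (rule borel_measurable_LIMSEQ_real)
  define q where "q n = (\<lambda>z. (Uc (min (fst z) b) (snd z) - Uc (min (fst z) b - 1 / real (Suc n)) (snd z)) / (1 / real (Suc n)))" for n
  have comp: "(\<lambda>z. Uc (h z) (snd z)) \<in> borel_measurable (lborel \<Otimes>\<^sub>M M)" if "h \<in> borel_measurable (lborel \<Otimes>\<^sub>M M)" for h :: "real \<times> 'a \<Rightarrow> real"
    by (rule measurable_Pair_compose_split[OF Uc_measurable]) (use that in auto)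
  show "q n \<in> borel_measurable (lborel \<Otimes>\<^sub>M M)" for n
    unfolding q_def by (intro borel_measurable_divide borel_measurable_diff comp) measurable
  fix z :: "real \<times> 'a" assume "z \<in> space (lborel \<Otimes>\<^sub>M M)"
  then have x: "snd z \<in> space M" by (auto simp: space_pair_measure)
  define t where "t = min (fst z) b"
  have t: "t \<le> b" by (simp add: t_def)
  have "((\<lambda>y. (U y (snd z) - U t (snd z)) / (y - t)) \<longlongrightarrow> U' t (snd z)) (at t within {..b})"
    using U_deriv[OF t x] by (simp add: has_field_derivative_iff)
  moreover have "filterlim (\<lambda>n. t - 1 / real (Suc n)) (at t within {..b}) sequentially"
    unfolding filterlim_at
  proof
    show "\<forall>\<^sub>F n in sequentially. t - 1 / real (Suc n) \<in> {..b} \<and> t - 1 / real (Suc n) \<noteq> t"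
      using t by (intro always_eventually allI) (auto intro: order_trans[rotated])
    show "(\<lambda>n. t - 1 / real (Suc n)) \<longlonglongrightarrow> t"
      using tendsto_diff[OF tendsto_const[of t] LIMSEQ_Suc[OF lim_1_over_n]] by simp
  qed
  ultimately have "(\<lambda>n. (U (t - 1 / real (Suc n)) (snd z) - U t (snd z)) / (t - 1 / real (Suc n) - t)) \<longlonglongrightarrow> U' t (snd z)"
    by (rule filterlim_compose)
  moreover have "(U (t - 1 / real (Suc n)) (snd z) - U t (snd z)) / (t - 1 / real (Suc n) - t) = q n z" for n
  proof -
    have "min (t - 1 / real (Suc n)) b = t - 1 / real (Suc n)" using t by (intro min_absorb1) (auto intro: order_trans[rotated])
    then show ?thesis using t unfolding q_def t_def[symmetric] Uc_def by (simp add: min_absorb1 algebra_simps)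
  qed
  ultimately show "(\<lambda>n. q n z) \<longlonglongrightarrow> (case z of (s, x) \<Rightarrow> Uc' s x)"
    by (simp add: Uc'_def case_prod_beta t_def)
qed

definition vc :: "real \<Rightarrow> 'a \<Rightarrow> real" where "vc t x = \<phi> (max 0 (Uc t x)) * exp (rc t x)"
definition Fc :: "real \<Rightarrow> real \<Rightarrow> 'a \<Rightarrow> real" where
  "Fc s t x = (if \<theta> * (vc t x - vc s x) < 0 then \<theta> * (Uc s x - level_inverse\<^sub>0 (vc t x * exp (- rc s x))) else 0)"
definition Gc :: "real \<Rightarrow> real \<Rightarrow> 'a \<Rightarrow> real" where
  "Gc s t x = (if \<theta> * (vc t x - vc s x) < 0 then \<theta> * (level_inverse\<^sub>0 (vc s x * exp (- rc t x)) - Uc t x) else 0)"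

lemma composed_measurable:
  assumes [measurable]: "g \<in> borel_measurable N" "p \<in> N \<rightarrow>\<^sub>M M"
  shows "(\<lambda>z. Uc (g z) (p z)) \<in> borel_measurable N" "(\<lambda>z. Uc' (g z) (p z)) \<in> borel_measurable N"
    "(\<lambda>z. rc (g z) (p z)) \<in> borel_measurable N" "(\<lambda>z. vc (g z) (p z)) \<in> borel_measurable N"
proof -
  show U[measurable]: "(\<lambda>z. Uc (g z) (p z)) \<in> borel_measurable N" "(\<lambda>z. Uc' (g z) (p z)) \<in> borel_measurable N"
    "(\<lambda>z. rc (g z) (p z)) \<in> borel_measurable N"
    by (rule measurable_Pair_compose_split[OF Uc_measurable] measurable_Pair_compose_split[OF Uc'_measurable]
        measurable_Pair_compose_split[OF rc_measurable]; simp)+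
  show "(\<lambda>z. vc (g z) (p z)) \<in> borel_measurable N"
    unfolding vc_def by measurable
qed

lemma composed_measurable2:
  assumes [measurable]: "g \<in> borel_measurable N" "h \<in> borel_measurable N" "p \<in> N \<rightarrow>\<^sub>M M"
  shows "(\<lambda>z. Fc (g z) (h z) (p z)) \<in> borel_measurable N" "(\<lambda>z. Gc (g z) (h z) (p z)) \<in> borel_measurable N"
proof -
  have [measurable]: "(\<lambda>z. Uc (g z) (p z)) \<in> borel_measurable N" "(\<lambda>z. Uc (h z) (p z)) \<in> borel_measurable N"
    "(\<lambda>z. rc (g z) (p z)) \<in> borel_measurable N" "(\<lambda>z. rc (h z) (p z)) \<in> borel_measurable N"
    "(\<lambda>z. vc (g z) (p z)) \<in> borel_measurable N" "(\<lambda>z. vc (h z) (p z)) \<in> borel_measurable N"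
    by (rule composed_measurable; simp)+
  show "(\<lambda>z. Fc (g z) (h z) (p z)) \<in> borel_measurable N" "(\<lambda>z. Gc (g z) (h z) (p z)) \<in> borel_measurable N"
    unfolding Fc_def Gc_def by measurable
qed

lemma clamp: "t \<le> b \<Longrightarrow> Uc t x = U t x" "t \<le> b \<Longrightarrow> Uc' t x = U' t x" "t \<le> b \<Longrightarrow> rc t x = r t x"
  "t \<le> b \<Longrightarrow> x \<in> space M \<Longrightarrow> vc t x = v t x"
  by (simp_all add: Uc_def Uc'_def rc_def vc_def v_def U_nonneg)

lemma clamp_FG:
  assumes "s < t" "t \<le> b" "x \<in> space M"
  shows "Fc s t x = F s t x" "Gc s t x = G s t x"
proof -
  have "level_inverse\<^sub>0 (v t x * exp (- r s x)) = tr t s x \<and> level_inverse\<^sub>0 (v s x * exp (- r t x)) = tr s t x" if "bad s t x"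
  proof -
    note tb = transport_bounds[OF assms that]
    obtain n where n: "max (U s x) (U t x) \<le> real n" using real_arch_simple by blast
    have "\<phi> (tr s t x) \<le> \<phi> (real n)" "\<phi> (tr t s x) \<le> \<phi> (real n)"
      using tb(2,3,5,6) n by (auto simp: phi_le_iff intro: order_trans)
    then have "\<exists>n. v t x * exp (- r s x) \<in> {0..\<phi> (real n)}" "\<exists>n. v s x * exp (- r t x) \<in> {0..\<phi> (real n)}"
      unfolding tb(1)[symmetric] tb(4)[symmetric] using tb(2,5) by (auto simp: phi_nonneg)
    then show ?thesis by (simp add: level_inverse\<^sub>0_def tr_def)
  qed
  then show "Fc s t x = F s t x" "Gc s t x = G s t x"
    using assms by (auto simp: Fc_def Gc_def F_def G_def clamp bad_def)
qed

lemma C_nonneg: "0 \<le> C"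
proof -
  have "0 \<le> (\<integral>x. \<bar>U' b x\<bar> \<partial>M)" by simp
  also have "\<dots> \<le> C * exp b" by (rule U'_bound) simp
  finally show ?thesis by (simp add: zero_le_mult_iff)
qed

lemma U'_bound': "s \<le> t \<Longrightarrow> t \<le> b \<Longrightarrow> (\<integral>x. \<bar>U' s x\<bar> \<partial>M) \<le> C * exp t"
  using U'_bound[of s] mult_left_mono[OF _ C_nonneg, of "exp s" "exp t"] by fastforce

lemma U'_joint_integrable:
  assumes g: "integrable M g" and st: "t \<le> b"
  shows "integrable (lborel \<Otimes>\<^sub>M M) (\<lambda>(q, x). indicator {s..t} q * (Uc' q x - g x))"
proof (rule LM.integrable_bounded_slices[where A="{s..t}" and K="C * exp b + (\<integral>x. \<bar>g x\<bar> \<partial>M)"])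
  have [measurable]: "g \<in> borel_measurable M" using g by auto
  have [measurable]: "(\<lambda>z. Uc' (fst z) (snd z)) \<in> borel_measurable (lborel \<Otimes>\<^sub>M M)"
    by (rule composed_measurable) auto
  show "(\<lambda>(q, x). indicator {s..t} q * (Uc' q x - g x)) \<in> borel_measurable (lborel \<Otimes>\<^sub>M M)"
    unfolding case_prod_beta by measurable
  fix q assume q: "q \<in> {s..t}"
  then have qb: "q \<le> b" using st by simp
  show "integrable M (\<lambda>x. indicator {s..t} q * (Uc' q x - g x))"
    using q U'_int[OF qb] g by (simp add: clamp[OF qb])
  have "(\<integral>x. \<bar>U' q x - g x\<bar> \<partial>M) \<le> (\<integral>x. \<bar>U' q x\<bar> + \<bar>g x\<bar> \<partial>M)"
    using U'_int[OF qb] g by (intro integral_mono) auto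
  also have "\<dots> = (\<integral>x. \<bar>U' q x\<bar> \<partial>M) + (\<integral>x. \<bar>g x\<bar> \<partial>M)" using U'_int[OF qb] g by simp
  also have "\<dots> \<le> C * exp b + (\<integral>x. \<bar>g x\<bar> \<partial>M)" using U'_bound'[OF qb] by simp
  finally show "(\<integral>x. \<bar>indicator {s..t} q * (Uc' q x - g x)\<bar> \<partial>M) \<le> C * exp b + (\<integral>x. \<bar>g x\<bar> \<partial>M)"
    using q by (simp add: clamp[OF qb])
qed (auto simp: emeasure_lborel_Icc_eq)

lemma AE_U'_integrable: "t \<le> b \<Longrightarrow> AE x in M. set_integrable lborel {s..t} (\<lambda>q. U' q x)"
proof -
  assume t: "t \<le> b"
  have "integrable M (\<lambda>x. 0 :: real)" by simp
  from LM.AE_integrable_snd[OF U'_joint_integrable[OF this t, of s]]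
  have "AE x in M. integrable lborel (\<lambda>q. indicator {s..t} q * (Uc' q x - 0))" by simp
  then show ?thesis
  proof eventually_elim
    case (elim x)
    then show ?case unfolding set_integrable_def
      by (rule Bochner_Integration.integrable_cong[THEN iffD1, rotated 2]) (use t in \<open>auto simp: clamp split: split_indicator\<close>)
  qed
qed

text \<open>
The increment of \<open>U\<close> is the time integral of \<open>U'\<close> at almost every point; the bound then follows by
exchanging the integrals.  The function \<open>g\<close> is \<open>0\<close> for the Lipschitz bound and \<open>U' s\<close> for the
convergence of difference quotients.
\<close>

lemma L1_increment:
  assumes st: "s < t" "t \<le> b" and g: "integrable M g"
    and \<eta>: "\<And>q. s \<le> q \<Longrightarrow> q \<le> t \<Longrightarrow> (\<integral>x. \<bar>U' q x - g x\<bar> \<partial>M) \<le> \<eta>"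
  shows "integrable M (\<lambda>x. U t x - U s x - (t - s) * g x)"
    and "(\<integral>x. \<bar>U t x - U s x - (t - s) * g x\<bar> \<partial>M) \<le> \<eta> * (t - s)"
proof -
  define h where "h q x = indicator {s..t} q * (Uc' q x - g x)" for q x
  have h: "integrable (lborel \<Otimes>\<^sub>M M) (case_prod h)"
    using U'_joint_integrable[OF g st(2), of s] by (simp add: h_def[abs_def])
  have ha: "integrable (lborel \<Otimes>\<^sub>M M) (\<lambda>(q, x). \<bar>h q x\<bar>)"
    using integrable_abs[OF h] by (simp add: case_prod_beta')
  have eq: "AE x in M. U t x - U s x - (t - s) * g x = (\<integral>q. h q x \<partial>lborel)"
    using AE_U'_integrable[OF st(2), of s] AE_space
  proof eventually_elim
    case (elim x)
    have "((\<lambda>q. U' q x) has_integral (U t x - U s x)) {s..t}"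
      by (rule fundamental_theorem_of_calculus)
        (use st elim in \<open>auto simp: has_real_derivative_iff_has_vector_derivative[symmetric] intro!: DERIV_subset[OF U_deriv]\<close>)
    moreover note set_borel_integral_eq_integral[OF elim(1)]
    ultimately have e1: "(LBINT q:{s..t}. U' q x) = U t x - U s x" using integral_unique by metis
    have i1: "set_integrable lborel {s..t} (\<lambda>q. g x)"
      unfolding set_integrable_def by (rule borel_integrable_compact) auto
    have "(\<integral>q. h q x \<partial>lborel) = (LBINT q:{s..t}. U' q x - g x)"
      unfolding set_lebesgue_integral_def
      by (rule Bochner_Integration.integral_cong) (use st in \<open>auto simp: h_def clamp split: split_indicator\<close>)
    also have "\<dots> = U t x - U s x - (t - s) * g x"
      using st by (simp add: set_integral_diff(2)[OF elim(1) i1] e1 set_integral_const)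
    finally show ?case ..
  qed
  have "(\<lambda>x. U t x - U s x - (t - s) * g x) \<in> borel_measurable M"
    using U_meas[of t] U_meas[of s] g st by auto
  moreover have "integrable M (\<lambda>x. \<integral>q. h q x \<partial>lborel)" by (rule LM.integrable_snd[OF h])
  ultimately show int: "integrable M (\<lambda>x. U t x - U s x - (t - s) * g x)"
    using eq by (subst integrable_cong_AE) (auto dest: borel_measurable_integrable)
  have "(\<integral>x. \<bar>U t x - U s x - (t - s) * g x\<bar> \<partial>M) \<le> (\<integral>x. (\<integral>q. \<bar>h q x\<bar> \<partial>lborel) \<partial>M)"
  proof (rule integral_mono_AE)
    show "integrable M (\<lambda>x. \<integral>q. \<bar>h q x\<bar> \<partial>lborel)" by (rule LM.integrable_snd[OF ha])
    show "AE x in M. \<bar>U t x - U s x - (t - s) * g x\<bar> \<le> (\<integral>q. \<bar>h q x\<bar> \<partial>lborel)"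
      using eq by eventually_elim (simp add: integral_abs_bound)
  qed (use int in simp)
  also have "\<dots> = (\<integral>q. (\<integral>x. \<bar>h q x\<bar> \<partial>M) \<partial>lborel)" by (rule LM.Fubini_integral[OF ha])
  also have "\<dots> \<le> (\<integral>q. \<eta> * indicator {s..t} q \<partial>lborel)"
  proof (rule integral_mono)
    show "integrable lborel (\<lambda>q. \<integral>x. \<bar>h q x\<bar> \<partial>M)" by (rule LM.integrable_fst[OF ha])
    show "integrable lborel (\<lambda>q. \<eta> * indicator {s..t} q)" using st by simp
    show "(\<integral>x. \<bar>h q x\<bar> \<partial>M) \<le> \<eta> * indicator {s..t} q" for q
      using \<eta>[of q] st by (cases "q \<in> {s..t}") (auto simp: h_def clamp)
  qed
  also have "\<dots> = \<eta> * (t - s)" using st by simp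
  finally show "(\<integral>x. \<bar>U t x - U s x - (t - s) * g x\<bar> \<partial>M) \<le> \<eta> * (t - s)" .
qed

lemma L1_lipschitz:
  assumes "s < t" "t \<le> b"
  shows "integrable M (\<lambda>x. \<bar>U t x - U s x\<bar>)" "(\<integral>x. \<bar>U t x - U s x\<bar> \<partial>M) \<le> C * exp t * (t - s)"
  using L1_increment[OF assms, of "\<lambda>_. 0" "C * exp t"] U'_bound' assms by auto

end

section \<open>The integrated balance\<close>

lemma abs_one_minus_exp_le: "\<bar>1 - exp x\<bar> \<le> \<bar>x\<bar> * exp \<bar>x\<bar>" for x :: real
proof (cases "0 \<le> x")
  case True
  have "1 - x \<le> exp (- x)" using exp_ge_add_one_self[of "- x"] by simp
  then have "(1 - x) * exp x \<le> exp (- x) * exp x" by (rule mult_right_mono) simp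
  then show ?thesis using True by (simp add: algebra_simps flip: exp_add)
next
  case False
  then have "exp x \<le> 1" by simp
  moreover have "1 + x \<le> exp x" by (rule exp_ge_add_one_self)
  ultimately have "\<bar>1 - exp x\<bar> \<le> \<bar>x\<bar> * 1" by linarith
  also have "\<dots> \<le> \<bar>x\<bar> * exp \<bar>x\<bar>" by (intro mult_left_mono) auto
  finally show ?thesis .
qed

context degenerate_evolution
begin

abbreviation "W1 \<equiv> lag_weight \<beta>"
abbreviation "W2 \<equiv> lag_weight (\<beta> + k)"

lemma W_le:
  assumes h: "0 < h"
  shows "W1 h \<le> 1 / h" "W2 h \<le> 1 / h"
proof -
  have "lag_weight c' h \<le> 1 / h" if "0 \<le> c'" for c'
  proof -
    have "0 \<le> c' * h" using that h by simp
    then have "exp (- c' * h) \<le> 1" by simp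
    then show ?thesis unfolding lag_weight_def using h by (intro divide_right_mono) auto
  qed
  then show "W1 h \<le> 1 / h" "W2 h \<le> 1 / h" using const by auto
qed

lemma FG_L1:
  assumes st: "s < t" "t \<le> b"
  shows "integrable M (F s t)" "integrable M (G s t)"
    "(\<integral>x. F s t x \<partial>M) \<le> C * exp t * (t - s)" "(\<integral>x. G s t x \<partial>M) \<le> C * exp t * (t - s)"
proof -
  note L = L1_lipschitz[OF st]
  have "Fc s t \<in> borel_measurable M" "Gc s t \<in> borel_measurable M"
    using composed_measurable2[of "\<lambda>_. s" M "\<lambda>_. t" "\<lambda>x. x"] by auto
  then have m: "F s t \<in> borel_measurable M" "G s t \<in> borel_measurable M"
    using clamp_FG[OF st] by (auto cong: measurable_cong_simp)
  show i: "integrable M (F s t)" "integrable M (G s t)"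
    by (rule Bochner_Integration.integrable_bound[OF L(1)]; use m F_bounds[OF st] G_bounds[OF st] in auto)+
  have "(\<integral>x. F s t x \<partial>M) \<le> (\<integral>x. \<bar>U t x - U s x\<bar> \<partial>M)" "(\<integral>x. G s t x \<partial>M) \<le> (\<integral>x. \<bar>U t x - U s x\<bar> \<partial>M)"
    by (rule integral_mono; use i L F_bounds[OF st] G_bounds[OF st] in auto)+
  then show "(\<integral>x. F s t x \<partial>M) \<le> C * exp t * (t - s)" "(\<integral>x. G s t x \<partial>M) \<le> C * exp t * (t - s)"
    using L(2) by linarith+
qed

lemma FG_nonneg: "s < t \<Longrightarrow> t \<le> b \<Longrightarrow> 0 \<le> (\<integral>x. G s t x \<partial>M)" "s < t \<Longrightarrow> t \<le> b \<Longrightarrow> 0 \<le> (\<integral>x. F s t x \<partial>M)"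
  using G_bounds F_bounds by (auto intro!: Bochner_Integration.integral_nonneg_AE AE_I2)

text \<open>
The violations are of the order of the lag in \<open>L\<^sup>1\<close>, which compensates the singular weight.
\<close>

lemma weighted_joint:
  fixes w :: "real \<Rightarrow> real" and g h :: "real \<Rightarrow> real"
  assumes [measurable]: "w \<in> borel_measurable borel" "g \<in> borel_measurable borel" "h \<in> borel_measurable borel"
    and gh: "\<And>s. l \<le> s \<Longrightarrow> s \<le> u \<Longrightarrow> g s < h s \<and> h s \<le> b"
    and wb: "\<And>s. l \<le> s \<Longrightarrow> s \<le> u \<Longrightarrow> \<bar>w s\<bar> * (h s - g s) \<le> K"
  shows "integrable (lborel \<Otimes>\<^sub>M M) (\<lambda>(s, x). indicator {l..u} s * (w s * Fc (g s) (h s) x))"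
    and "integrable (lborel \<Otimes>\<^sub>M M) (\<lambda>(s, x). indicator {l..u} s * (w s * Gc (g s) (h s) x))"
proof -
  have [measurable]: "(\<lambda>z. Fc (g (fst z)) (h (fst z)) (snd z)) \<in> borel_measurable (lborel \<Otimes>\<^sub>M M)"
    "(\<lambda>z. Gc (g (fst z)) (h (fst z)) (snd z)) \<in> borel_measurable (lborel \<Otimes>\<^sub>M M)"
    by (rule composed_measurable2; measurable)+
  have Kb: "\<bar>w s\<bar> * (C * exp (h s) * (h s - g s)) \<le> C * exp b * K" if "s \<in> {l..u}" for s
  proof -
    have "\<bar>w s\<bar> * (C * exp (h s) * (h s - g s)) = (C * exp (h s)) * (\<bar>w s\<bar> * (h s - g s))" by simp
    also have "\<dots> \<le> (C * exp b) * K"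
      using gh[of s] wb[of s] that C_nonneg by (intro mult_mono) auto
    finally show ?thesis by simp
  qed
  have slice: "integrable M (\<lambda>x. indicator {l..u} s * (w s * Fc (g s) (h s) x))"
    "(\<integral>x. \<bar>indicator {l..u} s * (w s * Fc (g s) (h s) x)\<bar> \<partial>M) \<le> C * exp b * K"
    "integrable M (\<lambda>x. indicator {l..u} s * (w s * Gc (g s) (h s) x))"
    "(\<integral>x. \<bar>indicator {l..u} s * (w s * Gc (g s) (h s) x)\<bar> \<partial>M) \<le> C * exp b * K" if s: "s \<in> {l..u}" for s
  proof -
    have st: "g s < h s" "h s \<le> b" using gh[of s] s by auto
    note FG = FG_L1[OF st] and c = clamp_FG[OF st]
    show "integrable M (\<lambda>x. indicator {l..u} s * (w s * Fc (g s) (h s) x))"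
      "integrable M (\<lambda>x. indicator {l..u} s * (w s * Gc (g s) (h s) x))"
      using FG(1,2) by (auto simp: c cong: Bochner_Integration.integrable_cong)
    have "(\<integral>x. \<bar>indicator {l..u} s * (w s * Fc (g s) (h s) x)\<bar> \<partial>M) = (\<integral>x. \<bar>w s\<bar> * F (g s) (h s) x \<partial>M)"
      "(\<integral>x. \<bar>indicator {l..u} s * (w s * Gc (g s) (h s) x)\<bar> \<partial>M) = (\<integral>x. \<bar>w s\<bar> * G (g s) (h s) x \<partial>M)"
      by (rule Bochner_Integration.integral_cong; use s F_bounds[OF st] G_bounds[OF st] in \<open>simp add: c abs_mult\<close>)+
    then have "(\<integral>x. \<bar>indicator {l..u} s * (w s * Fc (g s) (h s) x)\<bar> \<partial>M) = \<bar>w s\<bar> * (\<integral>x. F (g s) (h s) x \<partial>M)"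
      "(\<integral>x. \<bar>indicator {l..u} s * (w s * Gc (g s) (h s) x)\<bar> \<partial>M) = \<bar>w s\<bar> * (\<integral>x. G (g s) (h s) x \<partial>M)"
      by simp_all
    moreover have "\<bar>w s\<bar> * (\<integral>x. F (g s) (h s) x \<partial>M) \<le> C * exp b * K" "\<bar>w s\<bar> * (\<integral>x. G (g s) (h s) x \<partial>M) \<le> C * exp b * K"
      by (rule order_trans[OF mult_left_mono[OF _ abs_ge_zero] Kb[OF s]]; use FG in simp)+
    ultimately show "(\<integral>x. \<bar>indicator {l..u} s * (w s * Fc (g s) (h s) x)\<bar> \<partial>M) \<le> C * exp b * K"
      "(\<integral>x. \<bar>indicator {l..u} s * (w s * Gc (g s) (h s) x)\<bar> \<partial>M) \<le> C * exp b * K" by simp_all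
  qed
  show "integrable (lborel \<Otimes>\<^sub>M M) (\<lambda>(s, x). indicator {l..u} s * (w s * Fc (g s) (h s) x))"
    by (rule LM.integrable_bounded_slices[where A="{l..u}" and K="C * exp b * K"])
      (use slice in \<open>auto simp: emeasure_lborel_Icc_eq case_prod_beta\<close>)
  show "integrable (lborel \<Otimes>\<^sub>M M) (\<lambda>(s, x). indicator {l..u} s * (w s * Gc (g s) (h s) x))"
    by (rule LM.integrable_bounded_slices[where A="{l..u}" and K="C * exp b * K"])
      (use slice in \<open>auto simp: emeasure_lborel_Icc_eq case_prod_beta\<close>)
qed

text \<open>
With the weight \<open>exp (- k * t)\<close> times the lag weight, the pairing inequality at each pair of times is
the sign of the spatial integral of the integrand of \<open>path_inequality\<close>.
\<close>

lemma pairing_integral_nonpos: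
  assumes a: "a < b" and e: "0 < e" "e < b - a"
  defines "H \<equiv> \<lambda>z x. indicator (defect_region a e) z * (if \<theta> * (vc (snd z) x - vc (fst z) x) < 0
      then \<theta> * (W2 (snd z - fst z) * Uc' (fst z) x - W1 (snd z - fst z) * Uc' (snd z) x) else 0)"
  shows "integrable M (\<lambda>x. \<integral>z. H z x \<partial>(lborel \<Otimes>\<^sub>M lborel))" "(\<integral>x. (\<integral>z. H z x \<partial>(lborel \<Otimes>\<^sub>M lborel)) \<partial>M) \<le> 0"
proof -
  have "sigma_finite_measure (lborel \<Otimes>\<^sub>M lborel :: (real \<times> real) measure)"
    unfolding lborel_prod by (rule sigma_finite_lborel)
  then interpret PM: pair_sigma_finite "lborel \<Otimes>\<^sub>M lborel :: (real \<times> real) measure" M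
    by (intro pair_sigma_finite.intro sigma_finite_measure_axioms)
  have "closed (defect_region a e)"
    unfolding defect_region_def case_prod_unfold by (intro closed_Collect_conj closed_Collect_le continuous_intros)
  then have Dm[measurable]: "defect_region a e \<in> sets (lborel \<Otimes>\<^sub>M lborel)" unfolding lborel_prod by simp
  have D: "a \<le> s" "s < t" "t \<le> b" "e \<le> t - s" "s \<le> b" if "(s, t) \<in> defect_region a e" for s t
    using that e by (auto simp: defect_region_def)
  have [measurable]:
    "(\<lambda>z. vc (fst (fst z)) (snd z)) \<in> borel_measurable ((lborel \<Otimes>\<^sub>M lborel) \<Otimes>\<^sub>M M)"
    "(\<lambda>z. vc (snd (fst z)) (snd z)) \<in> borel_measurable ((lborel \<Otimes>\<^sub>M lborel) \<Otimes>\<^sub>M M)"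
    "(\<lambda>z. Uc' (fst (fst z)) (snd z)) \<in> borel_measurable ((lborel \<Otimes>\<^sub>M lborel) \<Otimes>\<^sub>M M)"
    "(\<lambda>z. Uc' (snd (fst z)) (snd z)) \<in> borel_measurable ((lborel \<Otimes>\<^sub>M lborel) \<Otimes>\<^sub>M M)"
    by (rule composed_measurable; measurable)+
  have H_meas: "case_prod H \<in> borel_measurable ((lborel \<Otimes>\<^sub>M lborel) \<Otimes>\<^sub>M M)"
    unfolding H_def case_prod_beta by measurable
  have slice: "integrable M (H z) \<and> (\<integral>x. \<bar>H z x\<bar> \<partial>M) \<le> 2 * (C * exp b) / e" for z
  proof (cases "z \<in> defect_region a e")
    case False
    then have "H z = (\<lambda>_. 0)" by (simp add: H_def)
    then show ?thesis using C_nonneg e by simp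
  next
    case True
    obtain s t where z: "z = (s, t)" by force
    note d = D[OF True[unfolded z]]
    let ?B = "\<lambda>x. (1 / e) * \<bar>U' s x\<bar> + (1 / e) * \<bar>U' t x\<bar>"
    have iB: "integrable M ?B" using U'_int[OF d(3)] U'_int[OF d(5)] by auto
    have "1 / (t - s) \<le> 1 / e" using d e by (intro divide_left_mono) auto
    then have W: "0 \<le> W1 (t - s)" "0 \<le> W2 (t - s)" "W1 (t - s) \<le> 1 / e" "W2 (t - s) \<le> 1 / e"
      using W_le[of "t - s"] lag_weight_pos[of "t - s"] d by (auto intro: less_imp_le order_trans)
    have bd: "\<bar>H z x\<bar> \<le> ?B x" for x
    proof -
      have "\<bar>H z x\<bar> \<le> \<bar>W2 (t - s) * U' s x - W1 (t - s) * U' t x\<bar>"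
        unfolding H_def z using d by (auto simp: abs_mult clamp split: split_indicator)
      also have "\<dots> \<le> W2 (t - s) * \<bar>U' s x\<bar> + W1 (t - s) * \<bar>U' t x\<bar>"
        using W by (metis abs_mult abs_of_nonneg abs_triangle_ineq4)
      also have "\<dots> \<le> ?B x" using W by (intro add_mono mult_right_mono) auto
      finally show ?thesis .
    qed
    have m: "H z \<in> borel_measurable M"
      using measurable_compose[OF measurable_Pair1' H_meas, of z] by (simp add: space_pair_measure)
    have i: "integrable M (H z)"
      by (rule Bochner_Integration.integrable_bound[OF iB m]) (use bd in \<open>auto intro: order_trans[OF _ abs_ge_self]\<close>)
    have "(\<integral>x. \<bar>H z x\<bar> \<partial>M) \<le> (\<integral>x. ?B x \<partial>M)" by (rule integral_mono) (use i iB bd in auto)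
    also have "\<dots> = (1 / e) * (\<integral>x. \<bar>U' s x\<bar> \<partial>M) + (1 / e) * (\<integral>x. \<bar>U' t x\<bar> \<partial>M)"
      using U'_int[OF d(3)] U'_int[OF d(5)] by simp
    also have "\<dots> \<le> (1 / e) * (C * exp b) + (1 / e) * (C * exp b)"
      using U'_bound'[of s b] U'_bound'[of t b] d e by (intro add_mono mult_left_mono) auto
    finally show ?thesis using i by simp
  qed
  have H: "integrable ((lborel \<Otimes>\<^sub>M lborel) \<Otimes>\<^sub>M M) (case_prod H)"
  proof (rule PM.integrable_bounded_slices[OF H_meas])
    show "{a..b} \<times> {a..b} \<in> sets (lborel \<Otimes>\<^sub>M lborel)" by simp
    show "emeasure (lborel \<Otimes>\<^sub>M lborel) ({a..b} \<times> {a..b}) < \<infinity>"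
      unfolding lborel_prod by (rule emeasure_bounded_finite) (simp add: bounded_Times)
    show "H z x = 0" if "z \<notin> {a..b} \<times> {a..b}" for z x
      using that D[of "fst z" "snd z"] by (cases z) (auto simp: H_def split: split_indicator)
  qed (use slice in auto)
  show "integrable M (\<lambda>x. \<integral>z. H z x \<partial>(lborel \<Otimes>\<^sub>M lborel))" by (rule PM.integrable_snd[OF H])
  have neg: "(\<integral>x. H z x \<partial>M) \<le> 0" for z
  proof (cases "z \<in> defect_region a e")
    case True
    obtain s t where z: "z = (s, t)" by force
    note d = D[OF True[unfolded z]]
    \<comment> \<open>Both weights are the factor \<open>W1 (t - s) * exp (- k * t)\<close> times the exponentials of \<open>pairing\<close>.\<close>
    let ?p = "\<lambda>x. if \<theta> * (\<phi> (U t x) * exp (r t x) - \<phi> (U s x) * exp (r s x)) < 0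
          then \<theta> * (exp (k * t) * U' t x - exp (k * s) * U' s x) else 0"
    have "(\<integral>x. H z x \<partial>M) = (\<integral>x. - (W1 (t - s) * exp (- k * t)) * ?p x \<partial>M)"
    proof (rule Bochner_Integration.integral_cong[OF refl])
      fix x assume x: "x \<in> space M"
      have W2: "W2 (t - s) = W1 (t - s) * exp (- k * t) * exp (k * s)"
        by (simp add: lag_weight_add exp_add[symmetric] algebra_simps)
      have W1: "W1 (t - s) = W1 (t - s) * exp (- k * t) * exp (k * t)"
        by (simp add: exp_add[symmetric] mult.assoc)
      have "W2 (t - s) * U' s x - W1 (t - s) * U' t x = - (W1 (t - s) * exp (- k * t)) * (exp (k * t) * U' t x - exp (k * s) * U' s x)"
        unfolding W2 by (subst (2) W1) (simp add: algebra_simps)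
      then show "H z x = - (W1 (t - s) * exp (- k * t)) * ?p x"
        using True d x unfolding H_def z by (simp add: clamp v_def)
    qed
    also have "\<dots> = - (W1 (t - s) * exp (- k * t)) * (\<integral>x. ?p x \<partial>M)" by simp
    also have "\<dots> \<le> 0"
      using pairing[OF d(2,3)] lag_weight_pos[of "t - s" \<beta>] d by (simp add: mult_nonneg_nonneg less_imp_le)
    finally show ?thesis .
  qed (simp add: H_def)
  have "(\<integral>x. (\<integral>z. H z x \<partial>(lborel \<Otimes>\<^sub>M lborel)) \<partial>M) = (\<integral>z. (\<integral>x. H z x \<partial>M) \<partial>(lborel \<Otimes>\<^sub>M lborel))"
    by (rule PM.Fubini_integral[OF H])
  also have "\<dots> \<le> (\<integral>z. 0 \<partial>(lborel \<Otimes>\<^sub>M lborel :: (real \<times> real) measure))"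
    by (rule integral_mono) (use PM.integrable_fst[OF H] neg in auto)
  finally show "(\<integral>x. (\<integral>z. H z x \<partial>(lborel \<Otimes>\<^sub>M lborel)) \<partial>M) \<le> 0" by simp
qed

text \<open>
The difference of the two measures of a violation at lag \<open>e\<close>, relative to \<open>e\<close>; it bounds the
diagonal terms up to terms of order \<open>e\<close>.
\<close>

definition defect :: "real \<Rightarrow> real \<Rightarrow> real" where
  "defect e s = (\<integral>x. \<bar>Gc s (s + e) x - Fc s (s + e) x\<bar> / e \<partial>M)"

text \<open>
\<open>path_estimate\<close> is integrated over space.  The double integral drops out by its sign, the initial
boundary term is small because \<open>U'\<close> is of the order of \<open>exp a\<close> near the time \<open>a\<close>, and the diagonal term
reduces to the defect.
\<close>

lemma balance:
  assumes a: "a < b" and e: "0 < e" "e < b - a" "e \<le> 1"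
  shows "(LBINT s:{a..b - e}. W1 (b - s) * (\<integral>x. G s b x \<partial>M))
    \<le> (LBINT s:{a..b - e}. defect e s) + \<bar>k\<bar> * exp \<bar>k\<bar> * (C * exp b * e) * (b - a) + C * exp a * (b - a)"
proof -
  define Hf where "Hf s x = indicator {a..b - e} s * (W1 (b - s) * Gc s b x)" for s x
  define Hg where "Hg s x = indicator {a..b - e} s * (W1 e * Gc s (s + e) x)" for s x
  define Hh where "Hh s x = indicator {a..b - e} s * (W2 e * Fc s (s + e) x)" for s x
  define Hs where "Hs t x = indicator {a + e..b} t * (W2 (t - a) * Fc a t x)" for t x
  have wb: "\<bar>W1 h\<bar> * h \<le> 1" "\<bar>W2 h\<bar> * h \<le> 1" if "0 < h" for h
    using W_le[OF that] lag_weight_pos[OF that] that by (simp_all add: field_simps abs_of_pos)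
  have Hf: "integrable (lborel \<Otimes>\<^sub>M M) (case_prod Hf)" and Hg: "integrable (lborel \<Otimes>\<^sub>M M) (case_prod Hg)"
    and Hh: "integrable (lborel \<Otimes>\<^sub>M M) (case_prod Hh)" and Hs: "integrable (lborel \<Otimes>\<^sub>M M) (case_prod Hs)"
    unfolding Hf_def Hg_def Hh_def Hs_def
    by (rule weighted_joint[where K=1]; use e wb in auto)+
  note snd = LM.integrable_snd[OF Hf] LM.integrable_snd[OF Hg] LM.integrable_snd[OF Hh] LM.integrable_snd[OF Hs]
  note Fub = LM.Fubini_integral[OF Hf] LM.Fubini_integral[OF Hg] LM.Fubini_integral[OF Hh] LM.Fubini_integral[OF Hs]
  note J = pairing_integral_nonpos[OF a e(1,2)]
  define J where "J x = (\<integral>z. indicator (defect_region a e) z * (if \<theta> * (vc (snd z) x - vc (fst z) x) < 0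
      then \<theta> * (W2 (snd z - fst z) * Uc' (fst z) x - W1 (snd z - fst z) * Uc' (snd z) x) else 0) \<partial>(lborel \<Otimes>\<^sub>M lborel))" for x
  have Ji: "integrable M J" and Jn: "(\<integral>x. J x \<partial>M) \<le> 0" using J by (simp_all add: J_def[abs_def])
  have est: "AE x in M. (\<integral>s. Hf s x \<partial>lborel) \<le> (\<integral>s. Hg s x \<partial>lborel) - (\<integral>s. Hh s x \<partial>lborel) + (\<integral>t. Hs t x \<partial>lborel) + J x"
    using AE_U'_integrable[OF order_refl, of a] AE_space LM.AE_integrable_snd[OF Hg] LM.AE_integrable_snd[OF Hh]
  proof eventually_elim
    case (elim x)
        note est = path_estimate[OF a elim(2,1) e(1,2)]
    have "(LBINT s:{a..b - e}. W1 (b - s) * G s b x) = (\<integral>s. Hf s x \<partial>lborel)"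
      unfolding set_lebesgue_integral_def
      by (rule Bochner_Integration.integral_cong) (use e elim(2) in \<open>auto simp: Hf_def clamp_FG split: split_indicator\<close>)
    moreover have "(LBINT s:{a..b - e}. W1 e * G s (s + e) x - W2 e * F s (s + e) x) = (\<integral>s. Hg s x - Hh s x \<partial>lborel)"
      unfolding set_lebesgue_integral_def
      by (rule Bochner_Integration.integral_cong) (use e elim(2) in \<open>auto simp: Hg_def Hh_def clamp_FG split: split_indicator\<close>)
    moreover have "(LBINT t:{a + e..b}. W2 (t - a) * F a t x) = (\<integral>t. Hs t x \<partial>lborel)"
      unfolding set_lebesgue_integral_def
      by (rule Bochner_Integration.integral_cong) (use e elim(2) in \<open>auto simp: Hs_def clamp_FG split: split_indicator\<close>)
    moreover have "(\<integral>(s, t). indicator (defect_region a e) (s, t) * (if bad s t x then \<theta> * (W2 (t - s) * U' s x - W1 (t - s) * U' t x) else 0)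
         \<partial>(lborel \<Otimes>\<^sub>M lborel)) = J x"
      unfolding J_def
    proof (rule Bochner_Integration.integral_cong[OF refl])
      fix z :: "real \<times> real"
      obtain s t where z: "z = (s, t)" by force
      show "(case z of (s, t) \<Rightarrow> indicator (defect_region a e) (s, t) * (if bad s t x then \<theta> * (W2 (t - s) * U' s x - W1 (t - s) * U' t x) else 0))
        = indicator (defect_region a e) z * (if \<theta> * (vc (snd z) x - vc (fst z) x) < 0
      then \<theta> * (W2 (snd z - fst z) * Uc' (fst z) x - W1 (snd z - fst z) * Uc' (snd z) x) else 0)"
      proof (cases "(s, t) \<in> defect_region a e")
        case True
        then have "s \<le> b" "t \<le> b" using e by (auto simp: defect_region_def)
        then show ?thesis using elim(2) by (simp add: z bad_def clamp)
      qed (simp add: z)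
    qed
    moreover have "(\<integral>s. Hg s x - Hh s x \<partial>lborel) = (\<integral>s. Hg s x \<partial>lborel) - (\<integral>s. Hh s x \<partial>lborel)"
      using elim by (intro Bochner_Integration.integral_diff) auto
    ultimately show ?case using est by linarith
  qed
  have "(\<integral>x. (\<integral>s. Hf s x \<partial>lborel) \<partial>M)
      \<le> (\<integral>x. (\<integral>s. Hg s x \<partial>lborel) - (\<integral>s. Hh s x \<partial>lborel) + (\<integral>t. Hs t x \<partial>lborel) + J x \<partial>M)"
    by (rule integral_mono_AE) (use snd Ji est in auto)
  also have "\<dots> = (\<integral>x. (\<integral>s. Hg s x \<partial>lborel) \<partial>M) - (\<integral>x. (\<integral>s. Hh s x \<partial>lborel) \<partial>M) + (\<integral>x. (\<integral>t. Hs t x \<partial>lborel) \<partial>M) + (\<integral>x. J x \<partial>M)"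
    using snd Ji by simp
  finally have main: "(\<integral>s. (\<integral>x. Hf s x \<partial>M) \<partial>lborel) \<le> (\<integral>s. (\<integral>x. Hg s x \<partial>M) \<partial>lborel) - (\<integral>s. (\<integral>x. Hh s x \<partial>M) \<partial>lborel) + (\<integral>t. (\<integral>x. Hs t x \<partial>M) \<partial>lborel)"
    using Jn unfolding Fub by linarith
  have f_eq: "(\<integral>s. (\<integral>x. Hf s x \<partial>M) \<partial>lborel) = (LBINT s:{a..b - e}. W1 (b - s) * (\<integral>x. G s b x \<partial>M))"
    unfolding set_lebesgue_integral_def
  proof (rule Bochner_Integration.integral_cong[OF refl])
    fix s
    show "(\<integral>x. Hf s x \<partial>M) = indicator {a..b - e} s *\<^sub>R (W1 (b - s) * (\<integral>x. G s b x \<partial>M))"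
    proof (cases "s \<in> {a..b - e}")
      case True
      then have "(\<integral>x. Hf s x \<partial>M) = (\<integral>x. W1 (b - s) * G s b x \<partial>M)"
        by (intro Bochner_Integration.integral_cong) (use e in \<open>auto simp: Hf_def clamp_FG\<close>)
      then show ?thesis using True by simp
    qed (simp add: Hf_def)
  qed
  have start: "(\<integral>t. (\<integral>x. Hs t x \<partial>M) \<partial>lborel) \<le> C * exp a * (b - a)"
  proof -
    have "(\<integral>t. (\<integral>x. Hs t x \<partial>M) \<partial>lborel) \<le> (\<integral>t. C * exp a * indicator {a..b} t \<partial>lborel)"
    proof (rule integral_mono[OF LM.integrable_fst[OF Hs]])
      fix t
      show "(\<integral>x. Hs t x \<partial>M) \<le> C * exp a * indicator {a..b} t"
      proof (cases "t \<in> {a + e..b}")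
        case True
        then have t: "a < t" "t \<le> b" using e by auto
        have "(\<integral>x. Hs t x \<partial>M) = (\<integral>x. W2 (t - a) * F a t x \<partial>M)"
          by (intro Bochner_Integration.integral_cong) (use True t in \<open>auto simp: Hs_def clamp_FG\<close>)
        also have "\<dots> = W2 (t - a) * (\<integral>x. F a t x \<partial>M)" by simp
        also have "\<dots> \<le> W2 (t - a) * (C * exp t * (t - a))"
          using FG_L1(3)[OF t] lag_weight_pos[of "t - a"] t by (intro mult_left_mono) (auto intro: less_imp_le)
        \<comment> \<open>The factor \<open>t - a\<close> from the \<open>L\<^sup>1\<close> bound cancels the singularity of the weight.\<close>
        also have "\<dots> = C * exp a * exp (- ((\<beta> + k - 1) * (t - a)))"
          using t by (simp add: lag_weight_def field_simps flip: exp_add)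
        also have "\<dots> \<le> C * exp a * 1"
        proof (rule mult_left_mono)
          have "0 \<le> (\<beta> + k - 1) * (t - a)" using const t by (intro mult_nonneg_nonneg) auto
          then show "exp (- ((\<beta> + k - 1) * (t - a))) \<le> 1" by simp
        qed (use C_nonneg in simp)
        finally show ?thesis using True e by simp
      next
        case False
        then show ?thesis using C_nonneg by (simp add: Hs_def)
      qed
    qed (use a in simp)
    also have "\<dots> = C * exp a * (b - a)" using a by simp
    finally show ?thesis .
  qed
  have def_i: "integrable (lborel \<Otimes>\<^sub>M M) (\<lambda>(s, x). \<bar>indicator {a..b - e} s * ((1 / e) * Gc s (s + e) x) - indicator {a..b - e} s * ((1 / e) * Fc s (s + e) x)\<bar>)"
  proof -
    have "integrable (lborel \<Otimes>\<^sub>M M) (\<lambda>(s, x). indicator {a..b - e} s * ((1 / e) * Gc s (s + e) x))"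
      "integrable (lborel \<Otimes>\<^sub>M M) (\<lambda>(s, x). indicator {a..b - e} s * ((1 / e) * Fc s (s + e) x))"
      by (rule weighted_joint[where K=1]; use e in auto)+
    from integrable_abs[OF Bochner_Integration.integrable_diff[OF this]] show ?thesis
      by (simp add: case_prod_beta')
  qed
  have def_eq: "(\<integral>x. \<bar>indicator {a..b - e} s * ((1 / e) * Gc s (s + e) x) - indicator {a..b - e} s * ((1 / e) * Fc s (s + e) x)\<bar> \<partial>M)
      = indicator {a..b - e} s * defect e s" for s
    unfolding defect_def using e
    by (cases "s \<in> {a..b - e}") (auto intro!: Bochner_Integration.integral_cong simp: abs_divide simp flip: diff_divide_distrib)
  have di: "integrable lborel (\<lambda>s. indicator {a..b - e} s * defect e s)"
    using LM.integrable_fst[OF def_i] unfolding def_eq .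
  let ?K = "\<bar>k\<bar> * exp \<bar>k\<bar> * (C * exp b * e)"
  have "(\<integral>s. (\<integral>x. Hg s x \<partial>M) \<partial>lborel) - (\<integral>s. (\<integral>x. Hh s x \<partial>M) \<partial>lborel) = (\<integral>s. (\<integral>x. Hg s x \<partial>M) - (\<integral>x. Hh s x \<partial>M) \<partial>lborel)"
    by (rule Bochner_Integration.integral_diff[symmetric]; rule LM.integrable_fst[OF Hg] LM.integrable_fst[OF Hh])
  also have "\<dots> \<le> (\<integral>s. indicator {a..b - e} s * defect e s + ?K * indicator {a..b} s \<partial>lborel)"
  proof (rule integral_mono)
    show "integrable lborel (\<lambda>s. (\<integral>x. Hg s x \<partial>M) - (\<integral>x. Hh s x \<partial>M))"
      using LM.integrable_fst[OF Hg] LM.integrable_fst[OF Hh] by simp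
    show "integrable lborel (\<lambda>s. indicator {a..b - e} s * defect e s + ?K * indicator {a..b} s)"
      using di a by simp
    fix s
    show "(\<integral>x. Hg s x \<partial>M) - (\<integral>x. Hh s x \<partial>M) \<le> indicator {a..b - e} s * defect e s + ?K * indicator {a..b} s"
    proof (cases "s \<in> {a..b - e}")
      case True
      then have st: "s < s + e" "s + e \<le> b" using e by auto
      note FG = FG_L1[OF st]
      have "(\<integral>x. Hg s x \<partial>M) - (\<integral>x. Hh s x \<partial>M) = (\<integral>x. W1 e * G s (s + e) x \<partial>M) - (\<integral>x. W2 e * F s (s + e) x \<partial>M)"
        by (intro arg_cong2[where f=minus] Bochner_Integration.integral_cong) (use True st in \<open>auto simp: Hg_def Hh_def clamp_FG\<close>)
      also have "\<dots> = (\<integral>x. W1 e * G s (s + e) x - W2 e * F s (s + e) x \<partial>M)"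
        using FG by (intro Bochner_Integration.integral_diff[symmetric]) auto
      also have "\<dots> \<le> (\<integral>x. \<bar>G s (s + e) x - F s (s + e) x\<bar> / e + \<bar>k\<bar> * exp \<bar>k\<bar> * F s (s + e) x \<partial>M)"
      proof (rule integral_mono)
        fix x assume x: "x \<in> space M"
        have W1: "0 \<le> W1 e" "W1 e \<le> 1 / e" using W_le(1)[OF e(1)] lag_weight_pos[OF e(1)] by (auto intro: less_imp_le)
        have "W1 e - W2 e = W1 e * (1 - exp (- k * e))" by (simp add: lag_weight_add algebra_simps)
        also have "\<dots> \<le> W1 e * (\<bar>- k * e\<bar> * exp \<bar>- k * e\<bar>)"
          by (rule mult_left_mono[OF order_trans[OF abs_ge_self abs_one_minus_exp_le] W1(1)])
        also have "\<dots> \<le> (1 / e) * (\<bar>- k * e\<bar> * exp \<bar>- k * e\<bar>)"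
          by (rule mult_right_mono[OF W1(2)]) simp
        also have "\<dots> = \<bar>k\<bar> * exp (\<bar>k\<bar> * e)" using e by (simp add: abs_mult)
        also have "\<dots> \<le> \<bar>k\<bar> * exp \<bar>k\<bar>" using e by (intro mult_left_mono) (auto simp: mult_left_le)
        finally have W12: "W1 e - W2 e \<le> \<bar>k\<bar> * exp \<bar>k\<bar>" .
        have "W1 e * G s (s + e) x - W2 e * F s (s + e) x = W1 e * (G s (s + e) x - F s (s + e) x) + (W1 e - W2 e) * F s (s + e) x"
          by (simp add: algebra_simps)
        also have "\<dots> \<le> (1 / e) * \<bar>G s (s + e) x - F s (s + e) x\<bar> + (\<bar>k\<bar> * exp \<bar>k\<bar>) * F s (s + e) x"
        proof (intro add_mono mult_right_mono[OF W12])
          have "W1 e * (G s (s + e) x - F s (s + e) x) \<le> W1 e * \<bar>G s (s + e) x - F s (s + e) x\<bar>"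
            using W1 by (intro mult_left_mono) auto
          also have "\<dots> \<le> (1 / e) * \<bar>G s (s + e) x - F s (s + e) x\<bar>" using W1 by (intro mult_right_mono) auto
          finally show "W1 e * (G s (s + e) x - F s (s + e) x) \<le> (1 / e) * \<bar>G s (s + e) x - F s (s + e) x\<bar>" .
        qed (use F_bounds[OF st x] in simp)
        finally show "W1 e * G s (s + e) x - W2 e * F s (s + e) x \<le> \<bar>G s (s + e) x - F s (s + e) x\<bar> / e + \<bar>k\<bar> * exp \<bar>k\<bar> * F s (s + e) x"
          by simp
      qed (use FG in auto)
      also have "\<dots> = (\<integral>x. \<bar>G s (s + e) x - F s (s + e) x\<bar> / e \<partial>M) + \<bar>k\<bar> * exp \<bar>k\<bar> * (\<integral>x. F s (s + e) x \<partial>M)"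
        using FG by simp
      also have "(\<integral>x. \<bar>G s (s + e) x - F s (s + e) x\<bar> / e \<partial>M) = defect e s"
        unfolding defect_def by (rule Bochner_Integration.integral_cong) (use st in \<open>auto simp: clamp_FG\<close>)
      also have "(\<integral>x. F s (s + e) x \<partial>M) \<le> C * exp b * e"
      proof -
        have "C * exp (s + e) * e \<le> C * exp b * e" using st e C_nonneg by (intro mult_right_mono mult_left_mono) auto
        then show ?thesis using FG(3) by simp
      qed
      finally show ?thesis using True e by (simp add: mult_left_mono)
    next
      case False
      have "0 \<le> ?K" using C_nonneg e by simp
      then show ?thesis using False by (simp add: Hg_def Hh_def)
    qed
  qed
  also have "\<dots> = (LBINT s:{a..b - e}. defect e s) + ?K * (b - a)"
    unfolding set_lebesgue_integral_def using di a by simp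
  finally show ?thesis using main start unfolding f_eq by linarith
qed

end

section \<open>Removal of the cut-offs\<close>

lemma AE_lborel_dense:
  fixes c d :: real
  assumes ae: "AE s in lborel. P s" and cd: "c < d"
  shows "\<exists>s. c < s \<and> s < d \<and> P s"
proof (rule ccontr)
  assume "\<not> ?thesis"
  then have "AE s in lborel. s \<notin> {c<..<d}" using ae by (auto elim!: eventually_mono)
  then have "{c<..<d} \<in> null_sets lborel" by (subst AE_iff_null_sets) auto
  then show False using cd by (auto simp: null_sets_def)
qed

context degenerate_evolution
begin

lemma defect_measurable: "defect e \<in> borel_measurable lborel"
proof -
  have [measurable]: "(\<lambda>z. Fc (fst z) (fst z + e) (snd z)) \<in> borel_measurable (lborel \<Otimes>\<^sub>M M)"
    "(\<lambda>z. Gc (fst z) (fst z + e) (snd z)) \<in> borel_measurable (lborel \<Otimes>\<^sub>M M)"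
    by (rule composed_measurable2; measurable)+
  show ?thesis unfolding defect_def[abs_def]
    by (rule borel_measurable_lebesgue_integral) (simp add: case_prod_beta)
qed

lemma defect_abs_le: "s < t \<Longrightarrow> t \<le> b \<Longrightarrow> x \<in> space M \<Longrightarrow> \<bar>G s t x - F s t x\<bar> \<le> \<bar>U t x - U s x\<bar>"
  using G_bounds[of s t x] F_bounds[of s t x] by linarith

lemma defect_bounds:
  assumes "0 < e" "s + e \<le> b"
  shows "0 \<le> defect e s" "defect e s \<le> C * exp b"
proof -
  have st: "s < s + e" using assms by simp
  note FG = FG_L1[OF st assms(2)] and L = L1_lipschitz[OF st assms(2)]
  show "0 \<le> defect e s" unfolding defect_def using assms by simp
  have "defect e s = (\<integral>x. \<bar>G s (s + e) x - F s (s + e) x\<bar> / e \<partial>M)"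
    unfolding defect_def by (rule Bochner_Integration.integral_cong) (use st assms in \<open>auto simp: clamp_FG\<close>)
  also have "\<dots> \<le> (\<integral>x. \<bar>U (s + e) x - U s x\<bar> / e \<partial>M)"
    by (rule integral_mono) (use FG L assms defect_abs_le[OF st assms(2)] in \<open>auto intro: divide_right_mono\<close>)
  also have "\<dots> = (\<integral>x. \<bar>U (s + e) x - U s x\<bar> \<partial>M) / e" by simp
  also have "\<dots> \<le> (C * exp (s + e) * e) / e" using L assms by (intro divide_right_mono) auto
  also have "\<dots> \<le> C * exp b" using assms C_nonneg by (simp add: mult_left_mono)
  finally show "defect e s \<le> C * exp b" .
qed

lemma difference_quotient_L1:
  assumes s: "s < b" and e: "\<And>n. 0 < e n" "e \<longlonglongrightarrow> 0" "\<And>n. s + e n \<le> b"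
  shows "(\<lambda>n. \<integral>x. \<bar>(U (s + e n) x - U s x) / e n - U' s x\<bar> \<partial>M) \<longlonglongrightarrow> 0"
proof (rule tendstoI)
  fix \<eta> :: real assume \<eta>: "0 < \<eta>"
  have "\<forall>\<^sub>F q in at s within {..b}. (\<integral>x. \<bar>U' q x - U' s x\<bar> \<partial>M) < \<eta> / 2"
    using order_tendstoD(2)[OF U'_cont[of s], of "\<eta> / 2"] s \<eta> by simp
  then obtain d where d: "0 < d" "\<And>q. q \<le> b \<Longrightarrow> q \<noteq> s \<Longrightarrow> dist q s < d \<Longrightarrow> (\<integral>x. \<bar>U' q x - U' s x\<bar> \<partial>M) < \<eta> / 2"
    unfolding eventually_at by auto
  have "\<forall>\<^sub>F n in sequentially. e n < d" using order_tendstoD(2)[OF e(2) d(1)] .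
  then show "\<forall>\<^sub>F n in sequentially. dist (\<integral>x. \<bar>(U (s + e n) x - U s x) / e n - U' s x\<bar> \<partial>M) 0 < \<eta>"
  proof eventually_elim
    case (elim n)
    have st: "s < s + e n" using e(1)[of n] by simp
    have g: "integrable M (U' s)" using U'_int s by simp
    have "(\<integral>x. \<bar>U' q x - U' s x\<bar> \<partial>M) \<le> \<eta> / 2" if "s \<le> q" "q \<le> s + e n" for q
      using d(2)[of q] that elim e(3)[of n] \<eta> by (cases "q = s") (auto simp: dist_real_def)
    from L1_increment(2)[OF st e(3) g this]
    have le: "(\<integral>x. \<bar>U (s + e n) x - U s x - e n * U' s x\<bar> \<partial>M) \<le> \<eta> / 2 * e n" by simp
    have "(\<integral>x. \<bar>(U (s + e n) x - U s x) / e n - U' s x\<bar> \<partial>M) = (\<integral>x. \<bar>U (s + e n) x - U s x - e n * U' s x\<bar> / e n \<partial>M)"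
    proof (rule Bochner_Integration.integral_cong[OF refl])
      fix x
      have "(U (s + e n) x - U s x) / e n - U' s x = (U (s + e n) x - U s x - e n * U' s x) / e n"
        using e(1)[of n] by (simp add: field_simps)
      then show "\<bar>(U (s + e n) x - U s x) / e n - U' s x\<bar> = \<bar>U (s + e n) x - U s x - e n * U' s x\<bar> / e n"
        using e(1)[of n] by (simp add: abs_divide)
    qed
    also have "\<dots> \<le> \<eta> / 2" using le e(1)[of n] by (simp add: pos_divide_le_eq)
    finally show ?case using \<eta> by simp
  qed
qed

lemma defect_tendsto:
  assumes s: "s < b" and e: "\<And>n. 0 < e n" "e \<longlonglongrightarrow> 0"
  shows "(\<lambda>n. defect (e n) s) \<longlonglongrightarrow> 0"
proof -
  define e' where "e' n = min (e n) (b - s)" for n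
  have e': "0 < e' n" "s + e' n \<le> b" for n using e(1)[of n] s by (auto simp: e'_def)
  have e'0: "e' \<longlonglongrightarrow> 0"
    using tendsto_min[OF e(2) tendsto_const[of "b - s"]] s by (simp add: e'_def[abs_def])
  have "\<forall>\<^sub>F n in sequentially. e n < b - s" using order_tendstoD(2)[OF e(2)] s by simp
  then have ev: "\<forall>\<^sub>F n in sequentially. e' n = e n" by eventually_elim (simp add: e'_def)
  \<comment> \<open>\<open>q n\<close> is bounded by the difference quotient of \<open>U\<close>, which varies with \<open>n\<close> but converges in
    \<open>L\<^sup>1\<close> to \<open>U' s\<close>.  So \<open>min (q n) \<bar>U' s\<bar>\<close> is treated by dominated convergence, and the rest is at
    most the distance of the difference quotient from \<open>U' s\<close>.\<close>
  define q where "q n x = \<bar>G s (s + e' n) x - F s (s + e' n) x\<bar> / e' n" for n x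
  have st: "s < s + e' n" for n using e' by simp
  note FG = FG_L1[OF st e'(2)]
  have U's: "integrable M (U' s)" using U'_int s by simp
  have qi: "integrable M (q n)" for n unfolding q_def[abs_def] using FG by simp
  have q0: "0 \<le> q n x" for n x using e'[of n] by (simp add: q_def)
  have mi: "integrable M (\<lambda>x. min (q n x) \<bar>U' s x\<bar>)" for n
    using qi[of n] U's by simp
  have lim1: "(\<lambda>n. \<integral>x. min (q n x) \<bar>U' s x\<bar> \<partial>M) \<longlonglongrightarrow> (\<integral>x. 0 \<partial>M)"
  proof (rule integral_dominated_convergence[where w="\<lambda>x. \<bar>U' s x\<bar>"])
    show "AE x in M. (\<lambda>n. min (q n x) \<bar>U' s x\<bar>) \<longlonglongrightarrow> 0"
      using AE_U'_integrable[OF order_refl, of s] AE_space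
    proof eventually_elim
      case (elim x)
      have "((\<lambda>e. \<bar>G s (s + e) x - F s (s + e) x\<bar> / e) \<longlongrightarrow> 0) (at_right 0)"
        by (rule defect_small[OF s elim(2,1) order_refl s])
      moreover have "filterlim e' (at_right 0) sequentially"
        by (simp add: filterlim_at e'0 e' less_imp_neq[OF e'(1), symmetric])
      ultimately have "(\<lambda>n. q n x) \<longlonglongrightarrow> 0" unfolding q_def by (rule filterlim_compose)
      then show ?case
        by (rule tendsto_sandwich[OF _ _ tendsto_const, rotated 2]) (use q0 in \<open>auto intro!: always_eventually\<close>)
    qed
    show "AE x in M. norm (min (q n x) \<bar>U' s x\<bar>) \<le> \<bar>U' s x\<bar>" for n using q0 by (intro AE_I2) auto
  qed (use U's mi in auto)
  have le: "(\<integral>x. q n x \<partial>M) \<le> (\<integral>x. min (q n x) \<bar>U' s x\<bar> \<partial>M) + (\<integral>x. \<bar>(U (s + e' n) x - U s x) / e' n - U' s x\<bar> \<partial>M)" for n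
  proof -
    have di: "integrable M (\<lambda>x. \<bar>(U (s + e' n) x - U s x) / e' n - U' s x\<bar>)"
    proof -
      have "integrable M (\<lambda>x. U (s + e' n) x - U s x)"
        using L1_increment(1)[OF st[of n] e'(2)[of n], of "\<lambda>_. 0" "C * exp b"] U'_bound' e'(2)[of n] by auto
      then show ?thesis using U's by simp
    qed
    have "(\<integral>x. q n x \<partial>M) \<le> (\<integral>x. min (q n x) \<bar>U' s x\<bar> + \<bar>(U (s + e' n) x - U s x) / e' n - U' s x\<bar> \<partial>M)"
    proof (rule integral_mono)
      fix x assume x: "x \<in> space M"
      have "q n x \<le> \<bar>(U (s + e' n) x - U s x) / e' n\<bar>"
        unfolding q_def using defect_abs_le[OF st e'(2) x] e'[of n] by (simp add: abs_divide divide_right_mono)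
      then show "q n x \<le> min (q n x) \<bar>U' s x\<bar> + \<bar>(U (s + e' n) x - U s x) / e' n - U' s x\<bar>" by linarith
    qed (use qi mi di in auto)
    then show ?thesis using mi di by simp
  qed
  have "(\<lambda>n. \<integral>x. q n x \<partial>M) \<longlonglongrightarrow> 0"
  proof (rule tendsto_sandwich[OF _ _ tendsto_const])
    show "(\<lambda>n. (\<integral>x. min (q n x) \<bar>U' s x\<bar> \<partial>M) + (\<integral>x. \<bar>(U (s + e' n) x - U s x) / e' n - U' s x\<bar> \<partial>M)) \<longlonglongrightarrow> 0"
      using tendsto_add[OF lim1 difference_quotient_L1[OF s e'(1) e'0 e'(2)]] by simp
  qed (use le q0 in \<open>auto intro!: always_eventually\<close>)
  moreover have "(\<integral>x. q n x \<partial>M) = defect (e' n) s" for n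
    unfolding q_def defect_def by (rule Bochner_Integration.integral_cong) (use st e' in \<open>auto simp: clamp_FG\<close>)
  ultimately have "(\<lambda>n. defect (e' n) s) \<longlonglongrightarrow> 0" by simp
  then show ?thesis
    by (rule Lim_transform_eventually) (use ev in \<open>auto elim: eventually_mono\<close>)
qed

lemma final_integrable:
  assumes "0 < e"
  shows "set_integrable lborel {a..b - e} (\<lambda>s. W1 (b - s) * (\<integral>x. G s b x \<partial>M))"
proof -
  have wb: "\<bar>W1 h\<bar> * h \<le> 1" if "0 < h" for h
    using W_le[OF that] lag_weight_pos[OF that] that by (simp_all add: field_simps abs_of_pos)
  have "integrable (lborel \<Otimes>\<^sub>M M) (\<lambda>(s, x). indicator {a..b - e} s * (W1 (b - s) * Gc s b x))"
    by (rule weighted_joint[where K=1]; use assms wb in auto)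
  from LM.integrable_fst[OF this]
  have "integrable lborel (\<lambda>s. indicator {a..b - e} s * (W1 (b - s) * (\<integral>x. Gc s b x \<partial>M)))" by simp
  then show ?thesis unfolding set_integrable_def
  proof (rule Bochner_Integration.integrable_cong[THEN iffD1, OF refl, rotated])
    fix s
    show "indicator {a..b - e} s * (W1 (b - s) * (\<integral>x. Gc s b x \<partial>M)) = indicator {a..b - e} s *\<^sub>R (W1 (b - s) * (\<integral>x. G s b x \<partial>M))"
    proof (cases "s \<in> {a..b - e}")
      case True
      then have "(\<integral>x. Gc s b x \<partial>M) = (\<integral>x. G s b x \<partial>M)"
        using assms by (intro Bochner_Integration.integral_cong) (auto simp: clamp_FG)
      then show ?thesis by simp
    qed simp
  qed
qed

lemma final_mono:
  assumes "a' \<le> a" "0 < e'" "e' \<le> e"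
  shows "(LBINT s:{a..b - e}. W1 (b - s) * (\<integral>x. G s b x \<partial>M)) \<le> (LBINT s:{a'..b - e'}. W1 (b - s) * (\<integral>x. G s b x \<partial>M))"
  unfolding set_lebesgue_integral_def
proof (rule integral_mono)
  show "integrable lborel (\<lambda>s. indicator {a..b - e} s *\<^sub>R (W1 (b - s) * (\<integral>x. G s b x \<partial>M)))"
    "integrable lborel (\<lambda>s. indicator {a'..b - e'} s *\<^sub>R (W1 (b - s) * (\<integral>x. G s b x \<partial>M)))"
    using final_integrable assms by (auto simp: set_integrable_def)
  fix s
  have "0 \<le> W1 (b - s) * (\<integral>x. G s b x \<partial>M)" if "s < b"
    using FG_nonneg(1)[of s b] lag_weight_pos[of "b - s"] that by (intro mult_nonneg_nonneg) (auto intro: less_imp_le)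
  then show "indicator {a..b - e} s *\<^sub>R (W1 (b - s) * (\<integral>x. G s b x \<partial>M)) \<le> indicator {a'..b - e'} s *\<^sub>R (W1 (b - s) * (\<integral>x. G s b x \<partial>M))"
    using assms by (auto split: split_indicator)
qed

lemma final_le:
  assumes a: "a < b" and e: "0 < e" "e < b - a"
  shows "(LBINT s:{a..b - e}. W1 (b - s) * (\<integral>x. G s b x \<partial>M)) \<le> C * exp a * (b - a)"
proof -
  define \<epsilon> where "\<epsilon> n = min e 1 / real (Suc n)" for n
  have \<epsilon>: "0 < \<epsilon> n" "\<epsilon> n \<le> e" "\<epsilon> n \<le> 1" for n
  proof -
    show "0 < \<epsilon> n" using e by (simp add: \<epsilon>_def)
    have "\<epsilon> n \<le> min e 1 / 1" unfolding \<epsilon>_def using e by (intro divide_left_mono) auto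
    then show "\<epsilon> n \<le> e" "\<epsilon> n \<le> 1" by auto
  qed
  have \<epsilon>0: "\<epsilon> \<longlonglongrightarrow> 0"
    using tendsto_mult_right[OF LIMSEQ_Suc[OF lim_1_over_n], of "min e 1"] by (simp add: \<epsilon>_def[abs_def])
  define D where "D n = (LBINT s:{a..b - \<epsilon> n}. defect (\<epsilon> n) s)" for n
  have D0: "D \<longlonglongrightarrow> (\<integral>s. 0 \<partial>(lborel :: real measure))"
    unfolding D_def[abs_def] set_lebesgue_integral_def
  proof (rule integral_dominated_convergence[where w="\<lambda>s. C * exp b * indicator {a..b} s"])
    show "AE s in lborel. (\<lambda>n. indicator {a..b - \<epsilon> n} s *\<^sub>R defect (\<epsilon> n) s) \<longlonglongrightarrow> 0"
    proof (rule AE_I2)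
      fix s :: real
      show "(\<lambda>n. indicator {a..b - \<epsilon> n} s *\<^sub>R defect (\<epsilon> n) s) \<longlonglongrightarrow> 0"
      proof (cases "s < b")
        case True
        show ?thesis
        proof (rule Lim_null_comparison[OF _ tendsto_rabs_zero[OF defect_tendsto[OF True \<epsilon>(1) \<epsilon>0]]])
          show "\<forall>\<^sub>F n in sequentially. norm (indicator {a..b - \<epsilon> n} s *\<^sub>R defect (\<epsilon> n) s) \<le> \<bar>defect (\<epsilon> n) s\<bar>"
            by (intro always_eventually) (auto split: split_indicator)
        qed
      next
        case False
        then have "s \<notin> {a..b - \<epsilon> n}" for n using \<epsilon>(1)[of n] by auto
        then show ?thesis by simp
      qed
    qed
    show "AE s in lborel. norm (indicator {a..b - \<epsilon> n} s *\<^sub>R defect (\<epsilon> n) s) \<le> C * exp b * indicator {a..b} s" for n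
    proof (rule AE_I2)
      fix s
      show "norm (indicator {a..b - \<epsilon> n} s *\<^sub>R defect (\<epsilon> n) s) \<le> C * exp b * indicator {a..b} s"
      proof (cases "s \<in> {a..b - \<epsilon> n}")
        case True
        then show ?thesis using defect_bounds[OF \<epsilon>(1)[of n], of s] \<epsilon>(1)[of n] by simp
      qed (use C_nonneg in simp)
    qed
    show "(\<lambda>s. indicator {a..b - \<epsilon> n} s *\<^sub>R defect (\<epsilon> n) s) \<in> borel_measurable lborel" for n
      using defect_measurable by measurable
  qed (use a in simp_all)
  have "(\<lambda>n. D n + \<bar>k\<bar> * exp \<bar>k\<bar> * (C * exp b * \<epsilon> n) * (b - a) + C * exp a * (b - a))
      \<longlonglongrightarrow> 0 + \<bar>k\<bar> * exp \<bar>k\<bar> * (C * exp b * 0) * (b - a) + C * exp a * (b - a)"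
    by (intro tendsto_intros \<epsilon>0) (use D0 in simp)
  moreover have "(LBINT s:{a..b - e}. W1 (b - s) * (\<integral>x. G s b x \<partial>M))
      \<le> D n + \<bar>k\<bar> * exp \<bar>k\<bar> * (C * exp b * \<epsilon> n) * (b - a) + C * exp a * (b - a)" for n
    using order_trans[OF final_mono[OF order_refl \<epsilon>(1,2)] balance[OF a \<epsilon>(1) _ \<epsilon>(3)]] \<epsilon>(2)[of n] e
    unfolding D_def by simp
  ultimately show ?thesis using LIMSEQ_le_const by fastforce
qed

text \<open>
The left side increases if the interval is extended to the left, while its bound tends to \<open>0\<close> as
the initial time tends to \<open>-\<infinity>\<close>.
\<close>

lemma final_zero:
  assumes a: "a < b" and e: "0 < e" "e < b - a"
  shows "(LBINT s:{a..b - e}. W1 (b - s) * (\<integral>x. G s b x \<partial>M)) = 0"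
proof (rule antisym)
  let ?L = "LBINT s:{a..b - e}. W1 (b - s) * (\<integral>x. G s b x \<partial>M)"
  have "((\<lambda>y. C * exp b * (y ^ 1 / exp y)) \<longlongrightarrow> C * exp b * 0) at_top"
    by (intro tendsto_mult_left tendsto_power_div_exp_0)
  moreover have "\<forall>\<^sub>F y in at_top. ?L \<le> C * exp b * (y ^ 1 / exp y)"
    using eventually_ge_at_top[of "b - a"]
  proof eventually_elim
    case (elim y)
    have "?L \<le> (LBINT s:{b - y..b - e}. W1 (b - s) * (\<integral>x. G s b x \<partial>M))"
      by (rule final_mono) (use elim e in auto)
    also have "\<dots> \<le> C * exp (b - y) * (b - (b - y))" by (rule final_le) (use elim e a in auto)
    finally show ?case by (simp add: exp_diff)
  qed
  ultimately show "?L \<le> 0" using tendsto_lowerbound[of _ _ at_top ?L] by fastforce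
  show "0 \<le> ?L"
    unfolding set_lebesgue_integral_def
    by (rule Bochner_Integration.integral_nonneg)
      (use e FG_nonneg(1) in \<open>auto intro!: mult_nonneg_nonneg less_imp_le[OF lag_weight_pos] split: split_indicator\<close>)
qed

text \<open>
The integrated violation between the times \<open>q\<close> and \<open>b\<close> vanishes for almost every \<open>q\<close>, hence along a
sequence of times that tends to \<open>s\<close>; the level is continuous in time.
\<close>

theorem comparison:
  assumes s: "s < b"
  shows "AE x in M. \<theta> * v s x \<le> \<theta> * v b x"
proof -
  define e where "e = (b - s) / 2"
  have e: "0 < e" "e < b - s" using s by (simp_all add: e_def)
  have "AE q in lborel. indicator {s..b - e} q *\<^sub>R (W1 (b - q) * (\<integral>x. G q b x \<partial>M)) = 0"
  proof (subst integral_nonneg_eq_0_iff_AE[symmetric])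
    show "integrable lborel (\<lambda>q. indicator {s..b - e} q *\<^sub>R (W1 (b - q) * (\<integral>x. G q b x \<partial>M)))"
      using final_integrable[OF e(1)] by (simp add: set_integrable_def)
    show "AE q in lborel. 0 \<le> indicator {s..b - e} q *\<^sub>R (W1 (b - q) * (\<integral>x. G q b x \<partial>M))"
      using e FG_nonneg(1) by (auto intro!: AE_I2 mult_nonneg_nonneg less_imp_le[OF lag_weight_pos] split: split_indicator)
    show "(LINT q|lborel. indicator {s..b - e} q *\<^sub>R (W1 (b - q) * (\<integral>x. G q b x \<partial>M))) = 0"
      using final_zero[OF s e] by (simp add: set_lebesgue_integral_def)
  qed
  then have ae: "AE q in lborel. q \<in> {s..b - e} \<longrightarrow> (\<integral>x. G q b x \<partial>M) = 0"
  proof eventually_elim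
    case (elim q)
    show ?case
    proof
      assume q: "q \<in> {s..b - e}"
      then have "0 < W1 (b - q)" using e by (intro lag_weight_pos) auto
      then show "(\<integral>x. G q b x \<partial>M) = 0" using elim q by simp
    qed
  qed
  have "\<exists>q. s < q \<and> q < s + e / real (Suc n) \<and> (q \<in> {s..b - e} \<longrightarrow> (\<integral>x. G q b x \<partial>M) = 0)" for n
    by (rule AE_lborel_dense[OF ae]) (use e in simp)
  then obtain q where q: "\<And>n. s < q n" "\<And>n. q n < s + e / real (Suc n)"
    "\<And>n. q n \<in> {s..b - e} \<longrightarrow> (\<integral>x. G (q n) b x \<partial>M) = 0" by metis
  have qI: "q n \<in> {s..b - e}" for n
  proof -
    have "e / real (Suc n) \<le> e / 1" using e by (intro divide_left_mono) auto
    moreover have "b - e = s + e" by (simp add: e_def field_simps)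
    ultimately show ?thesis using q(1)[of n] q(2)[of n] unfolding atLeastAtMost_iff by linarith
  qed
  have q_le: "q n \<le> b" for n using qI[of n] e by simp
  have q_lim: "q \<longlonglongrightarrow> s"
  proof (rule tendsto_sandwich[OF _ _ tendsto_const])
    show "(\<lambda>n. s + e / real (Suc n)) \<longlonglongrightarrow> s"
      using tendsto_add[OF tendsto_const[of s] tendsto_mult_right[OF LIMSEQ_Suc[OF lim_1_over_n], of e]] by simp
  qed (use q(1,2) in \<open>auto intro!: always_eventually less_imp_le\<close>)
  have "AE x in M. \<not> bad (q n) b x" for n
  proof -
    have qb: "q n < b" using qI[of n] e by auto
    have "AE x in M. G (q n) b x = 0"
    proof (subst integral_nonneg_eq_0_iff_AE[symmetric])
      show "AE x in M. 0 \<le> G (q n) b x" using G_bounds[OF qb order_refl] by (intro AE_I2) auto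
    qed (use FG_L1(2)[OF qb order_refl] q(3)[of n] qI in auto)
    with AE_space show ?thesis
    proof eventually_elim
      case (elim x)
      then show ?case using transport_bounds(7)[OF qb order_refl, of x] by (auto simp: G_def)
    qed
  qed
  then have "AE x in M. \<forall>n. \<not> bad (q n) b x" by (simp add: AE_all_countable)
  with AE_space show ?thesis
  proof eventually_elim
    case (elim x)
    have "(\<lambda>n. v (q n) x) \<longlonglongrightarrow> v s x"
      by (rule continuous_on_tendsto_compose[OF v_cont[OF elim(1)] q_lim]) (use s q_le in \<open>auto intro!: always_eventually\<close>)
    then have "(\<lambda>n. \<theta> * v (q n) x) \<longlonglongrightarrow> \<theta> * v s x" by (intro tendsto_intros)
    then show ?case
      by (rule LIMSEQ_le_const2) (use elim in \<open>auto simp: bad_def not_less algebra_simps\<close>)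
  qed
qed

end

section \<open>Classical solutions\<close>

text \<open>
Bounds for the derivative of \<open>ln \<kappa>\<close> in logarithmic time and for its Lipschitz constant.
\<close>

definition log_slope_bound :: "real \<Rightarrow> real \<Rightarrow> real" where
  "log_slope_bound L T = T * L\<^sup>2"

definition log_slope_lipschitz :: "real \<Rightarrow> real \<Rightarrow> real" where
  "log_slope_lipschitz L T = T * L\<^sup>2 + T\<^sup>2 * (L\<^sup>2 + L ^ 4)"

text \<open>
The slope of \<open>r\<close> lies within \<open>log_slope_bound L T\<close> of \<open>\<theta> \<rho>\<close>.  The summand divided by \<open>m\<close> makes the
rate \<open>\<nu>\<close> of the lag inequality at least \<open>1\<close>: up to the influence of \<open>\<kappa>\<close> this rate is \<open>m \<rho> - 1\<close>.
\<close>

definition decay_exponent :: "real \<Rightarrow> real \<Rightarrow> real \<Rightarrow> real" where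
  "decay_exponent m L T = log_slope_bound L T + log_slope_lipschitz L T + 1 + (log_slope_bound L T + 2) / m"

locale classical_setting = nonlinearity m \<theta> \<phi> + sigma_finite_measure M
  for m \<theta> :: real and \<phi> :: "real \<Rightarrow> real" and M :: "'a measure" +
  fixes L T :: real and A :: "'a l1_operator" and \<kappa> \<kappa>\<^sub>t \<kappa>\<^sub>t\<^sub>t u u\<^sub>t :: "real \<Rightarrow> 'a \<Rightarrow> real"
  assumes LT: "0 < L" "0 < T"
    and linear: "linear_operator_L1 M A" and P: "property_P M A"
    and \<kappa>_meas: "\<And>t. t \<in> {0..T} \<Longrightarrow> \<kappa> t \<in> borel_measurable M"
    and \<kappa>_deriv: "\<And>t x. t \<in> {0..T} \<Longrightarrow> x \<in> space M \<Longrightarrow> ((\<lambda>s. \<kappa> s x) has_real_derivative \<kappa>\<^sub>t t x) (at t within {0..T})"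
    and \<kappa>\<^sub>t_deriv: "\<And>t x. t \<in> {0..T} \<Longrightarrow> x \<in> space M \<Longrightarrow> ((\<lambda>s. \<kappa>\<^sub>t s x) has_real_derivative \<kappa>\<^sub>t\<^sub>t t x) (at t within {0..T})"
    and \<kappa>_bounds: "\<And>t x. t \<in> {0..T} \<Longrightarrow> x \<in> space M \<Longrightarrow>
        0 < \<kappa> t x \<and> \<kappa> t x \<le> L \<and> inverse (\<kappa> t x) \<le> L \<and> \<bar>\<kappa>\<^sub>t t x\<bar> \<le> L \<and> \<bar>\<kappa>\<^sub>t\<^sub>t t x\<bar> \<le> L"
    and u_Linf: "\<And>t. t \<in> {0..T} \<Longrightarrow> u t \<in> L1 M \<inter> Linf M"
    and u_nonneg: "\<And>t x. t \<in> {0..T} \<Longrightarrow> x \<in> space M \<Longrightarrow> 0 \<le> u t x"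
    and u_deriv: "\<And>t x. t \<in> {0..T} \<Longrightarrow> x \<in> space M \<Longrightarrow> ((\<lambda>s. u s x) has_real_derivative u\<^sub>t t x) (at t within {0..T})"
    and equation: "\<And>t. t \<in> {0..T} \<Longrightarrow> ((\<lambda>x. \<kappa> t x * \<phi> (u t x)), (\<lambda>x. - u\<^sub>t t x)) \<in> A"
    and u\<^sub>t_cont: "\<And>t. t \<in> {0<..T} \<Longrightarrow> ((\<lambda>s. norm1 M (\<lambda>x. u\<^sub>t s x - u\<^sub>t t x)) \<longlongrightarrow> 0) (at t within {0<..T})"
begin

definition w :: "real \<Rightarrow> 'a \<Rightarrow> real" where "w t x = \<kappa> t x * \<phi> (u t x)"

lemma u\<^sub>t_int: "t \<in> {0..T} \<Longrightarrow> integrable M (u\<^sub>t t)" and w_int: "t \<in> {0..T} \<Longrightarrow> integrable M (w t)"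
proof -
  assume t: "t \<in> {0..T}"
  have "A \<subseteq> L1 M \<times> L1 M" using linear by (simp add: linear_operator_L1_def)
  then have "w t \<in> L1 M" "(\<lambda>x. - u\<^sub>t t x) \<in> L1 M" using equation[OF t] by (auto simp: w_def[abs_def])
  then show "integrable M (u\<^sub>t t)" "integrable M (w t)" by (simp_all add: L1_def)
qed

lemma w_Linf: "t \<in> {0..T} \<Longrightarrow> \<exists>K. AE x in M. \<bar>w t x\<bar> \<le> K"
proof -
  assume t: "t \<in> {0..T}"
  obtain K where K: "AE x in M. \<bar>u t x\<bar> \<le> K" using u_Linf[OF t] by (auto simp: Linf_def)
  have "AE x in M. \<bar>w t x\<bar> \<le> L * \<phi> (max 0 K)"
    using K AE_space
  proof eventually_elim
    case (elim x)
    have "\<phi> (u t x) \<le> \<phi> (max 0 K)" using elim u_nonneg[OF t] by (simp add: phi_le_iff)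
    then have "\<kappa> t x * \<phi> (u t x) \<le> L * \<phi> (max 0 K)"
      using \<kappa>_bounds[OF t elim(2)] phi_nonneg[OF u_nonneg[OF t elim(2)]] LT by (intro mult_mono) auto
    moreover have "0 \<le> \<kappa> t x * \<phi> (u t x)"
      using \<kappa>_bounds[OF t elim(2)] phi_nonneg[OF u_nonneg[OF t elim(2)]] by simp
    ultimately show ?case by (simp add: w_def)
  qed
  then show ?thesis by blast
qed

text \<open>
The equation turns a combination of the levels at two times into an element of the domain whose
image is the combination of the time derivatives, and property (P) applies to it.
\<close>

lemma half_space_test:
  assumes s: "s \<in> {0..T}" and t: "t \<in> {0..T}"
  shows "0 \<le> (\<integral>x. (if \<theta> * (p * w t x - q * w s x) < 0 then \<theta> * (p * u\<^sub>t t x - q * u\<^sub>t s x) else 0) \<partial>M)"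
proof -
  define f where "f x = (\<theta> * p) * w t x + (- \<theta> * q) * w s x" for x
  define g where "g x = (\<theta> * p) * (- u\<^sub>t t x) + (- \<theta> * q) * (- u\<^sub>t s x)" for x
  \<comment> \<open>The Heaviside graph of the negative half-line, with the value \<open>0\<close> at the origin.\<close>
  define \<beta> where "\<beta> = {(a, b :: real). (a < (0::real) \<and> b = -1) \<or> (0 \<le> a \<and> b = 0)}"
  define h where "h x = (if f x < 0 then -1 else 0 :: real)" for x
  have scale: "\<And>c f g. (f, g) \<in> A \<Longrightarrow> ((\<lambda>x. c * f x), (\<lambda>x. c * g x)) \<in> A"
    and add: "\<And>f g f' g'. (f, g) \<in> A \<Longrightarrow> (f', g') \<in> A \<Longrightarrow> ((\<lambda>x. f x + f' x), (\<lambda>x. g x + g' x)) \<in> A"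
    using linear unfolding linear_operator_L1_def by (elim conjE; metis)+
  have fg: "(f, g) \<in> A"
    using add[OF scale[OF equation[OF t], of "\<theta> * p"] scale[OF equation[OF s], of "- \<theta> * q"]]
    by (simp add: f_def[abs_def] g_def[abs_def] w_def)
  have fi: "integrable M f" unfolding f_def[abs_def] using w_int[OF t] w_int[OF s] by simp
  have gi: "integrable M g" unfolding g_def[abs_def] using u\<^sub>t_int[OF t] u\<^sub>t_int[OF s] by simp
  have f_bdd: "f \<in> L1 M \<inter> Linf M"
  proof -
    obtain K K' where K: "AE x in M. \<bar>w t x\<bar> \<le> K" "AE x in M. \<bar>w s x\<bar> \<le> K'" using w_Linf s t by blast
    have "AE x in M. \<bar>f x\<bar> \<le> \<bar>\<theta> * p\<bar> * K + \<bar>- \<theta> * q\<bar> * K'"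
      using K
    proof eventually_elim
      case (elim x)
      have "\<bar>f x\<bar> \<le> \<bar>\<theta> * p\<bar> * \<bar>w t x\<bar> + \<bar>- \<theta> * q\<bar> * \<bar>w s x\<bar>" 
        unfolding f_def abs_mult[symmetric] by (rule abs_triangle_ineq)
      also have "\<dots> \<le> \<bar>\<theta> * p\<bar> * K + \<bar>- \<theta> * q\<bar> * K'" using elim by (intro add_mono mult_left_mono) auto
      finally show ?case .
    qed
    then show ?thesis using fi by (auto simp: L1_def Linf_def)
  qed
  have hm: "h \<in> borel_measurable M" unfolding h_def[abs_def] using fi by measurable
  have hg: "integrable M (\<lambda>x. h x * g x)"
  proof (rule Bochner_Integration.integrable_bound[OF gi])
    show "(\<lambda>x. h x * g x) \<in> borel_measurable M" using hm gi by simp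
  qed (simp add: h_def)
  have "0 \<le> (\<integral>x. h x * g x \<partial>M)"
  proof (rule P[unfolded property_P_def, rule_format])
    show "f \<in> L1 M \<inter> Linf M \<and> (f, g) \<in> A \<and> monotone_graph \<beta> \<and> (0, 0) \<in> \<beta> \<and> h \<in> borel_measurable M \<and>
        (AE x in M. (f x, h x) \<in> \<beta>) \<and> integrable M (\<lambda>x. h x * g x)"
    proof (intro conjI)
      show "monotone_graph \<beta>"
        by (auto simp: monotone_graph_def \<beta>_def intro: mult_nonneg_nonneg mult_nonpos_nonpos)
      show "AE x in M. (f x, h x) \<in> \<beta>" by (intro AE_I2) (simp add: \<beta>_def h_def)
    qed (use f_bdd fg hm hg in \<open>simp_all add: \<beta>_def\<close>)
  qed
  also have "(\<integral>x. h x * g x \<partial>M) = (\<integral>x. (if \<theta> * (p * w t x - q * w s x) < 0 then \<theta> * (p * u\<^sub>t t x - q * u\<^sub>t s x) else 0) \<partial>M)"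
    by (rule Bochner_Integration.integral_cong) (auto simp: h_def f_def g_def algebra_simps)
  finally show ?thesis .
qed

abbreviation C\<^sub>1 :: real where "C\<^sub>1 \<equiv> log_slope_bound L T"
abbreviation C\<^sub>2 :: real where "C\<^sub>2 \<equiv> log_slope_lipschitz L T"
abbreviation \<rho> :: real where "\<rho> \<equiv> decay_exponent m L T"

lemma C_nonneg: "0 \<le> C\<^sub>1" "0 \<le> C\<^sub>2"
  using LT by (auto simp: log_slope_bound_def log_slope_lipschitz_def)

lemma \<rho>_bounds: "1 \<le> \<rho> - C\<^sub>1" "C\<^sub>2 \<le> \<rho> - C\<^sub>1" "C\<^sub>1 + 2 \<le> m * (\<rho> - C\<^sub>1)"
proof -
  have "0 \<le> (C\<^sub>1 + 2) / m" using C_nonneg m by simp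
  then show "1 \<le> \<rho> - C\<^sub>1" "C\<^sub>2 \<le> \<rho> - C\<^sub>1" using C_nonneg by (simp_all add: decay_exponent_def)
  have "m * (\<rho> - C\<^sub>1) = m * (C\<^sub>2 + 1) + (C\<^sub>1 + 2)" using m by (simp add: decay_exponent_def field_simps)
  then show "C\<^sub>1 + 2 \<le> m * (\<rho> - C\<^sub>1)" using m C_nonneg by simp
qed

text \<open>
In the logarithmic time \<open>\<sigma>\<close> with \<open>t = s\<^sub>0 + exp \<sigma>\<close> the power of the elapsed time becomes an exponential,
and the derivative of the solution picks up the factor \<open>exp \<sigma>\<close>, whence the exponent
\<open>k = \<theta> \<rho> - 1\<close>.  The shift by \<open>s\<^sub>0 > 0\<close> keeps \<open>u\<^sub>t\<close> bounded in \<open>L\<^sup>1\<close> near the initial time.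
\<close>

lemma shifted_comparison:
  assumes s0: "0 < s\<^sub>0" "s\<^sub>0 < t\<^sub>0" and t: "t\<^sub>0 < t\<^sub>1" "t\<^sub>1 \<le> T"
  shows "AE x in M. \<theta> * ((t\<^sub>0 - s\<^sub>0) powr (\<theta> * \<rho>) * w t\<^sub>0 x) \<le> \<theta> * ((t\<^sub>1 - s\<^sub>0) powr (\<theta> * \<rho>) * w t\<^sub>1 x)"
proof -
  define \<tau> where "\<tau> \<sigma> = s\<^sub>0 + exp \<sigma>" for \<sigma>
  define b where "b = ln (t\<^sub>1 - s\<^sub>0)"
  have \<tau>_le: "\<tau> \<sigma> \<le> t\<^sub>1" if "\<sigma> \<le> b" for \<sigma>
  proof -
    have "exp \<sigma> \<le> exp b" using that by simp
    also have "\<dots> = t\<^sub>1 - s\<^sub>0" using s0 t by (simp add: b_def)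
    finally show ?thesis by (simp add: \<tau>_def)
  qed
  have \<tau>_gt: "s\<^sub>0 < \<tau> \<sigma>" for \<sigma> by (simp add: \<tau>_def)
  have \<tau>I: "\<tau> \<sigma> \<in> {0..T}" "\<tau> \<sigma> \<in> {0<..T}" "\<tau> \<sigma> \<in> {s\<^sub>0..T}" if "\<sigma> \<le> b" for \<sigma>
    using \<tau>_le[OF that] \<tau>_gt[of \<sigma>] s0 t by auto
  have exp_le: "exp \<sigma> \<le> T" if "\<sigma> \<le> b" for \<sigma> using \<tau>_le[OF that] s0 t by (simp add: \<tau>_def)
  have \<tau>_deriv: "(\<tau> has_real_derivative exp \<sigma>) (at \<sigma> within S)" for \<sigma> S
    unfolding \<tau>_def[abs_def] by (auto intro!: derivative_eq_intros)
  have chain: "((\<lambda>s. f (\<tau> s)) has_real_derivative D * exp \<sigma>) (at \<sigma> within {..b})"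
    if "(f has_real_derivative D) (at (\<tau> \<sigma>) within {0..T})" "\<sigma> \<le> b" for f :: "real \<Rightarrow> real" and D \<sigma>
  proof -
    have "\<tau> ` {..b} \<subseteq> {0..T}" using \<tau>I(1) by auto
    then have "(f has_real_derivative D) (at (\<tau> \<sigma>) within \<tau> ` {..b})" by (rule DERIV_subset[OF that(1)])
    from DERIV_image_chain[OF this \<tau>_deriv] show ?thesis by (simp add: o_def)
  qed
  define U where "U \<sigma> x = u (\<tau> \<sigma>) x" for \<sigma> x
  define U' where "U' \<sigma> x = exp \<sigma> * u\<^sub>t (\<tau> \<sigma>) x" for \<sigma> x
  define r where "r \<sigma> x = \<theta> * \<rho> * \<sigma> + ln (\<kappa> (\<tau> \<sigma>) x)" for \<sigma> x
  \<comment> \<open>\<open>c\<close> is the derivative of \<open>ln \<kappa>\<close> with respect to \<open>\<sigma>\<close>.\<close>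
  define c where "c \<sigma> x = exp \<sigma> * \<kappa>\<^sub>t (\<tau> \<sigma>) x / \<kappa> (\<tau> \<sigma>) x" for \<sigma> x
  define r' where "r' \<sigma> x = \<theta> * \<rho> + c \<sigma> x" for \<sigma> x
  define k where "k = \<theta> * \<rho> - 1"
  \<comment> \<open>The last two summands give \<open>1 \<le> \<beta> + k\<close>, which controls the start of the time axis.\<close>
  define \<beta> where "\<beta> = (1 + m) * (\<rho> + C\<^sub>1) + C\<^sub>2 * (2 + m) + \<rho> + 2"
  have \<rho>0: "0 \<le> \<rho>" using \<rho>_bounds(1) C_nonneg by linarith
  have u_norm: "continuous_on {s\<^sub>0..T} (\<lambda>t. \<integral>x. \<bar>u\<^sub>t t x\<bar> \<partial>M)"
    unfolding continuous_on
  proof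
    fix t assume t': "t \<in> {s\<^sub>0..T}"
    have "((\<lambda>s. norm1 M (\<lambda>x. u\<^sub>t s x - u\<^sub>t t x)) \<longlongrightarrow> 0) (at t within {s\<^sub>0..T})"
      by (rule tendsto_within_subset[OF u\<^sub>t_cont]) (use t' s0 in auto)
    then have "((\<lambda>s. (\<integral>x. \<bar>u\<^sub>t s x\<bar> \<partial>M) - (\<integral>x. \<bar>u\<^sub>t t x\<bar> \<partial>M)) \<longlongrightarrow> 0) (at t within {s\<^sub>0..T})"
    proof (rule Lim_null_comparison[rotated])
      show "\<forall>\<^sub>F s in at t within {s\<^sub>0..T}. norm ((\<integral>x. \<bar>u\<^sub>t s x\<bar> \<partial>M) - (\<integral>x. \<bar>u\<^sub>t t x\<bar> \<partial>M)) \<le> norm1 M (\<lambda>x. u\<^sub>t s x - u\<^sub>t t x)"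
        unfolding eventually_at_filter
      proof (intro always_eventually allI impI)
        fix s assume "s \<noteq> t" "s \<in> {s\<^sub>0..T}"
        then have i: "integrable M (u\<^sub>t s)" "integrable M (u\<^sub>t t)" using u\<^sub>t_int t' s0 by auto
        have "(\<integral>x. \<bar>u\<^sub>t s x\<bar> \<partial>M) - (\<integral>x. \<bar>u\<^sub>t t x\<bar> \<partial>M) = (\<integral>x. \<bar>u\<^sub>t s x\<bar> - \<bar>u\<^sub>t t x\<bar> \<partial>M)" using i by simp
        also have "norm \<dots> \<le> (\<integral>x. norm (\<bar>u\<^sub>t s x\<bar> - \<bar>u\<^sub>t t x\<bar>) \<partial>M)" by (rule integral_norm_bound)
        also have "\<dots> \<le> (\<integral>x. \<bar>u\<^sub>t s x - u\<^sub>t t x\<bar> \<partial>M)" using i by (intro integral_mono) auto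
        finally show "norm ((\<integral>x. \<bar>u\<^sub>t s x\<bar> \<partial>M) - (\<integral>x. \<bar>u\<^sub>t t x\<bar> \<partial>M)) \<le> norm1 M (\<lambda>x. u\<^sub>t s x - u\<^sub>t t x)"
          by (simp add: norm1_def)
      qed
    qed
    then show "((\<lambda>s. \<integral>x. \<bar>u\<^sub>t s x\<bar> \<partial>M) \<longlongrightarrow> (\<integral>x. \<bar>u\<^sub>t t x\<bar> \<partial>M)) (at t within {s\<^sub>0..T})" by (simp add: LIM_zero_iff)
  qed
  obtain C where C: "\<And>t. t \<in> {s\<^sub>0..T} \<Longrightarrow> (\<integral>x. \<bar>u\<^sub>t t x\<bar> \<partial>M) \<le> C"
  proof -
    obtain C where "\<forall>t\<in>{s\<^sub>0..T}. \<bar>\<integral>x. \<bar>u\<^sub>t t x\<bar> \<partial>M\<bar> \<le> C"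
      using compact_imp_bounded[OF compact_continuous_image[OF u_norm compact_Icc]] by (auto simp: bounded_iff)
    then show ?thesis using that by force
  qed
  have c_bound: "\<bar>c \<sigma> x\<bar> \<le> C\<^sub>1" if "\<sigma> \<le> b" "x \<in> space M" for \<sigma> x
  proof -
    note K = \<kappa>_bounds[OF \<tau>I(1)[OF that(1)] that(2)]
    have "\<bar>c \<sigma> x\<bar> = exp \<sigma> * (\<bar>\<kappa>\<^sub>t (\<tau> \<sigma>) x\<bar> * inverse (\<kappa> (\<tau> \<sigma>) x))"
      using K by (simp add: c_def abs_mult abs_divide divide_inverse)
    also have "\<dots> \<le> T * (L * L)"
      using K exp_le[OF that(1)] LT by (intro mult_mono) auto
    finally show ?thesis by (simp add: log_slope_bound_def power2_eq_square)
  qed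
  have c_deriv: "\<exists>D. ((\<lambda>\<sigma>. c \<sigma> x) has_real_derivative D) (at \<sigma> within {..b}) \<and> \<bar>D\<bar> \<le> C\<^sub>2" if "\<sigma> \<le> b" "x \<in> space M" for \<sigma> x
  proof -
    note K = \<kappa>_bounds[OF \<tau>I(1)[OF that(1)] that(2)]
    let ?k = "\<kappa> (\<tau> \<sigma>) x" and ?k1 = "\<kappa>\<^sub>t (\<tau> \<sigma>) x" and ?k2 = "\<kappa>\<^sub>t\<^sub>t (\<tau> \<sigma>) x" and ?e = "exp \<sigma>"
    note d1 = chain[OF \<kappa>_deriv[OF \<tau>I(1)[OF that(1)] that(2)] that(1)]
    note d2 = chain[OF \<kappa>\<^sub>t_deriv[OF \<tau>I(1)[OF that(1)] that(2)] that(1)]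
    define D where "D = ?e * (?k1 * inverse ?k) + ?e * ?e * (?k2 * inverse ?k - (?k1 * ?k1) * (inverse ?k * inverse ?k))"
    have "((\<lambda>\<sigma>. c \<sigma> x) has_real_derivative D) (at \<sigma> within {..b})"
    proof -
      have arith: "((e * k1 + (k2 * e) * e) * k - (e * k1) * (k1 * e)) / (k * k)
          = e * (k1 * inverse k) + e * e * (k2 * inverse k - (k1 * k1) * (inverse k * inverse k))"
        if "k \<noteq> 0" for e k k1 k2 :: real
        using that by (simp add: field_simps)
      have "?k \<noteq> 0" using K by simp
      from DERIV_divide[OF DERIV_mult[OF DERIV_subset[OF DERIV_exp subset_UNIV] d2] d1 this]
      show ?thesis unfolding c_def D_def by (rule DERIV_cong) (rule arith[OF \<open>?k \<noteq> 0\<close>])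
    qed
    moreover have "\<bar>D\<bar> \<le> C\<^sub>2"
    proof -
      have i: "0 \<le> inverse ?k" "inverse ?k \<le> L" using K by auto
      have e: "0 \<le> ?e" "?e \<le> T" using exp_le[OF that(1)] by auto
      have 1: "\<bar>?e * (?k1 * inverse ?k)\<bar> \<le> T * (L * L)"
        unfolding abs_mult using K i e LT by (intro mult_mono) auto
      have 2: "\<bar>?k2 * inverse ?k\<bar> \<le> L * L" unfolding abs_mult using K i LT by (intro mult_mono) auto
      have 3: "\<bar>(?k1 * ?k1) * (inverse ?k * inverse ?k)\<bar> \<le> (L * L) * (L * L)"
        unfolding abs_mult using K i LT by (intro mult_mono) auto
      have 4: "\<bar>?k2 * inverse ?k - (?k1 * ?k1) * (inverse ?k * inverse ?k)\<bar> \<le> L * L + (L * L) * (L * L)"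
        using 2 3 by linarith
      have "\<bar>?e * ?e * (?k2 * inverse ?k - (?k1 * ?k1) * (inverse ?k * inverse ?k))\<bar> \<le> (T * T) * (L * L + (L * L) * (L * L))"
        unfolding abs_mult[of "?e * ?e"] by (rule mult_mono[OF _ 4]) (use e LT in \<open>auto intro!: mult_mono\<close>)
      with 1 have "\<bar>D\<bar> \<le> T * (L * L) + (T * T) * (L * L + (L * L) * (L * L))" unfolding D_def by linarith
      then show ?thesis by (simp add: log_slope_lipschitz_def power2_eq_square power4_eq_xxxx mult.assoc)
    qed
    ultimately show ?thesis by blast
  qed
  have lev: "\<phi> (U \<sigma> x) * exp (r \<sigma> x) = exp (\<theta> * \<rho> * \<sigma>) * w (\<tau> \<sigma>) x" if "\<sigma> \<le> b" "x \<in> space M" for \<sigma> x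
    using \<kappa>_bounds[OF \<tau>I(1)[OF that(1)] that(2)] by (simp add: U_def r_def w_def exp_add)
  interpret E: degenerate_evolution m \<theta> \<phi> M k \<beta> b C C\<^sub>2 "\<rho> - C\<^sub>1" "\<rho> + C\<^sub>1" U U' r r'
  proof
    fix t assume t: "t \<le> b"
    note tI = \<tau>I[OF t]
    show "U t \<in> borel_measurable M" using u_Linf[OF tI(1)] by (simp add: U_def[abs_def] Linf_def)
    show "r t \<in> borel_measurable M" using \<kappa>_meas[OF tI(1)] unfolding r_def[abs_def] by measurable
    show "integrable M (U' t)" using u\<^sub>t_int[OF tI(1)] by (simp add: U'_def[abs_def])
    have "(\<integral>x. \<bar>U' t x\<bar> \<partial>M) = exp t * (\<integral>x. \<bar>u\<^sub>t (\<tau> t) x\<bar> \<partial>M)" by (simp add: U'_def abs_mult)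
    also have "\<dots> \<le> exp t * C" using C[OF tI(3)] by simp
    finally show "(\<integral>x. \<bar>U' t x\<bar> \<partial>M) \<le> C * exp t" by (simp add: mult.commute)
    show "((\<lambda>s. \<integral>x. \<bar>U' s x - U' t x\<bar> \<partial>M) \<longlongrightarrow> 0) (at t within {..b})"
    proof (rule Lim_null_comparison)
      have "filterlim \<tau> (at (\<tau> t) within {0<..T}) (at t within {..b})"
        unfolding filterlim_at
      proof
        show "\<forall>\<^sub>F x in at t within {..b}. \<tau> x \<in> {0<..T} \<and> \<tau> x \<noteq> \<tau> t"
          unfolding eventually_at_filter using \<tau>I(2) by (intro always_eventually) (auto simp: \<tau>_def)
        show "(\<tau> \<longlongrightarrow> \<tau> t) (at t within {..b})" unfolding \<tau>_def by (intro tendsto_intros)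
      qed
      from filterlim_compose[OF u\<^sub>t_cont[OF tI(2)] this]
      have l1: "((\<lambda>s. norm1 M (\<lambda>x. u\<^sub>t (\<tau> s) x - u\<^sub>t (\<tau> t) x)) \<longlongrightarrow> 0) (at t within {..b})" .
      have "((\<lambda>s. exp s * norm1 M (\<lambda>x. u\<^sub>t (\<tau> s) x - u\<^sub>t (\<tau> t) x) + \<bar>exp s - exp t\<bar> * (\<integral>x. \<bar>u\<^sub>t (\<tau> t) x\<bar> \<partial>M))
          \<longlongrightarrow> exp t * 0 + \<bar>exp t - exp t\<bar> * (\<integral>x. \<bar>u\<^sub>t (\<tau> t) x\<bar> \<partial>M)) (at t within {..b})"
        by (intro tendsto_intros l1)
      then show "((\<lambda>s. exp s * norm1 M (\<lambda>x. u\<^sub>t (\<tau> s) x - u\<^sub>t (\<tau> t) x) + \<bar>exp s - exp t\<bar> * (\<integral>x. \<bar>u\<^sub>t (\<tau> t) x\<bar> \<partial>M)) \<longlongrightarrow> 0) (at t within {..b})"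
        by simp
      show "\<forall>\<^sub>F s in at t within {..b}. norm (\<integral>x. \<bar>U' s x - U' t x\<bar> \<partial>M)
          \<le> exp s * norm1 M (\<lambda>x. u\<^sub>t (\<tau> s) x - u\<^sub>t (\<tau> t) x) + \<bar>exp s - exp t\<bar> * (\<integral>x. \<bar>u\<^sub>t (\<tau> t) x\<bar> \<partial>M)"
        unfolding eventually_at_filter
      proof (intro always_eventually allI impI)
        fix s assume "s \<noteq> t" "s \<in> {..b}"
        then have i: "integrable M (u\<^sub>t (\<tau> s))" "integrable M (u\<^sub>t (\<tau> t))" using u\<^sub>t_int \<tau>I(1) t by auto
        have "(\<integral>x. \<bar>U' s x - U' t x\<bar> \<partial>M) \<le> (\<integral>x. exp s * \<bar>u\<^sub>t (\<tau> s) x - u\<^sub>t (\<tau> t) x\<bar> + \<bar>exp s - exp t\<bar> * \<bar>u\<^sub>t (\<tau> t) x\<bar> \<partial>M)"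
        proof (rule integral_mono)
          fix x
          have "U' s x - U' t x = exp s * (u\<^sub>t (\<tau> s) x - u\<^sub>t (\<tau> t) x) + (exp s - exp t) * u\<^sub>t (\<tau> t) x"
            by (simp add: U'_def algebra_simps)
          then show "\<bar>U' s x - U' t x\<bar> \<le> exp s * \<bar>u\<^sub>t (\<tau> s) x - u\<^sub>t (\<tau> t) x\<bar> + \<bar>exp s - exp t\<bar> * \<bar>u\<^sub>t (\<tau> t) x\<bar>"
            using abs_triangle_ineq[of "exp s * (u\<^sub>t (\<tau> s) x - u\<^sub>t (\<tau> t) x)" "(exp s - exp t) * u\<^sub>t (\<tau> t) x"]
            by (simp add: abs_mult)
        qed (use i in \<open>auto simp: U'_def[abs_def]\<close>)
        also have "\<dots> = exp s * norm1 M (\<lambda>x. u\<^sub>t (\<tau> s) x - u\<^sub>t (\<tau> t) x) + \<bar>exp s - exp t\<bar> * (\<integral>x. \<bar>u\<^sub>t (\<tau> t) x\<bar> \<partial>M)"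
          using i by (simp add: norm1_def)
        finally show "norm (\<integral>x. \<bar>U' s x - U' t x\<bar> \<partial>M)
          \<le> exp s * norm1 M (\<lambda>x. u\<^sub>t (\<tau> s) x - u\<^sub>t (\<tau> t) x) + \<bar>exp s - exp t\<bar> * (\<integral>x. \<bar>u\<^sub>t (\<tau> t) x\<bar> \<partial>M)"
          by simp
      qed
    qed
    fix x assume x: "x \<in> space M"
    show "0 \<le> U t x" using u_nonneg[OF tI(1) x] by (simp add: U_def)
    show "((\<lambda>s. U s x) has_real_derivative U' t x) (at t within {..b})"
      using chain[OF u_deriv[OF tI(1) x] t] by (simp add: U_def U'_def mult.commute)
    show "((\<lambda>s. r s x) has_real_derivative r' t x) (at t within {..b})"
    proof -
      have 1: "((\<lambda>s. \<theta> * \<rho> * s) has_real_derivative \<theta> * \<rho>) (at t within {..b})"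
        by (auto intro!: derivative_eq_intros)
      have "0 < \<kappa> (\<tau> t) x" using \<kappa>_bounds[OF tI(1) x] by simp
      note 2 = DERIV_chain2[OF DERIV_ln_divide[OF this] chain[OF \<kappa>_deriv[OF tI(1) x] t]]
      show ?thesis
        unfolding r_def r'_def c_def by (rule DERIV_cong[OF DERIV_add[OF 1 2]]) (simp add: mult.commute)
    qed
    have "\<theta> * r' t x = \<rho> + \<theta> * c t x" by (simp add: r'_def algebra_simps)
    moreover have "\<bar>\<theta> * c t x\<bar> \<le> C\<^sub>1" using c_bound[OF t x] by (simp add: abs_mult)
    ultimately show "\<rho> - C\<^sub>1 \<le> \<theta> * r' t x \<and> \<theta> * r' t x \<le> \<rho> + C\<^sub>1" by linarith
  next
    fix s t x assume st: "s \<le> b" "t \<le> b" and x: "x \<in> space M"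
    have "\<forall>\<sigma>\<in>{..b}. \<exists>D. ((\<lambda>\<sigma>. c \<sigma> x) has_real_derivative D) (at \<sigma> within {..b}) \<and> \<bar>D\<bar> \<le> C\<^sub>2"
      using c_deriv[OF _ x] by simp
    from bchoice[OF this] obtain D
      where D: "\<forall>\<sigma>\<in>{..b}. ((\<lambda>\<sigma>. c \<sigma> x) has_real_derivative D \<sigma>) (at \<sigma> within {..b}) \<and> \<bar>D \<sigma>\<bar> \<le> C\<^sub>2" ..
    have "norm (c s x - c t x) \<le> C\<^sub>2 * norm (s - t)"
      by (rule field_differentiable_bound[of "{..b}" "\<lambda>\<sigma>. c \<sigma> x" D]) (use D st in auto)
    then show "\<bar>r' s x - r' t x\<bar> \<le> C\<^sub>2 * \<bar>s - t\<bar>" by (simp add: r'_def)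
  next
    have nn: "0 \<le> (1 + m) * (\<rho> + C\<^sub>1)" "0 \<le> C\<^sub>2 * (2 + m)" using m \<rho>0 C_nonneg by auto
    show "1 \<le> \<rho> - C\<^sub>1" "0 \<le> C\<^sub>2" "C\<^sub>2 \<le> \<rho> - C\<^sub>1" by (fact \<rho>_bounds C_nonneg)+
    show "(1 + m) * (\<rho> + C\<^sub>1) + C\<^sub>2 * (2 + m) \<le> \<beta>" using \<rho>0 by (simp add: \<beta>_def)
    have "- \<rho> \<le> \<theta> * \<rho>" using \<theta> \<rho>0 by auto
    then show "1 \<le> \<beta> + k" "0 \<le> \<beta>" using nn \<rho>0 by (simp_all add: \<beta>_def k_def)
  next
    fix D assume D: "\<rho> - C\<^sub>1 \<le> D" "D \<le> \<rho> + C\<^sub>1"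
    have "\<bar>\<theta> * (\<rho> - D)\<bar> \<le> C\<^sub>1" using D by (simp add: abs_mult abs_le_iff)
    moreover have "m * (\<rho> - C\<^sub>1) \<le> m * D" using D m by simp
    moreover have "k - (\<theta> - m) * D = \<theta> * (\<rho> - D) - 1 + m * D" by (simp add: k_def algebra_simps)
    ultimately show "1 \<le> k - (\<theta> - m) * D" using \<rho>_bounds(3) by linarith
  next
    fix s t assume st: "s < t" "t \<le> b"
    have "0 \<le> (\<integral>x. (if \<theta> * (exp (\<theta> * \<rho> * t) * w (\<tau> t) x - exp (\<theta> * \<rho> * s) * w (\<tau> s) x) < 0
        then \<theta> * (exp (\<theta> * \<rho> * t) * u\<^sub>t (\<tau> t) x - exp (\<theta> * \<rho> * s) * u\<^sub>t (\<tau> s) x) else 0) \<partial>M)"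
      by (rule half_space_test) (use \<tau>I(1) st in auto)
    also have "\<dots> = (\<integral>x. (if \<theta> * (\<phi> (U t x) * exp (r t x) - \<phi> (U s x) * exp (r s x)) < 0
          then \<theta> * (exp (k * t) * U' t x - exp (k * s) * U' s x) else 0) \<partial>M)"
    proof (rule Bochner_Integration.integral_cong[OF refl])
      fix x assume x: "x \<in> space M"
      have "exp (k * q) * U' q x = exp (\<theta> * \<rho> * q) * u\<^sub>t (\<tau> q) x" for q
        by (simp add: k_def U'_def left_diff_distrib exp_diff)
      then show "(if \<theta> * (exp (\<theta> * \<rho> * t) * w (\<tau> t) x - exp (\<theta> * \<rho> * s) * w (\<tau> s) x) < 0
        then \<theta> * (exp (\<theta> * \<rho> * t) * u\<^sub>t (\<tau> t) x - exp (\<theta> * \<rho> * s) * u\<^sub>t (\<tau> s) x) else 0)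
        = (if \<theta> * (\<phi> (U t x) * exp (r t x) - \<phi> (U s x) * exp (r s x)) < 0
          then \<theta> * (exp (k * t) * U' t x - exp (k * s) * U' s x) else 0)"
        using lev[OF st(2) x] lev[of s x] st x by simp
    qed
    finally show "0 \<le> (\<integral>x. (if \<theta> * (\<phi> (U t x) * exp (r t x) - \<phi> (U s x) * exp (r s x)) < 0
          then \<theta> * (exp (k * t) * U' t x - exp (k * s) * U' s x) else 0) \<partial>M)" .
  qed
  define a where "a = ln (t\<^sub>0 - s\<^sub>0)"
  have a: "a < b" using s0 t by (simp add: a_def b_def)
  have \<tau>ab: "\<tau> a = t\<^sub>0" "\<tau> b = t\<^sub>1" using s0 t by (simp_all add: \<tau>_def a_def b_def)
  have pw: "exp (\<theta> * \<rho> * a) = (t\<^sub>0 - s\<^sub>0) powr (\<theta> * \<rho>)" "exp (\<theta> * \<rho> * b) = (t\<^sub>1 - s\<^sub>0) powr (\<theta> * \<rho>)"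
    using s0 t by (simp_all add: a_def b_def powr_def)
  show ?thesis
    using E.comparison[OF a] AE_space
  proof eventually_elim
    case (elim x)
    then show ?case using lev[of a x] lev[of b x] a by (simp add: E.v_def \<tau>ab pw)
  qed
qed

end

context classical_setting
begin

lemma w_nonneg: "t \<in> {0..T} \<Longrightarrow> x \<in> space M \<Longrightarrow> 0 \<le> w t x"
  using \<kappa>_bounds[of t x] phi_nonneg[OF u_nonneg[of t x]] by (simp add: w_def)

lemma w_cont: "x \<in> space M \<Longrightarrow> continuous_on {0..T} (\<lambda>t. w t x)"
  unfolding w_def
  by (intro continuous_intros continuous_on_compose2[OF phi_cont] DERIV_continuous_on[OF \<kappa>_deriv] DERIV_continuous_on[OF u_deriv])
    (auto simp: u_nonneg)

lemma comparison_pair: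
  assumes t: "0 < t\<^sub>0" "t\<^sub>0 < t\<^sub>1" "t\<^sub>1 \<le> T"
  shows "AE x in M. \<theta> * (t\<^sub>0 powr (\<theta> * \<rho>) * w t\<^sub>0 x) \<le> \<theta> * (t\<^sub>1 powr (\<theta> * \<rho>) * w t\<^sub>1 x)"
proof -
  define s where "s n = t\<^sub>0 / real (Suc (Suc n))" for n
  have s: "0 < s n" "s n < t\<^sub>0" for n
  proof -
    show "0 < s n" using t by (simp add: s_def)
    have "s n < t\<^sub>0 / 1" unfolding s_def using t by (intro divide_strict_left_mono) auto
    then show "s n < t\<^sub>0" by simp
  qed
  have s0: "s \<longlonglongrightarrow> 0"
    using tendsto_mult_right[OF LIMSEQ_Suc[OF LIMSEQ_Suc[OF lim_1_over_n]], of t\<^sub>0] by (simp add: s_def[abs_def])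
  have "AE x in M. \<forall>n. \<theta> * ((t\<^sub>0 - s n) powr (\<theta> * \<rho>) * w t\<^sub>0 x) \<le> \<theta> * ((t\<^sub>1 - s n) powr (\<theta> * \<rho>) * w t\<^sub>1 x)"
    unfolding AE_all_countable using shifted_comparison[OF s t(2,3)] by blast
  then show ?thesis
  proof eventually_elim
    case (elim x)
    have "(\<lambda>n. \<theta> * ((t - s n) powr (\<theta> * \<rho>) * w t x)) \<longlonglongrightarrow> \<theta> * ((t - 0) powr (\<theta> * \<rho>) * w t x)" if "0 < t" for t
      by (intro tendsto_intros s0) (use that in auto)
    from this[of t\<^sub>0] this[of t\<^sub>1] show ?case
      using t elim by (intro LIMSEQ_le[where X="\<lambda>n. \<theta> * ((t\<^sub>0 - s n) powr (\<theta> * \<rho>) * w t\<^sub>0 x)"]) auto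
  qed
qed

text \<open>
The exceptional null set is made independent of the two times by passing through rational times.
\<close>

lemma comparison_all:
  "AE x in M. \<forall>t\<^sub>0 t\<^sub>1. 0 < t\<^sub>0 \<longrightarrow> t\<^sub>0 < t\<^sub>1 \<longrightarrow> t\<^sub>1 \<le> T \<longrightarrow>
     \<theta> * (t\<^sub>0 powr (\<theta> * \<rho>) * w t\<^sub>0 x) \<le> \<theta> * (t\<^sub>1 powr (\<theta> * \<rho>) * w t\<^sub>1 x)"
proof -
  define g where "g t x = \<theta> * (t powr (\<theta> * \<rho>) * w t x)" for t x
  have "AE x in M. \<forall>p q :: rat. 0 < real_of_rat p \<longrightarrow> real_of_rat p < real_of_rat q \<longrightarrow> real_of_rat q \<le> T \<longrightarrow>
      g (real_of_rat p) x \<le> g (real_of_rat q) x"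
    unfolding AE_all_countable
  proof (intro allI)
    fix p q :: rat
    show "AE x in M. 0 < real_of_rat p \<longrightarrow> real_of_rat p < real_of_rat q \<longrightarrow> real_of_rat q \<le> T \<longrightarrow>
      g (real_of_rat p) x \<le> g (real_of_rat q) x"
      using comparison_pair[of "real_of_rat p" "real_of_rat q"] unfolding g_def
      by (cases "0 < real_of_rat p \<and> real_of_rat p < real_of_rat q \<and> real_of_rat q \<le> T") auto
  qed
  then have "AE x in M. \<forall>t\<^sub>0 t\<^sub>1. 0 < t\<^sub>0 \<longrightarrow> t\<^sub>0 < t\<^sub>1 \<longrightarrow> t\<^sub>1 \<le> T \<longrightarrow> g t\<^sub>0 x \<le> g t\<^sub>1 x"
    using AE_space
  proof eventually_elim
    case (elim x)
    have cont: "continuous_on {0<..T} (\<lambda>t. g t x)"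
      unfolding g_def
      by (intro continuous_intros continuous_on_subset[OF w_cont[OF elim(2)]]) auto
    show ?case
    proof (intro allI impI)
      fix t\<^sub>0 t\<^sub>1 :: real assume t: "0 < t\<^sub>0" "t\<^sub>0 < t\<^sub>1" "t\<^sub>1 \<le> T"
      define \<delta> where "\<delta> n = (t\<^sub>1 - t\<^sub>0) / 2 * (1 / real (Suc n))" for n
      have \<delta>: "0 < \<delta> n" "\<delta> n \<le> (t\<^sub>1 - t\<^sub>0) / 2" for n
      proof -
        show "0 < \<delta> n" using t by (simp add: \<delta>_def)
        have "\<delta> n \<le> (t\<^sub>1 - t\<^sub>0) / 2 * 1" unfolding \<delta>_def using t by (intro mult_left_mono) auto
        then show "\<delta> n \<le> (t\<^sub>1 - t\<^sub>0) / 2" by simp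
      qed
      have \<delta>0: "\<delta> \<longlonglongrightarrow> 0"
        using tendsto_mult_left[OF LIMSEQ_Suc[OF lim_1_over_n], of "(t\<^sub>1 - t\<^sub>0) / 2"]
        unfolding \<delta>_def[abs_def] mult_zero_right .
      have "\<forall>n. \<exists>p. t\<^sub>0 < real_of_rat p \<and> real_of_rat p < t\<^sub>0 + \<delta> n" "\<forall>n. \<exists>q. t\<^sub>1 - \<delta> n < real_of_rat q \<and> real_of_rat q < t\<^sub>1"
        using of_rat_dense[of t\<^sub>0 "t\<^sub>0 + \<delta> n" for n] of_rat_dense[of "t\<^sub>1 - \<delta> n" t\<^sub>1 for n] \<delta>(1) by auto
      then obtain p' q' where "\<And>n. t\<^sub>0 < real_of_rat (p' n)" "\<And>n. real_of_rat (p' n) < t\<^sub>0 + \<delta> n"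
        and "\<And>n. t\<^sub>1 - \<delta> n < real_of_rat (q' n)" "\<And>n. real_of_rat (q' n) < t\<^sub>1" by metis
      moreover define p q where "p n = real_of_rat (p' n)" and "q n = real_of_rat (q' n)" for n
      ultimately have p: "t\<^sub>0 < p n" "p n < t\<^sub>0 + \<delta> n" and q: "t\<^sub>1 - \<delta> n < q n" "q n < t\<^sub>1" for n by simp_all
      have pl: "p \<longlonglongrightarrow> t\<^sub>0"
        by (rule tendsto_sandwich[OF _ _ tendsto_const tendsto_add[OF tendsto_const \<delta>0, of t\<^sub>0, simplified]])
          (use p in \<open>auto intro!: always_eventually less_imp_le\<close>)
      have ql: "q \<longlonglongrightarrow> t\<^sub>1"
        by (rule tendsto_sandwich[OF _ _ tendsto_diff[OF tendsto_const \<delta>0, of t\<^sub>1, simplified] tendsto_const])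
          (use q in \<open>auto intro!: always_eventually less_imp_le\<close>)
      have pq: "0 < p n" "p n < q n" "q n \<le> T" for n
      proof -
        show "0 < p n" "q n \<le> T" using p(1)[of n] q(2)[of n] t by simp_all
        have "2 * \<delta> n \<le> t\<^sub>1 - t\<^sub>0" using \<delta>(2)[of n] by simp
        then show "p n < q n" using p(2)[of n] q(1)[of n] by linarith
      qed
      have pT: "p n \<in> {0<..T}" "q n \<in> {0<..T}" for n
        using pq[of n] by auto
      have "(\<lambda>n. g (p n) x) \<longlonglongrightarrow> g t\<^sub>0 x"
        by (rule continuous_on_tendsto_compose[OF cont pl]) (use pT t in auto)
      moreover have "(\<lambda>n. g (q n) x) \<longlonglongrightarrow> g t\<^sub>1 x"
        by (rule continuous_on_tendsto_compose[OF cont ql]) (use pT t in auto)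
      moreover have "g (p n) x \<le> g (q n) x" for n
        using elim(1) pq[of n] unfolding p_def q_def by blast
      ultimately show "g t\<^sub>0 x \<le> g t\<^sub>1 x"
        by (intro LIMSEQ_le) auto
    qed
  qed
  then show ?thesis by (simp add: g_def)
qed

lemma mono_on_if_comparison:
  assumes x: "x \<in> space M"
    and cmp: "\<And>t\<^sub>0 t\<^sub>1. 0 < t\<^sub>0 \<Longrightarrow> t\<^sub>0 < t\<^sub>1 \<Longrightarrow> t\<^sub>1 \<le> T \<Longrightarrow>
      \<theta> * (t\<^sub>0 powr (\<theta> * \<rho>) * w t\<^sub>0 x) \<le> \<theta> * (t\<^sub>1 powr (\<theta> * \<rho>) * w t\<^sub>1 x)"
  shows "mono_on (if \<theta> = 1 then {0..T} else {0<..T}) (\<lambda>t. \<theta> * t powr (\<rho> * \<theta>) * w t x)"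
proof (rule mono_onI)
  fix s t assume st: "s \<in> (if \<theta> = 1 then {0..T} else {0<..T})" "t \<in> (if \<theta> = 1 then {0..T} else {0<..T})" "s \<le> t"
  \<comment> \<open>At time \<open>0\<close>, which only occurs for \<open>\<theta> = 1\<close>, the power vanishes and \<open>w\<close> is non-negative.\<close>
  consider "s = t" | "s < t" "0 < s" | "s < t" "s = 0" "\<theta> = 1" using st by (cases "\<theta> = 1"; cases "s = t"; cases "s = 0") auto
  then show "\<theta> * s powr (\<rho> * \<theta>) * w s x \<le> \<theta> * t powr (\<rho> * \<theta>) * w t x"
  proof cases
    case 2
    then show ?thesis using cmp[of s t] st by (auto simp: mult_ac split: if_splits)
  next
    case 3
    then show ?thesis using w_nonneg[OF _ x, of t] st by simp
  qed simp
qed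

end

section \<open>Points of continuity\<close>

lemma sigma_finite_completion:
  assumes "sigma_finite_measure M"
  shows "sigma_finite_measure (completion M)"
proof -
  obtain A where A: "countable A" "A \<subseteq> sets M" "\<Union>A = space M" "\<forall>a\<in>A. emeasure M a \<noteq> \<infinity>"
    using sigma_finite_measure.sigma_finite_countable[OF assms] by blast
  show ?thesis
    by standard (use A in \<open>auto intro!: exI[of _ A] simp: subset_iff\<close>)
qed

lemma sigma_finite_leb: "sigma_finite_measure (leb d)"
proof -
  interpret product_sigma_finite "\<lambda>_ :: nat. lborel :: real measure" ..
  show ?thesis unfolding leb_def by (intro sigma_finite_completion sigma_finite) simp
qed

text \<open>
A basic open set of the product topology constrains the coordinates from \<open>d\<close> on as well, but these
are \<open>undefined\<close> for all points of the space; so it contains a box around the given point.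
\<close>

lemma open_positive_measure:
  assumes S: "open S" and x: "x \<in> S" "x \<in> space (leb d)"
  shows "\<exists>B. B \<in> sets (leb d) \<and> B \<subseteq> S \<inter> space (leb d) \<and> 0 < emeasure (leb d) B"
proof -
  interpret product_sigma_finite "\<lambda>_ :: nat. lborel :: real measure" ..
  have "openin (product_topology (\<lambda>_. euclidean) UNIV) S"
    using S by (simp add: euclidean_product_topology)
  from product_topology_open_contains_basis[OF this x(1)]
  obtain X where X: "x \<in> (\<Pi>\<^sub>E i\<in>UNIV. X i)" "\<And>i. open (X i)" "(\<Pi>\<^sub>E i\<in>UNIV. X i) \<subseteq> S" by auto
  define B where "B = (\<Pi>\<^sub>E i\<in>{..<d}. X i)"
  have xe: "x i = undefined" if "\<not> i < d" for i
    using x(2) that by (auto simp: leb_def space_PiM PiE_def extensional_def)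
  have Bm: "B \<in> sets (Pi\<^sub>M {..<d} (\<lambda>_. lborel))" unfolding B_def by (rule sets_PiM_I_finite) (use X(2) in auto)
  have BS: "B \<subseteq> S"
  proof
    fix y assume y: "y \<in> B"
    have "y i \<in> X i" for i
    proof (cases "i < d")
      case False
      then have "y i = x i" using y xe by (auto simp: B_def PiE_def extensional_def)
      then show ?thesis using X(1) by auto
    qed (use y in \<open>auto simp: B_def\<close>)
    then show "y \<in> S" using X(3) by auto
  qed
  have "emeasure lborel (X i) \<noteq> 0" for i
  proof -
    have "x i \<in> X i" using X(1) by auto
    then obtain e where e: "0 < e" "ball (x i) e \<subseteq> X i" using X(2) open_contains_ball by blast
    have "0 < emeasure lborel {x i - e<..<x i + e}" using e by simp
    also have "\<dots> \<le> emeasure lborel (X i)"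
      using e X(2)[of i] by (intro emeasure_mono) (auto simp: ball_eq_greaterThanLessThan)
    finally show ?thesis by simp
  qed
  then have "0 < (\<Prod>i<d. emeasure lborel (X i))"
    by (simp add: zero_less_iff_neq_zero)
  also have "\<dots> = emeasure (Pi\<^sub>M {..<d} (\<lambda>_. lborel)) B" unfolding B_def using X(2) by (subst emeasure_PiM) auto
  finally show ?thesis
    using Bm BS sets.sets_into_space[OF Bm] unfolding leb_def by (intro exI[of _ B]) auto
qed

lemma AE_inequality_at_continuity_point:
  fixes f g :: "(nat \<Rightarrow> real) \<Rightarrow> real"
  assumes ae: "AE x in leb d. f x \<le> g x" and x: "x \<in> space (leb d)"
    and cont: "continuous (at x within space (leb d)) f" "continuous (at x within space (leb d)) g"
  shows "f x \<le> g x"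
proof (rule ccontr)
  assume "\<not> f x \<le> g x"
  then have neg: "g x - f x < 0" by simp
  have "((\<lambda>y. g y - f y) \<longlongrightarrow> g x - f x) (at x within space (leb d))"
    using cont by (intro tendsto_intros) (auto simp: continuous_within)
  from order_tendstoD(2)[OF this neg]
  obtain S where S: "open S" "x \<in> S" "\<And>y. y \<in> S \<Longrightarrow> y \<noteq> x \<Longrightarrow> y \<in> space (leb d) \<Longrightarrow> g y - f y < 0"
    by (auto simp: eventually_at_topological)
  obtain B where B: "B \<in> sets (leb d)" "B \<subseteq> S \<inter> space (leb d)" "0 < emeasure (leb d) B"
    using open_positive_measure[OF S(1,2) x] by blast
  have "AE y in leb d. y \<notin> B"
    using ae
  proof eventually_elim
    case (elim y)
    then show ?case using S(3)[of y] neg B(2) by (cases "y = x") auto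
  qed
  then have "B \<in> null_sets (leb d)" using B(1) by (subst AE_iff_null_sets) auto
  then show False using B(3) by auto
qed

theorem theorem2p2:
  fixes m L T :: real
  assumes "0 < m" and "0 < L" and "0 < T"
  shows "\<exists>\<rho>>0. \<forall>(d::nat) A \<kappa> \<phi> u (\<theta>::real).
           0 < d \<and>
           linear_operator_L1 (leb d) A \<and>
           densely_defined_L1 (leb d) A \<and>
           m_accretive_L1 (leb d) A \<and>
           property_P (leb d) A \<and>
           \<theta> \<in> {-1, 1} \<and>
           admissible_nonlinearity m \<theta> \<phi> \<and>
           admissible_coefficient (leb d) T L \<kappa> \<and>
           (\<forall>t \<in> {0..T}. u t \<in> L1 (leb d) \<inter> Linf (leb d)) \<and>
           (\<forall>t \<in> {0..T}. \<forall>x \<in> space (leb d). 0 \<le> u t x) \<and>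
           classical_solution (leb d) A \<kappa> \<phi> T u
           \<longrightarrow>
           (let I = (if \<theta> = 1 then {0..T} else {0<..T});
                w = (\<lambda>t x. \<kappa> t x * \<phi> (u t x));
                nondecreasing_at = (\<lambda>x. mono_on I (\<lambda>t. \<theta> * t powr (\<rho> * \<theta>) * w t x))
            in (AE x in leb d. nondecreasing_at x) \<and>
               (\<forall>x \<in> space (leb d).
                  (\<forall>t \<in> I. continuous (at x within space (leb d)) (w t)) \<longrightarrow> nondecreasing_at x))"
proof (intro exI[of _ "decay_exponent m L T"] conjI allI impI, goal_cases)
  case 1
  have "0 \<le> log_slope_bound L T" "0 \<le> log_slope_lipschitz L T"
    using assms by (auto simp: log_slope_bound_def log_slope_lipschitz_def)
  moreover from this have "0 \<le> (log_slope_bound L T + 2) / m" using assms by simp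
  ultimately show ?case by (simp add: decay_exponent_def)
next
  case (2 d A \<kappa> \<phi> u \<theta>)
  then have lin: "linear_operator_L1 (leb d) A" and P: "property_P (leb d) A" and th: "\<theta> \<in> {-1, 1}"
    and adm: "admissible_nonlinearity m \<theta> \<phi>" and coeff: "admissible_coefficient (leb d) T L \<kappa>"
    and uL: "\<And>t. t \<in> {0..T} \<Longrightarrow> u t \<in> L1 (leb d) \<inter> Linf (leb d)"
    and u0: "\<And>t x. t \<in> {0..T} \<Longrightarrow> x \<in> space (leb d) \<Longrightarrow> 0 \<le> u t x"
    and sol: "classical_solution (leb d) A \<kappa> \<phi> T u" by blast+
  obtain \<kappa>\<^sub>t \<kappa>\<^sub>t\<^sub>t where \<kappa>: "\<forall>t \<in> {0..T}. \<forall>x \<in> space (leb d).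
        ((\<lambda>s. \<kappa> s x) has_real_derivative \<kappa>\<^sub>t t x) (at t within {0..T}) \<and>
        ((\<lambda>s. \<kappa>\<^sub>t s x) has_real_derivative \<kappa>\<^sub>t\<^sub>t t x) (at t within {0..T}) \<and>
        0 < \<kappa> t x \<and> \<kappa> t x \<le> L \<and> inverse (\<kappa> t x) \<le> L \<and>
        \<bar>\<kappa>\<^sub>t t x\<bar> \<le> L \<and> \<bar>\<kappa>\<^sub>t\<^sub>t t x\<bar> \<le> L"
    using coeff unfolding admissible_coefficient_def by blast
  obtain u\<^sub>t where u\<^sub>t: "\<forall>t \<in> {0..T}. \<forall>x \<in> space (leb d). ((\<lambda>s. u s x) has_real_derivative u\<^sub>t t x) (at t within {0..T})"
      "\<forall>t \<in> {0..T}. ((\<lambda>x. \<kappa> t x * \<phi> (u t x)), (\<lambda>x. - u\<^sub>t t x)) \<in> A"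
      "\<forall>t \<in> {0<..T}. ((\<lambda>s. norm1 (leb d) (\<lambda>x. u\<^sub>t s x - u\<^sub>t t x)) \<longlongrightarrow> 0) (at t within {0<..T})"
    using sol unfolding classical_solution_def by blast
  interpret S: sigma_finite_measure "leb d" by (rule sigma_finite_leb)
  interpret S: classical_setting m \<theta> \<phi> "leb d" L T A \<kappa> \<kappa>\<^sub>t \<kappa>\<^sub>t\<^sub>t u u\<^sub>t
  proof
    show "\<kappa> t \<in> borel_measurable (leb d)" if "t \<in> {0..T}" for t
      using coeff that unfolding admissible_coefficient_def by blast
  qed (use assms lin P th adm uL u0 \<kappa> u\<^sub>t in blast)+
  have w: "S.w = (\<lambda>t x. \<kappa> t x * \<phi> (u t x))" by (simp add: S.w_def fun_eq_iff)
  show ?case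
    unfolding Let_def w[symmetric]
  proof (intro conjI ballI impI)
    show "AE x in leb d. mono_on (if \<theta> = 1 then {0..T} else {0<..T}) (\<lambda>t. \<theta> * t powr (decay_exponent m L T * \<theta>) * S.w t x)"
      using S.comparison_all AE_space by eventually_elim (rule S.mono_on_if_comparison, auto)
    fix x assume x: "x \<in> space (leb d)"
      and cont: "\<forall>t \<in> (if \<theta> = 1 then {0..T} else {0<..T}). continuous (at x within space (leb d)) (S.w t)"
    have c: "continuous (at x within space (leb d)) (S.w t)" if "0 < t" "t \<le> T" for t using cont that by auto
    show "mono_on (if \<theta> = 1 then {0..T} else {0<..T}) (\<lambda>t. \<theta> * t powr (decay_exponent m L T * \<theta>) * S.w t x)"
    proof (rule S.mono_on_if_comparison[OF x])
      fix t\<^sub>0 t\<^sub>1 :: real assume t: "0 < t\<^sub>0" "t\<^sub>0 < t\<^sub>1" "t\<^sub>1 \<le> T"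
      show "\<theta> * (t\<^sub>0 powr (\<theta> * decay_exponent m L T) * S.w t\<^sub>0 x) \<le> \<theta> * (t\<^sub>1 powr (\<theta> * decay_exponent m L T) * S.w t\<^sub>1 x)"
        by (rule AE_inequality_at_continuity_point[OF S.comparison_pair[OF t] x])
          (use c t in \<open>auto intro!: continuous_intros\<close>)
    qed
  qed
qed

end
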